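(* Let $f^\flat(x)=\sum_{n\ge0}A_n^\flat x^n$ be the entire function attached to the Riemann Xi function, let $B_y(f^\flat)(x)=\sum_{n\ge0}A_n^\flat x^ny^{n(n+1)/2}$, and let $$\Theta=\sup\{y\in[0,+\infty)\;:\; B_y(f^\flat)\text{ is an entire function and has only real zeros}\}.$$ Let $\rho_o$ be the positive root of $\sum_{k=1}^\infty\rho^{k^2}=\tfrac12$. Then: i) If $0\le y\le\Theta$, then $B_y(f^\flat)$ is $L_1$, and thus has only negative zeros. ii) If $\Theta<1$ and $\Theta<y\le1$, then $B_y(f^\flat)$ is an entire function with at least two non-real zeros. iii) If $y>1$, the radius of convergence of the power series $B_y(f^\flat)$ (in $x$) is zero. iv) $\Theta=1$ if and only if the Riemann hypothesis is true. v) $0<\rho_o^2<1/4\le\Theta\le1$.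
   Context: The Riemann Xi function is $\Xi(z)=\tfrac12 s(s-1)\pi^{-s/2}\Gamma(s/2)\zeta(s)$ with $s=\tfrac12+iz$. It is entire, and $\Xi(z)=\sum_{n\ge0}(-1)^nA_n^\flat z^{2n}$ with all $A_n^\flat>0$; put $f^\flat(x)=\Xi(-i\sqrt{x})=\sum_{n\ge0}A_n^\flat x^n$, an entire function. The Riemann hypothesis is the assertion that all zeros of $\Xi$ are real (equivalently, all zeros of $f^\flat$ are negative real numbers). An entire function $f$ is called $L_1$ (first type of Laguerre) if it can be written $f(x)=Cx^me^{\sigma x}\prod_{p\ge1}(1+a_px)$ with $C,\sigma,a_p\ge0$, $m\in\mathbb{N}$ (including $0$), and $\sum_{p\ge1}a_p<+\infty$ (finite products allowed, e.g. with $a_p=0$ for large $p$). For $y=0$ the convention is $B_0(f)(x)=A_0$. *)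

theory Defs
  imports "HOL-Complex_Analysis.Complex_Analysis"
begin

text \<open>
  The Riemann zeta function is the analytic continuation of the Dirichlet series to the complex
  plane without the point 1, which is unique because that domain is connected. The value at the
  pole is set to 0 so that the function is determined everywhere.
\<close>
definition riemann_zeta :: "complex \<Rightarrow> complex" where
  "riemann_zeta = (THE f. f holomorphic_on (- {1}) \<and>
     (\<forall>s. Re s > 1 \<longrightarrow> (\<lambda>n. 1 / of_nat (Suc n) powr s) sums f s) \<and> f 1 = 0)"

text \<open>
  The defining product has removable singularities at the pole of zeta (\<open>s = 1\<close>) and at the poles
  of \<open>Gamma (s / 2)\<close> (\<open>s = 0, -2, -4, \<dots>\<close>), where the library functions take the value 0;
  \<^const>\<open>remove_sings\<close> replaces these values by the limits.
\<close>
definition riemann_Xi :: "complex \<Rightarrow> complex" where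
  "riemann_Xi = remove_sings (\<lambda>z. let s = 1 / 2 + \<i> * z in
     1 / 2 * s * (s - 1) * of_real pi powr (- s / 2) * Gamma (s / 2) * riemann_zeta s)"

definition riemann_hypothesis :: bool where
  "riemann_hypothesis \<longleftrightarrow> (\<forall>z. riemann_Xi z = 0 \<longrightarrow> z \<in> \<real>)"

text \<open>Since \<^const>\<open>riemann_Xi\<close> is even, the choice of the branch of the square root is immaterial.\<close>
definition f_flat :: "complex \<Rightarrow> complex" where
  "f_flat x = riemann_Xi (- \<i> * csqrt x)"

text \<open>
  For \<open>f x = (\<Sum>n. A n * x ^ n)\<close> this is the power series with coefficients
  \<open>A n * y ^ (n * (n + 1) / 2)\<close>. It is a formal power series because its radius of convergence may
  vanish. As \<open>0 ^ 0 = 1\<close>, the series for \<open>y = 0\<close> is the constant \<open>A 0\<close>.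
\<close>
definition B_series :: "real \<Rightarrow> (complex \<Rightarrow> complex) \<Rightarrow> complex fps" where
  "B_series y f =
     Abs_fps (\<lambda>n. fps_nth (fps_expansion f 0) n * of_real (y ^ (n * (n + 1) div 2)))"

definition entire_fps :: "complex fps \<Rightarrow> bool" where
  "entire_fps F \<longleftrightarrow> fps_conv_radius F = \<infinity>"

definition only_real_zeros :: "(complex \<Rightarrow> complex) \<Rightarrow> bool" where
  "only_real_zeros f \<longleftrightarrow> (\<forall>x. f x = 0 \<longrightarrow> x \<in> \<real>)"

definition laguerre_L1 :: "(complex \<Rightarrow> complex) \<Rightarrow> bool" where
  "laguerre_L1 f \<longleftrightarrow> f holomorphic_on UNIV \<and>
     (\<exists>(C::real) (\<sigma>::real) (m::nat) (a::nat \<Rightarrow> real).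
        C \<ge> 0 \<and> \<sigma> \<ge> 0 \<and> (\<forall>p. a p \<ge> 0) \<and> summable a \<and>
        (\<forall>x. f x = of_real C * x ^ m * exp (of_real \<sigma> * x) * (\<Prod>p. 1 + of_real (a p) * x)))"

text \<open>The set is bounded above, since the series has radius of convergence 0 for \<open>y > 1\<close>.\<close>
definition Theta :: real where
  "Theta = Sup {y. 0 \<le> y \<and> entire_fps (B_series y f_flat) \<and>
                   only_real_zeros (eval_fps (B_series y f_flat))}"

definition rho_o :: real where
  "rho_o = (THE \<rho>. \<rho> > 0 \<and> (\<lambda>k. \<rho> ^ ((Suc k)\<^sup>2)) sums (1 / 2))"

end

theory Submission
  imports Defs "HOL-Computational_Algebra.Fundamental_Theorem_Algebra"
    "HOL-Real_Asymp.Real_Asymp" "HOL-Probability.Distributions"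
begin

text \<open>
  Call a sequence of coefficients negative-rooted if it is a coefficientwise limit of polynomials
  \<open>C \<Prod>(1 + a\<^sub>j x)\<close> with \<open>C > 0\<close> and \<open>a\<^sub>j > 0\<close>. The first two coefficients control \<open>\<Sum>a\<^sub>j\<close>, so by
  compactness the power series of such a sequence is in the class \<open>L\<^sub>1\<close>. Conversely, an entire
  function with only negative zeros and with \<open>log M(r) = o(r)\<close> has negative-rooted coefficients:
  divided by the polynomial of its zeros in the disc of radius \<open>R\<close> it tends to a constant as \<open>R\<close>
  grows, by the maximum principle and the Borel-Caratheodory inequality. Negative-rooted sequences
  are closed under pointwise limits and under multiplication by \<open>q\<^bsup>n(n+1)/2\<^esup>\<close> for \<open>0 \<le> q \<le> 1\<close>
  (Laguerre). As \<open>B\<^sub>y\<close> and \<open>B\<^sub>z\<close> compose to \<open>B\<^sub>y\<^sub>z\<close>, the set defining \<open>\<Theta>\<close> is the closed interval from 0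
  to \<open>\<Theta>\<close>.

  For \<open>\<Xi>\<close> itself, the inversion formula of the theta function yields
  \<open>\<Xi>(z) = \<integral> \<Phi>(t) exp (i z t) dt\<close> with an even positive kernel \<open>\<Phi>\<close> of doubly exponential decay. Hence
  \<open>A\<^sub>n = \<integral> \<Phi>(t) t\<^bsup>2n\<^esup> dt / (2 n)!\<close>, which gives the growth of \<open>f\<^sup>\<flat>\<close> and the divergence for \<open>y > 1\<close>.
  The kernel is log-concave, hence so is \<open>A\<^sub>n\<close>, and Hutchinson's condition
  \<open>a\<^sub>n\<^sup>2 > 4 a\<^bsub>n-1\<^esub> a\<^bsub>n+1\<^esub>\<close> holds for the coefficients of \<open>B\<^sub>y f\<^sup>\<flat>\<close> as soon as \<open>y < 1/4\<close>.
\<close>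

section \<open>Polynomials with negative zeros\<close>

text \<open>Real-rootedness is recorded on coefficients alone. Closure under limits in
  \<open>y\<close> is then immediate: the supremum is attained, and 1/4 is reached although
  log-concavity of A_n yields Hutchinson's strict inequality only for y < 1/4. The constant 4 meets
  the exponent n(n+1)/2 because the second difference of the triangular numbers is 1: passing from
  A_n to A_n y^(n(n+1)/2) multiplies the quotient a_n^2 / (a_{n-1} a_{n+1}) by 1/y, and
  log-concavity says that it starts from at least 1. Log-concavity of A_n is inherited from the
  kernel by comparison with two-sided exponentials, whose normalized even moments are geometric, the
  case of equality. The coefficients are nonnegative with a positive constant term, so real zeros
  are automatically negative; they are real, so nonreal zeros come in conjugate pairs. Zeta enters
  only through its definite description, so the integral of the kernel also has to supply its
  continuation.\<close>

definition neg_rooted :: "complex poly \<Rightarrow> bool" where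
  "neg_rooted p \<longleftrightarrow> (\<exists>(C::real) as. C > 0 \<and> (\<forall>a\<in>set as. (0::real) < a) \<and>
     p = smult (of_real C) (\<Prod>a\<leftarrow>as. [:1, of_real a:]))"

text \<open>Induction on the degree: a root \<open>-r\<close> is split off as the factor
  \<open>1 + x/r\<close>, and the cofactor is rescaled by \<open>r\<close> so that its constant term
  is again \<open>C\<close>.\<close>

lemma neg_rootedI_roots:
  assumes "coeff p 0 = of_real C" "(C::real) > 0"
    and "\<And>z. poly p z = 0 \<Longrightarrow> z \<in> \<real> \<and> Re z < 0"
  shows "neg_rooted p"
  using assms
proof (induction "degree p" arbitrary: p)
  case 0
  then have "p = [:of_real C:]"
    by (metis degree_eq_zeroE coeff_pCons_0)
  then show ?case
    unfolding neg_rooted_def using 0 by (intro exI[of _ C] exI[of _ "[]"]) auto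
next
  case (Suc d)
  obtain z where z: "poly p z = 0"
    using Suc.hyps(2) alg_closed_imp_poly_has_root[of p] by auto
  define r where "r = - Re z"
  have r: "r > 0" "z = - of_real r"
    using Suc.prems(3)[OF z] by (auto simp: r_def complex_eq_iff complex_is_Real_iff)
  obtain q where q: "p = [:- z, 1:] * q"
    using z by (metis poly_eq_0_iff_dvd dvdE)
  define q' where "q' = smult (of_real r) q"
  have p: "p = [:1, of_real (1 / r):] * q'"
    unfolding q q'_def using r by (simp add: field_simps)
  have "q \<noteq> 0" using Suc.hyps(2) q by auto
  then have deg: "degree p = Suc (degree q')"
    unfolding q q'_def using r by (subst degree_mult_eq) auto
  have "neg_rooted q'"
  proof (rule Suc.hyps(1))
    show "d = degree q'" using deg Suc.hyps(2) by simp
    show "coeff q' 0 = of_real C" using Suc.prems(1) unfolding p by (simp add: coeff_mult)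
    show "\<And>z. poly q' z = 0 \<Longrightarrow> z \<in> \<real> \<and> Re z < 0"
      using Suc.prems(3) unfolding p by auto
  qed fact
  then obtain D as where "D > 0" "\<forall>a\<in>set as. (0::real) < a"
    "q' = smult (of_real D) (\<Prod>a\<leftarrow>as. [:1, of_real a:])"
    unfolding neg_rooted_def by blast
  then show ?case
    unfolding neg_rooted_def p using r
    by (intro exI[of _ D] exI[of _ "(1/r) # as"]) (auto simp: mult_ac)
qed

lemma poly_prod_linear:
  "poly (\<Prod>a\<leftarrow>as. [:1, of_real a:]) z = (\<Prod>a\<leftarrow>as. 1 + of_real a * (z::complex))"
  by (induction as) (auto simp: algebra_simps)

lemma coeff_prod_linear_nonneg:
  "\<forall>a\<in>set as. (0::real) < a \<Longrightarrow> coeff (\<Prod>a\<leftarrow>as. [:1, of_real a:]) n \<in> (\<real>\<^sub>\<ge>\<^sub>0 :: complex set)"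
proof (induction as arbitrary: n)
  case Nil
  show ?case by (cases n) auto
next
  case (Cons a as)
  then have IH: "coeff (\<Prod>a\<leftarrow>as. [:1, of_real a:]) n \<in> (\<real>\<^sub>\<ge>\<^sub>0 :: complex set)" for n by simp
  have "(of_real a :: complex) \<in> \<real>\<^sub>\<ge>\<^sub>0" using Cons.prems by simp
  then show ?case using IH
    by (cases n) (auto simp: intro!: nonneg_Reals_add_I nonneg_Reals_mult_I)
qed

text \<open>The coefficient is an elementary symmetric polynomial, and each of its monomials occurs
  n! times in the n-th power of the sum. The bound depends on the factors only through their sum,
  hence is uniform along sequences of polynomials with bounded sums.\<close>

lemma norm_coeff_prod_linear_le:
  "\<forall>a\<in>set as. (0::real) < a \<Longrightarrow>
     norm (coeff (\<Prod>a\<leftarrow>as. [:1, of_real a :: complex:]) n) \<le> sum_list as ^ n / fact n"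
proof (induction as arbitrary: n)
  case Nil
  show ?case by (cases n) auto
next
  case (Cons a as)
  let ?P = "\<Prod>a\<leftarrow>as. [:1, of_real a :: complex:]"
  let ?s = "sum_list as"
  have a: "a > 0" and s: "?s \<ge> 0" using Cons.prems by (auto intro!: sum_list_nonneg)
  have IH: "norm (coeff ?P n) \<le> ?s ^ n / fact n" for n using Cons by simp
  show ?case
  proof (cases n)
    case 0
    then show ?thesis using IH[of 0] by simp
  next
    case (Suc m)
    have "norm (coeff (\<Prod>a\<leftarrow>(a # as). [:1, of_real a :: complex:]) n)
        = norm (coeff ?P (Suc m) + of_real a * coeff ?P m)"
      by (simp add: Suc)
    also have "\<dots> \<le> norm (coeff ?P (Suc m)) + a * norm (coeff ?P m)"
      using a by (intro norm_triangle_le) (simp add: norm_mult)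
    also have "\<dots> \<le> ?s ^ Suc m / fact (Suc m) + a * (?s ^ m / fact m)"
      using a by (intro add_mono mult_left_mono IH) auto
    also have "\<dots> = (?s ^ Suc m + real (Suc m) * a * ?s ^ m) / fact (Suc m)"
      by (simp add: field_simps del: of_nat_Suc)
    \<comment> \<open>The left-hand side consists of the terms k = 0 and k = 1 of the binomial
      expansion.\<close>
    also have "?s ^ Suc m + real (Suc m) * a * ?s ^ m \<le> (a + ?s) ^ Suc m"
    proof -
      have "(a + ?s) ^ Suc m = (\<Sum>k\<le>Suc m. of_nat (Suc m choose k) * a ^ k * ?s ^ (Suc m - k))"
        by (rule binomial_ring)
      also have "\<dots> \<ge> (\<Sum>k\<in>{0,1}. of_nat (Suc m choose k) * a ^ k * ?s ^ (Suc m - k))"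
        using a s by (intro sum_mono2) auto
      finally show ?thesis by simp
    qed
    finally show ?thesis by (simp add: Suc divide_right_mono)
  qed
qed

text \<open>Each map z -> a z / (1 + a z) with a > 0 preserves the upper half-plane: the imaginary
  part is a Im z / |1 + a z|^2. The sum is x p'/p for the product p of the linear factors.\<close>

lemma sum_list_Im_pos:
  assumes "\<forall>a\<in>set as. (0::real) < a" "as \<noteq> []" "Im z > 0"
  shows "Im (\<Sum>a\<leftarrow>as. of_real a * z / (1 + of_real a * z)) > 0"
proof -
  have *: "Im (of_real a * z / (1 + of_real a * z)) > 0" if a: "a > 0" for a
  proof -
    have "1 + of_real a * z \<noteq> 0"
      using a assms(3) by (auto simp: complex_eq_iff)
    then have "(1 + a * Re z)\<^sup>2 + (a * Im z)\<^sup>2 > 0"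
      using a assms(3) by (intro add_nonneg_pos) auto
    moreover have "a * Im z * (1 + a * Re z) - a * Re z * (a * Im z) = a * Im z"
      by (simp add: algebra_simps)
    ultimately show ?thesis
      using a assms(3) by (simp add: Im_divide)
  qed
  show ?thesis using assms(1,2)
  proof (induction as)
    case (Cons a as)
    show ?case
    proof (cases "as = []")
      case True
      then show ?thesis using *[of a] Cons.prems by simp
    next
      case False
      then show ?thesis using *[of a] Cons by (auto intro: add_pos_pos)
    qed
  qed simp
qed

lemma pderiv_prod_linear:
  assumes "\<And>a. a \<in> set as \<Longrightarrow> 1 + of_real a * z \<noteq> 0"
  shows "z * poly (pderiv (\<Prod>a\<leftarrow>as. [:1, of_real a:])) z
    = poly (\<Prod>a\<leftarrow>as. [:1, of_real a:]) z * (\<Sum>a\<leftarrow>as. of_real a * z / (1 + of_real a * (z::complex)))"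
  using assms
proof (induction as)
  case (Cons a as)
  let ?P = "\<Prod>a\<leftarrow>as. [:1, of_real a:] :: complex poly"
  have nz: "1 + of_real a * z \<noteq> 0" using Cons.prems by simp
  have IH: "z * poly (pderiv ?P) z = poly ?P z * (\<Sum>a\<leftarrow>as. of_real a * z / (1 + of_real a * z))"
    using Cons by simp
  have "z * poly (pderiv (\<Prod>a\<leftarrow>(a # as). [:1, of_real a:])) z =
      (1 + of_real a * z) * (z * poly (pderiv ?P) z) + of_real a * z * poly ?P z"
    by (simp add: pderiv_mult pderiv_pCons algebra_simps del: mult_pCons_left)
  also have "\<dots> = (1 + of_real a * z) * poly ?P z * (of_real a * z / (1 + of_real a * z) + (\<Sum>a\<leftarrow>as. of_real a * z / (1 + of_real a * z)))"
    unfolding IH distrib_left using nz by (simp add: mult.commute mult.left_commute)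
  also have "\<dots> = poly (\<Prod>a\<leftarrow>(a # as). [:1, of_real a:]) z * (\<Sum>a\<leftarrow>(a#as). of_real a * z / (1 + of_real a * z))"
    by (simp add: algebra_simps)
  finally show ?case .
qed simp

section \<open>Multiplier sequences that preserve negative zeros\<close>

lemma coeff_Euler_op:
  "coeff (p + smult (of_real m) (pCons 0 (pderiv p))) n = (1 + of_real m * of_nat n) * coeff (p :: complex poly) n"
  by (cases n) (auto simp: coeff_pderiv algebra_simps)

lemma degree_prod_linear:
  "\<forall>a\<in>set as. (0::real) < a \<Longrightarrow> degree (\<Prod>a\<leftarrow>as. [:1, of_real a:] :: complex poly) = length as"
proof (induction as)
  case (Cons a as)
  have nz: "(\<Prod>a\<leftarrow>as. [:1, of_real a:] :: complex poly) \<noteq> 0"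
    by (auto simp: prod_list_zero_iff)
  have "degree (\<Prod>a\<leftarrow>(a # as). [:1, of_real a:] :: complex poly) =
     degree [:1, of_real a :: complex:] + degree (\<Prod>a\<leftarrow>as. [:1, of_real a:] :: complex poly)"
    unfolding list.map prod_list.Cons using nz by (intro degree_mult_eq) auto
  then show ?case using Cons by simp
qed simp

text \<open>
  Off the real axis \<open>x p' / p\<close> has an imaginary part of the sign of \<open>Im x\<close>, so that
  \<open>p + m x p'\<close> has no zero there, whatever the sign of \<open>m\<close>.
\<close>
lemma neg_rooted_Euler_op:
  fixes m :: real
  assumes "neg_rooted p" "1 + m * degree p > 0"
  shows "neg_rooted (p + smult (of_real m) (pCons 0 (pderiv p)))" (is "neg_rooted ?q")
proof -
  obtain C as where C: "C > 0" and as: "\<forall>a\<in>set as. (0::real) < a"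
    and p: "p = smult (of_real C) (\<Prod>a\<leftarrow>as. [:1, of_real a:])"
    using assms(1) unfolding neg_rooted_def by blast
  let ?P = "\<Prod>a\<leftarrow>as. [:1, of_real a:] :: complex poly"
  have coeff_q: "coeff ?q n = (1 + of_real m * of_nat n) * coeff p n" for n
    by (rule coeff_Euler_op)
  have "coeff ?P 0 = 1" by (induction as) auto
  then have q0: "coeff ?q 0 = of_real C" using p coeff_q[of 0] by simp
  have deg: "degree p = length as" using p C degree_prod_linear[OF as] by simp
  show ?thesis
  proof (cases "as = [] \<or> m = 0")
    case True
    then have "?q = p" using p by (auto simp: pderiv_pCons)
    then show ?thesis using assms(1) by metis
  next
    case False
    show ?thesis
    proof (rule neg_rootedI_roots[OF q0 C])
      fix z assume z: "poly ?q z = 0"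
      have "z \<in> \<real>"
      proof (rule ccontr)
        assume "z \<notin> \<real>"
        then have Im: "Im z \<noteq> 0" by (simp add: complex_is_Real_iff)
        define L where "L = (\<Sum>a\<leftarrow>as. of_real a * z / (1 + of_real a * z))"
        have nz: "1 + of_real a * z \<noteq> 0" if "a \<in> set as" for a
          using as that Im by (auto simp: complex_eq_iff)
        then have Pnz: "poly ?P z \<noteq> 0" by (auto simp: poly_prod_linear prod_list_zero_iff)
        have pd: "z * poly (pderiv ?P) z = poly ?P z * L"
          unfolding L_def by (rule pderiv_prod_linear) (rule nz)
        have "Im L \<noteq> 0"
        proof (cases "Im z > 0")
          case True
          then show ?thesis unfolding L_def using sum_list_Im_pos[OF as _ True] False by auto
        next
          case f: False
          have "cnj L = (\<Sum>a\<leftarrow>as. of_real a * cnj z / (1 + of_real a * cnj z))"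
            unfolding L_def by (induction as) auto
          moreover have "Im \<dots> > 0" using f Im False by (intro sum_list_Im_pos as) auto
          ultimately show ?thesis by (metis cnj.sel(2) neg_0_less_iff_less less_irrefl)
        qed
        have "poly ?q z = poly p z + of_real m * (of_real C * (z * poly (pderiv ?P) z))"
          by (simp add: p pderiv_smult mult.left_commute)
        also have "\<dots> = of_real C * poly ?P z * (1 + of_real m * L)"
          unfolding pd by (simp add: p ring_distribs mult_ac)
        finally have "1 + of_real m * L = 0" using z C Pnz by auto
        then have "m * Im L = 0" by (simp add: complex_eq_iff)
        then show False using False \<open>Im L \<noteq> 0\<close> by simp
      qed
      then obtain x where x: "z = of_real x" by (auto elim: Reals_cases)
      have "x < 0"
      proof (rule ccontr)
        assume "\<not> x < 0"
        then have x0: "x \<ge> 0" by simp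
        \<comment> \<open>For negative \<open>m\<close> the hypothesis on the degree keeps the
          multipliers 1 + m n nonnegative up to the degree. With nonnegative coefficients and a
          positive constant term no zero can be >= 0.\<close>
        have nn: "coeff ?q n \<in> \<real>\<^sub>\<ge>\<^sub>0" for n
        proof (cases "n \<le> degree p")
          case True
          have "1 + m * n \<ge> 0"
          proof (cases "m \<ge> 0")
            case False
            then have "m * n \<ge> m * degree p" using True by (intro mult_left_mono_neg) auto
            then show ?thesis using assms(2) by linarith
          qed simp
          then have "(of_real (1 + m * n) :: complex) \<in> \<real>\<^sub>\<ge>\<^sub>0"
            by (simp only: nonneg_Reals_of_real_iff)
          then have "of_real (1 + m * n) * (of_real C * coeff ?P n) \<in> \<real>\<^sub>\<ge>\<^sub>0"
            using C coeff_prod_linear_nonneg[OF as] by (intro nonneg_Reals_mult_I) auto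
          then show ?thesis unfolding coeff_q by (simp add: p)
        next
          case False
          then show ?thesis unfolding coeff_q by (simp add: coeff_eq_0)
        qed
        have nn': "Re (coeff ?q n) \<ge> 0" for n
          using nn[of n] by (auto simp: complex_nonneg_Reals_iff simp del: coeff_add)
        have "Re (poly ?q z) = (\<Sum>i\<le>degree ?q. Re (coeff ?q i) * x ^ i)"
          unfolding poly_altdef x by (simp del: coeff_add flip: of_real_power)
        also have "\<dots> \<ge> (\<Sum>i\<in>{0}. Re (coeff ?q i) * x ^ i)"
          using nn' x0 by (intro sum_mono2) (auto simp del: coeff_add)
        also have "(\<Sum>i\<in>{0}. Re (coeff ?q i) * x ^ i) = C" using q0 by simp
        finally have "C \<le> Re (poly ?q z)" .
        then show False unfolding z using C by simp
      qed
      then show "z \<in> \<real> \<and> Re z < 0" using x by simp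
    qed
  qed
qed

text \<open>Asking only for finitely many coefficients up to an error makes closure under limits a
  two-step estimate instead of a diagonal argument. Convergence as functions is not demanded; it is
  derived later from the first two coefficients.\<close>

definition neg_rooted_limit :: "(nat \<Rightarrow> complex) \<Rightarrow> bool" where
  "neg_rooted_limit A \<longleftrightarrow>
     (\<forall>N. \<forall>e>0. \<exists>p. neg_rooted p \<and> (\<forall>n\<le>N. norm (coeff p n - A n) < e))"

lemma neg_rooted_limit_tendstoI:
  assumes "\<forall>\<^sub>F k in F. neg_rooted_limit (p k)" "\<And>n. ((\<lambda>k. p k n) \<longlongrightarrow> A n) F" "F \<noteq> bot"
  shows "neg_rooted_limit A"
  unfolding neg_rooted_limit_def
proof safe
  fix N :: nat and e :: real assume e: "e > 0"
  have "\<forall>\<^sub>F k in F. dist (p k n) (A n) < e / 2" for n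
    using assms(2)[of n] e by (intro tendstoD) auto
  then have "\<forall>\<^sub>F k in F. \<forall>n\<in>{..N}. dist (p k n) (A n) < e / 2"
    by (intro eventually_ball_finite) auto
  then have "\<forall>\<^sub>F k in F. neg_rooted_limit (p k) \<and> (\<forall>n\<in>{..N}. dist (p k n) (A n) < e / 2)"
    using assms(1) by eventually_elim auto
  then obtain k where k: "neg_rooted_limit (p k)" "\<forall>n\<in>{..N}. dist (p k n) (A n) < e / 2"
    using assms(3) eventually_happens by blast
  then obtain q where q: "neg_rooted q" "\<forall>n\<le>N. norm (coeff q n - p k n) < e / 2"
    unfolding neg_rooted_limit_def using e by (meson half_gt_zero)
  have "norm (coeff q n - A n) < e" if "n \<le> N" for n
    using q(2) k(2) that dist_triangle_half_r[of "p k n" "coeff q n" e "A n"]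
    by (auto simp: dist_norm norm_minus_commute)
  then show "\<exists>p. neg_rooted p \<and> (\<forall>n\<le>N. norm (coeff p n - A n) < e)" using q by blast
qed

lemma neg_rooted_limit_coeff: "neg_rooted p \<Longrightarrow> neg_rooted_limit (coeff p)"
  unfolding neg_rooted_limit_def by (intro allI impI exI[of _ p]) auto

lemma neg_rooted_limit_obtain:
  assumes "neg_rooted_limit A"
  obtains p where "\<And>k. neg_rooted (p k)" "\<And>n. (\<lambda>k. coeff (p k) n) \<longlonglongrightarrow> A n"
proof -
  have "\<exists>p. \<forall>k. neg_rooted (p k) \<and> (\<forall>n\<le>k. norm (coeff (p k) n - A n) < 1 / Suc k)"
    using assms unfolding neg_rooted_limit_def by (intro choice allI) auto
  then obtain p where p: "\<And>k. neg_rooted (p k)"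
    "\<And>k n. n \<le> k \<Longrightarrow> norm (coeff (p k) n - A n) < 1 / Suc k" by blast
  have "(\<lambda>k. coeff (p k) n) \<longlonglongrightarrow> A n" for n
  proof (rule LIM_zero_cancel, rule Lim_null_comparison)
    show "\<forall>\<^sub>F k in sequentially. norm (coeff (p k) n - A n) \<le> 1 / Suc k"
      using eventually_ge_at_top[of n] by eventually_elim (use p(2) in \<open>auto intro: less_imp_le\<close>)
    show "(\<lambda>k. 1 / real (Suc k)) \<longlonglongrightarrow> 0"
      by (rule LIMSEQ_Suc[OF lim_1_over_n])
  qed
  then show thesis using p(1) that by blast
qed

text \<open>Dilations account for the linear part of the exponent n(n+1)/2.\<close>

lemma neg_rooted_scale:
  assumes "neg_rooted p" "(r::real) > 0"
  shows "neg_rooted (p \<circ>\<^sub>p [:0, of_real r:])"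
proof -
  obtain C as where C: "C > 0" and as: "\<forall>a\<in>set as. (0::real) < a"
    and p: "p = smult (of_real C) (\<Prod>a\<leftarrow>as. [:1, of_real a:])"
    using assms(1) unfolding neg_rooted_def by blast
  have lin: "[:1, of_real a:] \<circ>\<^sub>p [:0, of_real r:] = [:1, of_real (r * a) :: complex:]" for a
    by (simp add: pcompose_pCons mult_ac)
  have "(\<Prod>a\<leftarrow>as. [:1, of_real a:] :: complex poly) \<circ>\<^sub>p [:0, of_real r:] =
        (\<Prod>a\<leftarrow>map ((*) r) as. [:1, of_real a:])"
    by (induction as) (simp_all add: pcompose_mult lin pcompose_1 del: mult_pCons_left mult_pCons_right)
  then show ?thesis unfolding neg_rooted_def
    using C as assms(2) by (intro exI[of _ C] exI[of _ "map ((*) r) as"]) (auto simp: p pcompose_smult)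
qed

lemma coeff_scale: "coeff (p \<circ>\<^sub>p [:0, r:]) n = r ^ n * coeff (p :: complex poly) n"
  by (simp add: coeff_pcompose_linear)

text \<open>
  The multiplier \<open>1 - c n\<^sup>2 / M\<close> splits into \<open>1 + m n\<close> and \<open>1 - m n\<close>; its \<open>M\<close>-th power tends to
  \<open>exp (- c n\<^sup>2)\<close>.
\<close>
lemma neg_rooted_iterate:
  fixes c :: real
  assumes "neg_rooted p" "c \<ge> 0" "real M > c * (real (degree p))\<^sup>2"
  shows "\<exists>q. neg_rooted q \<and> (\<forall>n. coeff q n = of_real ((1 - c * (real n)\<^sup>2 / M) ^ j) * coeff p n)"
proof (induction j)
  case 0
  then show ?case using assms(1) by (intro exI[of _ p]) auto
next
  case (Suc j)
  then obtain q where q: "neg_rooted q"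
    "\<And>n. coeff q n = of_real ((1 - c * (real n)\<^sup>2 / M) ^ j) * coeff p n" by blast
  have M: "real M > 0" using assms(2,3) by (meson mult_nonneg_nonneg zero_le_power2 order_le_less_trans)
  define m where "m = sqrt (c / M)"
  have m0: "m \<ge> 0" and m2: "m\<^sup>2 = c / M" using assms(2) M by (auto simp: m_def)
  \<comment> \<open>Since m^2 = c/M, the lower bound on \<open>M\<close> says that 1 - m n stays
    positive up to the degree. The steps only rescale coefficients, so the degree never grows and
    the same \<open>M\<close> serves every iteration.\<close>
  have "(m * degree p)\<^sup>2 < 1\<^sup>2" using assms(3) M by (simp add: power_mult_distrib m2 field_simps)
  then have mp: "m * degree p < 1" using power_less_imp_less_base by fastforce
  have deg: "degree q' \<le> degree p" if "\<And>n. \<exists>c. coeff q' n = c * coeff p n" for q'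
    by (rule degree_le) (metis that coeff_eq_0 mult_zero_right)
  let ?q1 = "q + smult (of_real m) (pCons 0 (pderiv q))"
  let ?q2 = "?q1 + smult (of_real (- m)) (pCons 0 (pderiv ?q1))"
  have c1: "coeff ?q1 n = (1 + of_real m * of_nat n) * coeff q n" for n by (rule coeff_Euler_op)
  have c2: "coeff ?q2 n = (1 + of_real (-m) * of_nat n) * coeff ?q1 n" for n by (rule coeff_Euler_op)
  have n1: "neg_rooted ?q1" using m0 by (intro neg_rooted_Euler_op q(1)) (auto simp: add_pos_nonneg)
  have d1: "degree ?q1 \<le> degree p"
    by (rule deg) (metis c1 q(2) mult.assoc)
  have "m * degree ?q1 \<le> m * degree p" using d1 m0 by (intro mult_left_mono) auto
  then have n2: "neg_rooted ?q2" using mp by (intro neg_rooted_Euler_op n1) auto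
  have "coeff ?q2 n = of_real ((1 - c * (real n)\<^sup>2 / M) ^ Suc j) * coeff p n" for n
  proof -
    have "(1 + of_real (-m) * of_nat n) * (1 + of_real m * of_nat n) = (of_real (1 - m\<^sup>2 * (real n)\<^sup>2) :: complex)"
      by (simp add: algebra_simps power2_eq_square)
    then show ?thesis unfolding c2 c1 q(2) m2 by (simp add: mult.assoc[symmetric])
  qed
  then show ?case using n2 by blast
qed

text \<open>As n(n+1)/2 = n^2/2 + n/2, the multiplier is a Gaussian one combined with the dilation
  by the square root of \<open>y\<close>.\<close>

lemma triangular_power:
  assumes "0 < (y::real)"
  shows "y ^ (n * (n + 1) div 2) = exp (- (- ln y / 2) * (real n)\<^sup>2) * exp (ln y / 2) ^ n"
proof -
  have "real (n * (n + 1) div 2) = real n * (real n + 1) / 2"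
    by (subst real_of_nat_div) (auto simp: algebra_simps)
  then have "y ^ (n * (n + 1) div 2) = exp (real n * (real n + 1) / 2 * ln y)"
    using assms by (metis exp_ln exp_of_nat_mult)
  also have "\<dots> = exp (- (- ln y / 2) * (real n)\<^sup>2) * exp (ln y / 2) ^ n"
    by (simp add: exp_of_nat_mult[symmetric] exp_add[symmetric] field_simps power2_eq_square)
  finally show ?thesis .
qed

lemma neg_rooted_triangular:
  assumes "neg_rooted p" "0 \<le> y" "y \<le> 1"
  shows "neg_rooted_limit (\<lambda>n. coeff p n * of_real (y ^ (n * (n + 1) div 2)))"
proof (cases "y = 0")
  case True
  obtain C as where C: "C > 0"
    and p: "p = smult (of_real C) (\<Prod>a\<leftarrow>as. [:1, of_real a:])"
    using assms(1) unfolding neg_rooted_def by blast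
  have "coeff (\<Prod>a\<leftarrow>as. [:1, of_real a:] :: complex poly) 0 = 1" by (induction as) auto
  then have p0: "coeff p 0 = of_real C" using p by simp
  have "neg_rooted [:of_real C:]"
    unfolding neg_rooted_def using C by (intro exI[of _ C] exI[of _ "[]"]) auto
  moreover have "coeff [:of_real C:] = (\<lambda>n. coeff p n * of_real (y ^ (n * (n + 1) div 2)))"
  proof
    fix n show "coeff [:of_real C:] n = coeff p n * of_real (y ^ (n * (n + 1) div 2))"
      using p0 True by (cases n) auto
  qed
  ultimately show ?thesis using neg_rooted_limit_coeff by metis
next
  case False
  then have y: "y > 0" using assms by simp
  define c where "c = - ln y / 2"
  have c: "c \<ge> 0" using y assms by (auto simp: c_def)
  define r where "r = exp (ln y / 2)"
  \<comment> \<open>Stated as an implication so that a sequence indexed by all \<open>M\<close> can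
    be chosen; the condition holds eventually.\<close>
  have "\<exists>q. c * (real (degree p))\<^sup>2 < real M \<longrightarrow> neg_rooted q \<and>
     (\<forall>n. coeff q n = of_real ((1 - c * (real n)\<^sup>2 / M) ^ M * r ^ n) * coeff p n)" for M
  proof (cases "c * (real (degree p))\<^sup>2 < real M")
    case True
    obtain q where q: "neg_rooted q"
      "\<And>n. coeff q n = of_real ((1 - c * (real n)\<^sup>2 / M) ^ M) * coeff p n"
      using neg_rooted_iterate[OF assms(1) c True] by blast
    have "neg_rooted (q \<circ>\<^sub>p [:0, of_real r:])"
      by (rule neg_rooted_scale[OF q(1)]) (simp add: r_def)
    moreover have "coeff (q \<circ>\<^sub>p [:0, of_real r:]) n = of_real ((1 - c * (real n)\<^sup>2 / M) ^ M * r ^ n) * coeff p n" for n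
      by (simp add: coeff_scale q(2) mult_ac)
    ultimately show ?thesis by blast
  qed auto
  then obtain q where q: "\<And>M. c * (real (degree p))\<^sup>2 < real M \<Longrightarrow> neg_rooted (q M)"
     "\<And>M n. c * (real (degree p))\<^sup>2 < real M \<Longrightarrow> coeff (q M) n = of_real ((1 - c * (real n)\<^sup>2 / M) ^ M * r ^ n) * coeff p n"
    by metis
  have ev: "\<forall>\<^sub>F M in sequentially. c * (real (degree p))\<^sup>2 < real M"
    using filterlim_real_sequentially by (auto simp: filterlim_at_top_dense)
  show ?thesis
  proof (rule neg_rooted_limit_tendstoI)
    show "\<forall>\<^sub>F M in sequentially. neg_rooted_limit (coeff (q M))"
      using ev by eventually_elim (auto intro: neg_rooted_limit_coeff q)
    fix n
    have "(\<lambda>M. (1 + (- c * (real n)\<^sup>2) / real M) ^ M) \<longlonglongrightarrow> exp (- c * (real n)\<^sup>2)"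
      by (rule tendsto_exp_limit_sequentially)
    then have "(\<lambda>M. coeff p n * of_real ((1 + (- c * (real n)\<^sup>2) / real M) ^ M * r ^ n)) \<longlonglongrightarrow>
        coeff p n * of_real (exp (- c * (real n)\<^sup>2) * r ^ n)"
      by (intro tendsto_intros)
    also have "exp (- c * (real n)\<^sup>2) * r ^ n = y ^ (n * (n + 1) div 2)"
      using triangular_power[OF y] by (simp add: c_def r_def)
    finally show "(\<lambda>M. coeff (q M) n) \<longlonglongrightarrow> coeff p n * of_real (y ^ (n * (n + 1) div 2))"
      by (rule Lim_transform_eventually) (use ev in eventually_elim, auto simp: q(2) mult_ac)
  qed auto
qed

lemma neg_rooted_limit_triangular:
  assumes "neg_rooted_limit A" "0 \<le> y" "y \<le> 1"
  shows "neg_rooted_limit (\<lambda>n. A n * of_real (y ^ (n * (n + 1) div 2)))"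
proof -
  obtain p where p: "\<And>k. neg_rooted (p k)" "\<And>n. (\<lambda>k. coeff (p k) n) \<longlonglongrightarrow> A n"
    using neg_rooted_limit_obtain[OF assms(1)] by blast
  show ?thesis
    by (rule neg_rooted_limit_tendstoI[where p = "\<lambda>k n. coeff (p k) n * of_real (y ^ (n * (n + 1) div 2))" and F = sequentially])
       (intro always_eventually allI neg_rooted_triangular assms p tendsto_intros trivial_limit_sequentially)+
qed

section \<open>Limits of polynomials with negative zeros\<close>

text \<open>The factors are listed in decreasing order and padded by zeros. A bound S for their sum
  then yields a_j <= S/(j+1), which provides the majorant for passing to the limit.\<close>

lemma neg_rooted_sequence:
  assumes "neg_rooted p"
  obtains C a n where "(C::real) > 0" "\<And>j. (a::nat\<Rightarrow>real) j \<ge> 0" "decseq a" "\<And>j. j \<ge> n \<Longrightarrow> a j = 0"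
    "\<And>z. poly p z = of_real C * (\<Prod>j<n. 1 + of_real (a j) * z)"
    "\<And>k. norm (coeff p k) \<le> C * (\<Sum>j<n. a j) ^ k / fact k"
    "coeff p 0 = of_real C" "coeff p 1 = of_real (C * (\<Sum>j<n. a j))"
proof -
  obtain C as0 where C: "C > 0" and as0: "\<forall>a\<in>set as0. (0::real) < a"
    and p0: "p = smult (of_real C) (\<Prod>a\<leftarrow>as0. [:1, of_real a:])"
    using assms(1) unfolding neg_rooted_def by blast
  define as where "as = rev (sort as0)"
  have as: "\<forall>a\<in>set as. 0 < a" using as0 by (simp add: as_def)
  have "mset as = mset as0" by (simp add: as_def)
  then have "mset (map (\<lambda>a. [:1, of_real a :: complex:]) as) = mset (map (\<lambda>a. [:1, of_real a:]) as0)"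
    by simp
  then have "prod_list (map (\<lambda>a. [:1, of_real a :: complex:]) as) = prod_list (map (\<lambda>a. [:1, of_real a:]) as0)"
    by (metis prod_mset_prod_list)
  then have p: "p = smult (of_real C) (\<Prod>a\<leftarrow>as. [:1, of_real a:])" using p0 by simp
  have srt: "sorted_wrt (\<ge>) as" unfolding as_def by (simp add: sorted_wrt_rev)
  define n where "n = length as"
  define a where "a = (\<lambda>j. if j < n then as ! j else 0)"
  have a0: "a j \<ge> 0" for j using as by (auto simp: a_def n_def less_imp_le)
  have sum: "(\<Sum>j<n. a j) = sum_list as"
    by (auto simp: a_def n_def sum_list_sum_nth atLeast0LessThan intro!: sum.cong)
  show thesis
  proof (rule that[of C a n])
    show "decseq a"
      unfolding decseq_def
    proof (intro allI impI)
      fix i j :: nat assume "i \<le> j"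
      show "a j \<le> a i"
      proof (cases "i = j \<or> j \<ge> n")
        case True
        then show ?thesis using a0[of i] by (auto simp: a_def)
      next
        case False
        then show ?thesis using srt \<open>i \<le> j\<close> by (auto simp: a_def n_def sorted_wrt_iff_nth_less)
      qed
    qed
    show "poly p z = of_real C * (\<Prod>j<n. 1 + of_real (a j) * z)" for z
    proof -
      have "(\<Prod>a\<leftarrow>as. 1 + of_real a * z) = (\<Prod>j<length as. 1 + of_real (as ! j) * z)" for as :: "real list"
        by (induction as) (auto simp: prod.lessThan_Suc_shift simp del: prod.lessThan_Suc)
      then have "(\<Prod>a\<leftarrow>as. 1 + of_real a * z) = (\<Prod>j<n. 1 + of_real (a j) * z)"
        by (simp add: a_def n_def)
      then show ?thesis by (simp add: p poly_prod_linear)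
    qed
    show "norm (coeff p k) \<le> C * (\<Sum>j<n. a j) ^ k / fact k" for k
      using norm_coeff_prod_linear_le[OF as, of k] C unfolding sum
      by (simp add: p norm_mult field_simps)
    have "coeff (\<Prod>a\<leftarrow>as. [:1, of_real a:] :: complex poly) 0 = 1" for as by (induction as) auto
    moreover have "coeff (\<Prod>a\<leftarrow>as. [:1, of_real a:] :: complex poly) 1 = of_real (sum_list as)" for as
      using calculation by (induction as) (auto)
    ultimately show "coeff p 0 = of_real C" "coeff p 1 = of_real (C * (\<Sum>j<n. a j))"
      unfolding sum by (auto simp: p)
  qed (use C a0 in \<open>auto simp: a_def\<close>)
qed

section \<open>Infinite products of linear factors\<close>

lemma convergent_prod_linear:
  assumes "summable \<alpha>" "\<And>j. (\<alpha> j :: real) \<ge> 0"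
  shows "convergent_prod (\<lambda>j. 1 + of_real (\<alpha> j) * (z::complex))"
proof -
  have "summable (\<lambda>j. norm (of_real (\<alpha> j) * z))"
    using assms by (auto simp: norm_mult intro!: summable_mult2)
  then have "abs_convergent_prod (\<lambda>j. 1 + of_real (\<alpha> j) * z)"
    by (simp add: abs_convergent_prod_conv_summable)
  then show ?thesis by (rule abs_convergent_prod_imp_convergent_prod)
qed

lemma holomorphic_prodinf_linear:
  assumes "summable \<alpha>" "\<And>j. (\<alpha> j :: real) \<ge> 0"
  shows "(\<lambda>z::complex. \<Prod>j. 1 + of_real (\<alpha> j) * z) holomorphic_on UNIV"
proof (rule holomorphic_uniform_sequence[where f = "\<lambda>N z. \<Prod>j<N. 1 + of_real (\<alpha> j) * z"])
  fix x :: complex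
  have "uniformly_convergent_on (cball x 1) (\<lambda>N z. \<Prod>j<N. 1 + of_real (\<alpha> j) * z)"
  proof (rule uniformly_convergent_on_prod')
    show "uniformly_convergent_on (cball x 1) (\<lambda>N z. \<Sum>n<N. norm (1 + of_real (\<alpha> n) * z - 1))"
    proof (rule Weierstrass_m_test')
      show "norm (norm (1 + complex_of_real (\<alpha> n) * z - 1)) \<le> \<alpha> n * (norm x + 1)" if "z \<in> cball x 1" for n z
      proof -
        have "norm z \<le> norm x + 1" using that norm_triangle_sub[of z x] by (auto simp: dist_norm norm_minus_commute)
        then show ?thesis using assms(2) by (simp add: norm_mult mult_left_mono)
      qed
      show "summable (\<lambda>n. \<alpha> n * (norm x + 1))" using assms(1) by (rule summable_mult2)
    qed
  qed (auto intro!: continuous_intros)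
  then obtain l where l: "uniform_limit (cball x 1) (\<lambda>N z. \<Prod>j<N. 1 + of_real (\<alpha> j) * z) l sequentially"
    by (auto simp: uniformly_convergent_on_def)
  have lz: "l z = (\<Prod>j. 1 + of_real (\<alpha> j) * z)" if "z \<in> cball x 1" for z
  proof -
    have "(\<lambda>N. \<Prod>j<N. 1 + of_real (\<alpha> j) * z) \<longlonglongrightarrow> l z" using l that by (rule tendsto_uniform_limitI)
    moreover have "(\<lambda>N. \<Prod>j\<le>N. 1 + of_real (\<alpha> j) * z) \<longlonglongrightarrow> (\<Prod>j. 1 + of_real (\<alpha> j) * z)"
      by (rule convergent_prod_LIMSEQ[OF convergent_prod_linear[OF assms]])
    then have "(\<lambda>N. \<Prod>j<N. 1 + of_real (\<alpha> j) * z) \<longlonglongrightarrow> (\<Prod>j. 1 + of_real (\<alpha> j) * z)"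
      by (simp add: LIMSEQ_lessThan_iff_atMost)
    ultimately show ?thesis by (rule LIMSEQ_unique)
  qed
  have "uniform_limit (cball x 1) (\<lambda>N z. \<Prod>j<N. 1 + of_real (\<alpha> j) * z) (\<lambda>z. \<Prod>j. 1 + of_real (\<alpha> j) * z) sequentially"
    by (rule uniform_limit_cong'[THEN iffD1, OF refl lz l])
  then show "\<exists>d>0. cball x d \<subseteq> UNIV \<and> uniform_limit (cball x d) (\<lambda>N z. \<Prod>j<N. 1 + of_real (\<alpha> j) * z) (\<lambda>z. \<Prod>j. 1 + of_real (\<alpha> j) * z) sequentially"
    by (intro exI[of _ 1]) auto
qed (auto intro!: holomorphic_intros)

lemma summable_power_fact: "summable (\<lambda>n. S ^ n / fact n * (r::real) ^ n)"
  using summable_exp[of "S * r"] by (simp add: power_mult_distrib field_simps)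

text \<open>
  The part of \<open>\<Sum>a k j\<close> that is lost in the limit, spread over more and more small numbers,
  becomes the exponential factor.
\<close>
lemma linear_product_limit:
  fixes a :: "nat \<Rightarrow> nat \<Rightarrow> real"
  assumes a0: "\<And>k j. a k j \<ge> 0" and dec: "\<And>k. decseq (a k)" and fin: "\<And>k j. j \<ge> n k \<Longrightarrow> a k j = 0"
    and s: "\<And>k. (\<Sum>j<n k. a k j) \<le> S" and slim: "(\<lambda>k. \<Sum>j<n k. a k j) \<longlonglongrightarrow> s"
    and lim: "\<And>j. (\<lambda>k. a k j) \<longlonglongrightarrow> \<alpha> j" and S: "S \<ge> 1" and x: "norm (x::complex) \<le> 1 / (2 * S)"
  shows "summable \<alpha>" "suminf \<alpha> \<le> s"
    "(\<lambda>k. \<Prod>j<n k. 1 + of_real (a k j) * x) \<longlonglongrightarrow>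
      exp (of_real (s - suminf \<alpha>) * x) * (\<Prod>j. 1 + of_real (\<alpha> j) * x)"
proof -
  have \<alpha>0: "\<alpha> j \<ge> 0" for j by (rule LIMSEQ_le_const[OF lim]) (use a0 in auto)
  have part: "(\<Sum>j<m. a k j) \<le> (\<Sum>j<n k. a k j)" for m k
  proof -
    have "(\<Sum>j<m. a k j) \<le> (\<Sum>j<max m (n k). a k j)"
      using a0 by (intro sum_mono2) auto
    also have "\<dots> = (\<Sum>j<n k. a k j)"
      using fin by (intro sum.mono_neutral_right) auto
    finally show ?thesis .
  qed
  have le: "a k j \<le> S / Suc j" for k j
  proof -
    have "real (Suc j) * a k j = (\<Sum>i<Suc j. a k j)" by (simp only: sum_constant card_lessThan)
    also have "\<dots> \<le> (\<Sum>i<Suc j. a k i)" using dec by (intro sum_mono) (auto simp: decseq_def)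
    also have "\<dots> \<le> S" using part s order_trans by blast
    finally show ?thesis by (simp add: field_simps del: of_nat_Suc)
  qed
  have ps: "(\<Sum>j<m. \<alpha> j) \<le> s" for m
  proof (rule LIMSEQ_le[OF _ slim])
    show "(\<lambda>k. \<Sum>j<m. a k j) \<longlonglongrightarrow> (\<Sum>j<m. \<alpha> j)" by (intro tendsto_sum lim)
  qed (use part in auto)
  show sa: "summable \<alpha>"
    by (rule bounded_imp_summable[of _ s]) (use \<alpha>0 ps[of "Suc _"] in \<open>auto simp: lessThan_Suc_atMost\<close>)
  show "suminf \<alpha> \<le> s" by (rule suminf_le_const[OF sa ps])
  have small: "norm (of_real t * x) \<le> 1 / 2" if "0 \<le> t" "t \<le> S" for t
  proof -
    have "norm (of_real t * x) \<le> S * (1 / (2 * S))"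
      unfolding norm_mult using that x S by (intro mult_mono) auto
    then show ?thesis using S by simp
  qed
  \<comment> \<open>The logarithm without its linear part is of second order, hence dominated by a
    multiple of 1/(j+1)^2 uniformly in \<open>k\<close>. Only the linear parts can lose mass in the
    limit, and their sums tend to \<open>s\<close>.\<close>
  define D where "D = (\<lambda>t. Ln (1 + of_real t * x) - of_real t * x)"
  have D: "norm (D t) \<le> 2 * norm (of_real t * x) ^ 2" if "0 \<le> t" "t \<le> S" for t
  proof -
    have "norm (D t) \<le> norm (of_real t * x) ^ 2 / (1 - norm (of_real t * x))"
      unfolding D_def using small[OF that] by (intro Ln_approx_linear) auto
    also have "\<dots> \<le> norm (of_real t * x) ^ 2 / (1 / 2)"
      using small[OF that] by (intro divide_left_mono) auto
    finally show ?thesis by simp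
  qed
  have leS: "a k j \<le> S" for k j
  proof -
    have "S / Suc j \<le> S" using S by (simp add: field_simps)
    then show ?thesis using le[of k j] by linarith
  qed
  have \<alpha>S: "\<alpha> j \<le> S" for j by (rule LIMSEQ_le_const2[OF lim]) (use leS in auto)
  have ne: "1 + of_real t * x \<noteq> 0" if "0 \<le> t" "t \<le> S" for t
    using small[OF that] by (auto simp: add_eq_0_iff)
  have nneg: "1 + of_real t * x \<notin> \<real>\<^sub>\<le>\<^sub>0" if "0 \<le> t" "t \<le> S" for t
  proof
    assume "1 + of_real t * x \<in> \<real>\<^sub>\<le>\<^sub>0"
    then have "Re (1 + of_real t * x) \<le> 0" by (auto simp: complex_nonpos_Reals_iff)
    then have "Re (of_real t * x) \<le> -1" by simp
    then show False using abs_Re_le_cmod[of "of_real t * x"] small[OF that] by linarith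
  qed
  have tan: "summable (\<lambda>j. norm (D (\<alpha> j))) \<and> (\<lambda>k. \<Sum>j. D (a k j)) \<longlonglongrightarrow> (\<Sum>j. D (\<alpha> j))"
  proof -
    have "summable (\<lambda>j. 2 * (S * norm x)\<^sup>2 * (1 / real (Suc j) ^ 2))"
    proof (intro summable_mult)
      have "summable (\<lambda>j. inverse (real j ^ 2))" by (rule inverse_power_summable) simp
      then have "summable (\<lambda>j. inverse (real (Suc j) ^ 2))" by (subst summable_Suc_iff)
      then show "summable (\<lambda>j. 1 / real (Suc j) ^ 2)" by (simp only: inverse_eq_divide)
    qed
    moreover have "norm (D (a k j)) \<le> 2 * (S * norm x)\<^sup>2 * (1 / real (Suc j) ^ 2)" for k j
    proof -
      have "norm (D (a k j)) \<le> 2 * norm (of_real (a k j) * x) ^ 2" by (rule D[OF a0 leS])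
      also have "norm (of_real (a k j) * x) = a k j * norm x" using a0 by (simp add: norm_mult)
      also have "2 * (a k j * norm x)\<^sup>2 \<le> 2 * (S / Suc j * norm x)\<^sup>2"
        using a0 by (intro mult_left_mono power_mono mult_right_mono le) auto
      finally show ?thesis by (simp add: power_mult_distrib power_divide)
    qed
    moreover have "(\<lambda>k. D (a k j)) \<longlonglongrightarrow> D (\<alpha> j)" for j
      unfolding D_def by (intro tendsto_intros lim nneg \<alpha>0 \<alpha>S)
    ultimately show ?thesis
      using tannerys_theorem[of "\<lambda>j k. D (a k j)" "\<lambda>j. D (\<alpha> j)" sequentially "\<lambda>j. 2 * (S * norm x)\<^sup>2 * (1 / real (Suc j) ^ 2)"]
      by (auto intro: always_eventually)
  qed
  have fin_eq: "(\<Prod>j<n k. 1 + of_real (a k j) * x) = exp ((\<Sum>j. D (a k j)) + of_real (\<Sum>j<n k. a k j) * x)" for k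
  proof -
    have "(\<Prod>j<n k. 1 + of_real (a k j) * x) = (\<Prod>j<n k. exp (D (a k j) + of_real (a k j) * x))"
      by (intro prod.cong refl) (simp add: D_def ne[OF a0 leS])
    also have "\<dots> = exp (\<Sum>j<n k. D (a k j) + of_real (a k j) * x)" by (simp add: exp_sum)
    also have "(\<Sum>j<n k. D (a k j) + of_real (a k j) * x) = (\<Sum>j<n k. D (a k j)) + of_real (\<Sum>j<n k. a k j) * x"
      by (simp add: sum.distrib sum_distrib_right)
    also have "(\<Sum>j<n k. D (a k j)) = (\<Sum>j. D (a k j))"
      by (rule suminf_finite[symmetric]) (auto simp: D_def fin)
    finally show ?thesis .
  qed
  have "(\<lambda>k. \<Prod>j<n k. 1 + of_real (a k j) * x) \<longlonglongrightarrow> exp ((\<Sum>j. D (\<alpha> j)) + of_real s * x)"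
    unfolding fin_eq by (intro tendsto_intros slim) (use tan in auto)
  also have "exp ((\<Sum>j. D (\<alpha> j)) + of_real s * x) = exp (of_real (s - suminf \<alpha>) * x) * (\<Prod>j. 1 + of_real (\<alpha> j) * x)"
  proof -
    have sD: "summable (\<lambda>j. D (\<alpha> j))" by (rule summable_norm_cancel[OF tan[THEN conjunct1]])
    have s\<alpha>: "summable (\<lambda>j. of_real (\<alpha> j) * x)" using sa by (intro summable_mult2 summable_of_real)
    have "(\<Prod>j. 1 + of_real (\<alpha> j) * x) = (\<Prod>j. exp (D (\<alpha> j) + of_real (\<alpha> j) * x))"
      by (intro arg_cong[where f = prodinf] ext) (simp add: D_def ne[OF \<alpha>0 \<alpha>S])
    also have "\<dots> = exp (\<Sum>j. D (\<alpha> j) + of_real (\<alpha> j) * x)"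
      by (intro prodinf_exp summable_add sD s\<alpha>)
    also have "(\<Sum>j. D (\<alpha> j) + of_real (\<alpha> j) * x) = (\<Sum>j. D (\<alpha> j)) + of_real (suminf \<alpha>) * x"
      using sa by (simp add: suminf_add[symmetric] sD s\<alpha> suminf_mult2[symmetric] summable_of_real suminf_of_real)
    finally show ?thesis by (simp add: exp_add[symmetric] algebra_simps)
  qed
  finally show "(\<lambda>k. \<Prod>j<n k. 1 + of_real (a k j) * x) \<longlonglongrightarrow>
      exp (of_real (s - suminf \<alpha>) * x) * (\<Prod>j. 1 + of_real (\<alpha> j) * x)" .
qed

text \<open>Bounded sums give the coefficients the common majorant
  \<open>C1 * (S ^ i / fact i)\<close> and make the entries \<open>a k j\<close> converge along a
  diagonal subsequence. The product formula is first obtained on a small disc, where the logarithms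
  of the factors are controlled, and extends because both sides are entire.\<close>

theorem neg_rooted_limit_product:
  assumes "neg_rooted_limit A" "A 0 = of_real c" "(c::real) > 0"
  obtains \<sigma> \<alpha> where "(\<sigma>::real) \<ge> 0" "\<And>j::nat. (\<alpha> j :: real) \<ge> 0" "summable \<alpha>"
    "\<And>x. (\<lambda>n. A n * x ^ n) sums (of_real c * exp (of_real \<sigma> * x) * (\<Prod>j. 1 + of_real (\<alpha> j) * x))"
proof -
  obtain p where p: "\<And>k. neg_rooted (p k)" "\<And>n. (\<lambda>k. coeff (p k) n) \<longlonglongrightarrow> A n"
    using neg_rooted_limit_obtain[OF assms(1)] by blast
  have "\<forall>k. \<exists>C a n. (C::real) > 0 \<and> (\<forall>j. (a::nat\<Rightarrow>real) j \<ge> 0) \<and> decseq a \<and> (\<forall>j\<ge>n. a j = 0) \<and>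
    (\<forall>z. poly (p k) z = of_real C * (\<Prod>j<n. 1 + of_real (a j) * z)) \<and>
    (\<forall>i. norm (coeff (p k) i) \<le> C * (\<Sum>j<n. a j) ^ i / fact i) \<and>
    coeff (p k) 0 = of_real C \<and> coeff (p k) 1 = of_real (C * (\<Sum>j<n. a j))"
  proof
    fix k
    show "\<exists>C a n. (C::real) > 0 \<and> (\<forall>j. (a::nat\<Rightarrow>real) j \<ge> 0) \<and> decseq a \<and> (\<forall>j\<ge>n. a j = 0) \<and>
    (\<forall>z. poly (p k) z = of_real C * (\<Prod>j<n. 1 + of_real (a j) * z)) \<and>
    (\<forall>i. norm (coeff (p k) i) \<le> C * (\<Sum>j<n. a j) ^ i / fact i) \<and>
    coeff (p k) 0 = of_real C \<and> coeff (p k) 1 = of_real (C * (\<Sum>j<n. a j))"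
    proof (rule neg_rooted_sequence[OF p(1)[of k]], goal_cases)
      case (1 C a n)
      show ?case by (rule exI[of _ C], rule exI[of _ a], rule exI[of _ n], intro conjI allI impI 1)
    qed
  qed
  then obtain C a n where C: "\<And>k. (C k::real) > 0" and a0: "\<And>k j. a k j \<ge> (0::real)"
    and dec: "\<And>k. decseq (a k)" and fin: "\<And>k j. j \<ge> n k \<Longrightarrow> a k j = 0"
    and pol: "\<And>k z. poly (p k) z = of_real (C k) * (\<Prod>j<n k. 1 + of_real (a k j) * z)"
    and bnd: "\<And>k i. norm (coeff (p k) i) \<le> C k * (\<Sum>j<n k. a k j) ^ i / fact i"
    and c0: "\<And>k. coeff (p k) 0 = of_real (C k)"
    and c1: "\<And>k. coeff (p k) 1 = of_real (C k * (\<Sum>j<n k. a k j))"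
    unfolding choice_iff by blast
  have Clim: "C \<longlonglongrightarrow> c"
    using tendsto_Re[OF p(2)[of 0]] by (simp add: c0 assms(2))
  define s where "s = (\<lambda>k. \<Sum>j<n k. a k j)"
  have "(\<lambda>k. C k * s k) \<longlonglongrightarrow> Re (A 1)"
    using tendsto_Re[OF p(2)[of 1]] by (simp only: c1 s_def Re_complex_of_real)
  \<comment> \<open>The quotient of the first two coefficients is the sum of the a_j, so these sums
    converge and are bounded.\<close>
  then have "(\<lambda>k. C k * s k / C k) \<longlonglongrightarrow> Re (A 1) / c"
    using assms(3) by (intro tendsto_divide Clim) auto
  moreover have "C k * s k / C k = s k" for k using C[of k] by simp
  ultimately have slim: "s \<longlonglongrightarrow> Re (A 1) / c" by simp
  obtain S0 where "\<And>k. norm (s k) \<le> S0" using convergent_imp_Bseq[OF convergentI[OF slim]] by (auto simp: Bseq_def)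
  then have S0: "s k \<le> S0" for k by (metis abs_le_D1 real_norm_def)
  define S where "S = max 1 S0"
  have S: "S \<ge> 1" "\<And>k. s k \<le> S" using S0 by (auto simp: S_def le_max_iff_disj)
  have s0: "s k \<ge> 0" for k unfolding s_def by (intro sum_nonneg a0)
  obtain C1 where C1: "\<And>k. C k \<le> C1"
    using convergent_imp_Bseq[OF convergentI[OF Clim]] by (auto simp: Bseq_def abs_le_iff)
  have bnd': "norm (coeff (p k) i) \<le> C1 * (S ^ i / fact i)" for k i
  proof -
    have "C k * s k ^ i / fact i \<le> C1 * S ^ i / fact i"
      using C1[of k] S s0[of k] C[of k] by (intro divide_right_mono mult_mono power_mono) auto
    moreover have "norm (coeff (p k) i) \<le> C k * s k ^ i / fact i" unfolding s_def by (rule bnd)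
    ultimately show ?thesis by simp
  qed
  have Abnd: "norm (A i) \<le> C1 * (S ^ i / fact i)" for i
    by (rule LIMSEQ_le_const2[OF tendsto_norm[OF p(2)]]) (use bnd' in auto)
  have sumA: "summable (\<lambda>i. A i * x ^ i)" for x
  proof (rule summable_comparison_test')
    show "summable (\<lambda>i. C1 * (S ^ i / fact i * norm x ^ i))"
      by (intro summable_mult summable_power_fact)
    show "norm (A i * x ^ i) \<le> C1 * (S ^ i / fact i * norm x ^ i)" for i
      using mult_right_mono[OF Abnd[of i], of "norm x ^ i"] by (simp add: norm_mult norm_power mult_ac)
  qed
  have plim: "(\<lambda>k. poly (p k) x) \<longlonglongrightarrow> (\<Sum>i. A i * x ^ i)" for x
  proof -
    have "(\<lambda>k. \<Sum>i. coeff (p k) i * x ^ i) \<longlonglongrightarrow> (\<Sum>i. A i * x ^ i)"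
    proof (rule tannerys_theorem[THEN conjunct2, THEN conjunct2])
      show "summable (\<lambda>i. C1 * (S ^ i / fact i * norm x ^ i))"
        by (intro summable_mult summable_power_fact)
      have "norm (coeff (p k) i * x ^ i) \<le> C1 * (S ^ i / fact i * norm x ^ i)" for i k
        using mult_right_mono[OF bnd'[of k i], of "norm x ^ i"] by (simp add: norm_mult norm_power mult_ac)
      then show "\<forall>\<^sub>F (i, k) in at_top \<times>\<^sub>F sequentially. norm (coeff (p k) i * x ^ i) \<le> C1 * (S ^ i / fact i * norm x ^ i)"
        by (auto intro: always_eventually)
    qed (auto intro!: tendsto_intros p)
    moreover have "(\<Sum>i. coeff (p k) i * x ^ i) = poly (p k) x" for k
      unfolding poly_altdef by (rule suminf_finite) (auto simp: coeff_eq_0)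
    ultimately show ?thesis by simp
  qed
  have "\<exists>\<phi>. strict_mono \<phi> \<and> (\<forall>j. \<exists>l. (\<lambda>k. a (\<phi> k) j) \<longlonglongrightarrow> l)"
  proof -
    have "norm (a k j) \<le> S" for k j
    proof (cases "j < n k")
      case True
      then have "a k j \<le> s k" unfolding s_def using a0 by (intro member_le_sum) auto
      then show ?thesis using a0[of k j] S(2)[of k] by simp
    next
      case False
      then show ?thesis using fin S by simp
    qed
    then obtain \<phi> where "strict_mono (\<phi>::nat\<Rightarrow>nat)" "\<And>j. j \<in> UNIV \<Longrightarrow> \<exists>l. (\<lambda>k. a (\<phi> k) j) \<longlonglongrightarrow> l"
      by (rule function_convergent_subsequence[rotated, of UNIV a S]) auto
    then show ?thesis by auto 
  qed
  then obtain \<phi> \<alpha> where \<phi>: "strict_mono \<phi>" and \<alpha>: "\<And>j. (\<lambda>k. a (\<phi> k) j) \<longlonglongrightarrow> \<alpha> j"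
    by metis
  define \<sigma> where "\<sigma> = Re (A 1) / c - suminf \<alpha>"
  have slim': "(\<lambda>k. \<Sum>j<n (\<phi> k). a (\<phi> k) j) \<longlonglongrightarrow> Re (A 1) / c"
    using LIMSEQ_subseq_LIMSEQ[OF slim \<phi>] by (simp add: s_def o_def)
  have S2: "(\<Sum>j<n k. a k j) \<le> S" for k using S(2) by (simp add: s_def)
  have lim: "summable \<alpha>" "suminf \<alpha> \<le> Re (A 1) / c"
    using linear_product_limit(1,2)[of "\<lambda>k. a (\<phi> k)" "\<lambda>k. n (\<phi> k)" S "Re (A 1) / c" \<alpha> 0] a0 dec fin S2 slim' \<alpha> S(1) by auto
  have lim3: "(\<lambda>k. \<Prod>j<n (\<phi> k). 1 + of_real (a (\<phi> k) j) * x) \<longlonglongrightarrow>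
      exp (of_real \<sigma> * x) * (\<Prod>j. 1 + of_real (\<alpha> j) * x)" if "norm x \<le> 1 / (2 * S)" for x :: complex
    unfolding \<sigma>_def by (rule linear_product_limit(3)[where a = "\<lambda>k. a (\<phi> k)" and n = "\<lambda>k. n (\<phi> k)" and S = S])
      (use a0 dec fin S2 slim' \<alpha> S(1) that in auto)
  have \<alpha>0: "\<alpha> j \<ge> 0" for j by (rule LIMSEQ_le_const[OF \<alpha>]) (use a0 in auto)
  have s\<alpha>: "summable \<alpha>" and "suminf \<alpha> \<le> Re (A 1) / c" using lim by auto
  then have \<sigma>: "\<sigma> \<ge> 0" by (simp add: \<sigma>_def)
  define f where "f = (\<lambda>x. \<Sum>i. A i * x ^ i)"
  define g where "g = (\<lambda>x. complex_of_real c * exp (of_real \<sigma> * x) * (\<Prod>j. 1 + of_real (\<alpha> j) * x))"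
  have eq: "f x = g x" if "norm x \<le> 1 / (2 * S)" for x
  proof -
    have "(\<lambda>k. poly (p (\<phi> k)) x) \<longlonglongrightarrow> f x"
      using LIMSEQ_subseq_LIMSEQ[OF plim \<phi>] by (simp add: o_def f_def)
    moreover have "(\<lambda>k. of_real (C (\<phi> k)) * (\<Prod>j<n (\<phi> k). 1 + of_real (a (\<phi> k) j) * x)) \<longlonglongrightarrow>
        of_real c * (exp (of_real \<sigma> * x) * (\<Prod>j. 1 + of_real (\<alpha> j) * x))"
      using LIMSEQ_subseq_LIMSEQ[OF Clim \<phi>] lim3[OF that] unfolding o_def
      by (intro tendsto_mult tendsto_of_real) auto
    ultimately show ?thesis unfolding pol g_def mult.assoc by (rule LIMSEQ_unique)
  qed
  have "f holomorphic_on UNIV"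
  proof -
    have "fps_conv_radius (Abs_fps A) = \<infinity>"
      unfolding fps_conv_radius_def using sumA by (intro conv_radius_inftyI'') simp
    then have "eval_fps (Abs_fps A) holomorphic_on UNIV"
      by (intro holomorphic_on_eval_fps) auto
    then show ?thesis unfolding f_def eval_fps_def by simp
  qed
  moreover have "g holomorphic_on UNIV"
    unfolding g_def by (intro holomorphic_intros holomorphic_prodinf_linear s\<alpha> \<alpha>0)
  ultimately have "f x = g x" for x
    using eq S by (intro analytic_continuation_open[of "ball 0 (1 / (2 * S))" UNIV f g x]) auto
  then have "(\<lambda>n. A n * x ^ n) sums g x" for x
    using summable_sums[OF sumA[of x]] by (simp add: f_def)
  then show thesis using that[OF \<sigma> \<alpha>0 s\<alpha>] unfolding g_def by blast
qed

text \<open>A convergent product vanishes only if one of its factors does, and the exponential has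
  no zeros.\<close>

lemma product_zeros:
  assumes "(c::real) > 0" "\<And>j::nat. (\<alpha> j :: real) \<ge> 0" "summable \<alpha>"
    "of_real c * exp (of_real \<sigma> * x) * (\<Prod>j. 1 + of_real (\<alpha> j) * x) = (0::complex)"
  shows "x \<in> \<real> \<and> Re x < 0"
proof -
  have "(\<Prod>j. 1 + of_real (\<alpha> j) * x) = 0" using assms(1,4) by simp
  then obtain j where j: "1 + of_real (\<alpha> j) * x = 0"
    using prodinf_nonzero[OF convergent_prod_linear[OF assms(3,2)]] by blast
  then have "\<alpha> j \<noteq> 0" by auto
  then have aj: "\<alpha> j > 0" using assms(2)[of j] by simp
  have "x = of_real (- 1 / \<alpha> j)" using j aj by (simp add: field_simps add_eq_0_iff)
  then show ?thesis using aj by simp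
qed

section \<open>Entire functions of small growth with negative zeros\<close>

text \<open>The map w -> w / (2M - w) sends the half-plane Re w < M into the unit disc and fixes 0,
  so the Schwarz lemma applies once the disc is rescaled.\<close>

lemma Borel_Caratheodory:
  assumes holo: "g holomorphic_on ball 0 R" and "R > 0" "g 0 = 0"
    and Re: "\<And>z. norm z < R \<Longrightarrow> Re (g z) < M" and "norm z < R"
  shows "norm (g z) \<le> 2 * M * norm z / (R - norm z)"
proof -
  have M: "M > 0" using Re[of 0] assms by simp
  define \<phi> where "\<phi> = (\<lambda>w. g (of_real R * w) / (of_real (2 * M) - g (of_real R * w)))"
  have inb: "norm (of_real R * w) < R" if "norm w < 1" for w :: complex
    using that \<open>R > 0\<close> by (simp add: norm_mult)
  have lt: "norm (g w) < norm (of_real (2 * M) - g w)" if "norm w < R" for w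
  proof -
    have "(norm (of_real (2 * M) - g w))\<^sup>2 - (norm (g w))\<^sup>2 = 4 * M * (M - Re (g w))"
      unfolding cmod_power2 by (simp add: power2_eq_square algebra_simps)
    moreover have "4 * M * (M - Re (g w)) > 0" using Re[OF that] M by simp
    ultimately have "(norm (g w))\<^sup>2 < (norm (of_real (2 * M) - g w))\<^sup>2" by linarith
    then show ?thesis by (rule power_less_imp_less_base) simp
  qed
  have den: "of_real (2 * M) - g w \<noteq> 0" if "norm w < R" for w
    using lt[OF that] by (metis norm_ge_zero norm_zero not_less)
  have "(\<lambda>w. g (of_real R * w)) holomorphic_on ball 0 1"
    by (rule holomorphic_on_compose_gen[unfolded o_def, OF _ holo]) (auto intro!: holomorphic_intros simp: inb)
  then have hol: "\<phi> holomorphic_on ball 0 1"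
    unfolding \<phi>_def using den inb by (intro holomorphic_intros) auto
  have le1: "norm (\<phi> w) < 1" if "norm w < 1" for w
    using lt[OF inb[OF that]] den[OF inb[OF that]] by (simp add: \<phi>_def norm_divide)
  define w where "w = z / of_real R"
  have w: "norm w < 1" "of_real R * w = z" using assms by (auto simp: w_def norm_divide)
  have "norm (\<phi> w) \<le> norm w"
    by (rule Schwarz_Lemma(1)[OF hol _ le1 w(1)]) (simp_all add: \<phi>_def assms)
  moreover have "norm (\<phi> w) = norm (g z) / norm (of_real (2 * M) - g z)"
    by (simp only: \<phi>_def w norm_divide)
  moreover have "norm (of_real (2 * M) - g z) > 0" using den[OF assms(5)] by simp
  ultimately have "norm (g z) \<le> norm w * norm (of_real (2 * M) - g z)"
    by (simp only: pos_divide_le_eq)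
  also have "\<dots> \<le> norm w * (2 * M + norm (g z))"
    using M norm_triangle_ineq4[of "of_real (2 * M)" "g z"] by (intro mult_left_mono) auto
  also have "norm w = norm z / R" using \<open>R > 0\<close> by (simp add: w_def norm_divide)
  finally have "norm (g z) * R \<le> norm z * (2 * M + norm (g z))"
    using \<open>R > 0\<close> by (simp add: field_simps)
  then have "norm (g z) * (R - norm z) \<le> 2 * M * norm z" by (simp add: algebra_simps)
  then show ?thesis using assms(5) by (simp add: field_simps)
qed

lemma divide_out_zero:
  assumes "h holomorphic_on UNIV" "h \<zeta> = 0" "\<zeta> \<noteq> 0"
  obtains h1 where "h1 holomorphic_on UNIV" "\<And>z. h z = (1 - z / \<zeta>) * h1 z"
proof -
  define f where "f = (\<lambda>z. if z = \<zeta> then deriv h \<zeta> else h z / (z - \<zeta>))"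
  have "f holomorphic_on UNIV"
    by (rule pole_theorem_open_0[OF assms(1), of \<zeta>]) (auto simp: f_def assms)
  then have "(\<lambda>z. - \<zeta> * f z) holomorphic_on UNIV" by (intro holomorphic_intros)
  moreover have "h z = (1 - z / \<zeta>) * (- \<zeta> * f z)" for z
    using assms by (auto simp: f_def field_simps)
  ultimately show thesis by (rule that)
qed

text \<open>
  On the circle of radius \<open>3 R\<close> every factor \<open>1 - z / \<zeta>\<close> with \<open>\<bar>\<zeta>\<bar> \<le> R\<close> has modulus at least 2.
\<close>
lemma quotient_bound:
  assumes "h holomorphic_on UNIV" "\<And>z. f z = (\<Prod>\<zeta>\<leftarrow>zs. 1 - z / \<zeta>) * h z"
    and "\<And>\<zeta>. \<zeta> \<in> set zs \<Longrightarrow> \<zeta> \<noteq> 0 \<and> norm \<zeta> \<le> R" and "R > 0"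
    and B: "\<And>z. norm z = 3 * R \<Longrightarrow> norm (f z) \<le> B" and "norm z \<le> 3 * R"
  shows "norm (h z) \<le> B / 2 ^ length zs"
proof (rule maximum_modulus_frontier[of h "cball 0 (3 * R)"])
  show "h holomorphic_on interior (cball 0 (3 * R))" by (rule holomorphic_on_subset[OF assms(1)]) auto
  show "continuous_on (closure (cball 0 (3 * R))) h"
    by (rule holomorphic_on_imp_continuous_on, rule holomorphic_on_subset[OF assms(1)]) auto
  fix w :: complex assume "w \<in> frontier (cball 0 (3 * R))"
  then have w: "norm w = 3 * R" by simp
  have "2 ^ length zs \<le> norm (\<Prod>\<zeta>\<leftarrow>zs. 1 - w / \<zeta>)"
    using assms(3)
  proof (induction zs)
    case (Cons \<zeta> zs)
    have z: "\<zeta> \<noteq> 0" "norm \<zeta> \<le> R" using Cons.prems by auto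
    have "norm (w / \<zeta>) \<ge> 3" using z w by (simp add: norm_divide field_simps)
    then have "2 \<le> norm (1 - w / \<zeta>)" using norm_triangle_ineq2[of "w / \<zeta>" 1] by (simp add: norm_minus_commute)
    then show ?case using Cons by (auto simp: norm_mult intro!: mult_mono)
  qed simp
  then have "2 ^ length zs * norm (h w) \<le> norm (f w)"
    unfolding assms(2) norm_mult by (intro mult_right_mono) auto
  also have "\<dots> \<le> B" by (rule B[OF w])
  finally show "norm (h w) \<le> B / 2 ^ length zs" by (simp add: field_simps)
qed (use assms in auto)

text \<open>
  The preceding bound at the origin limits the number of zeros that can be divided out, so
  that a maximal list of them leaves a quotient without zeros in the disc.
\<close>
lemma factor_zeros_in_disc:
  assumes "f holomorphic_on UNIV" "f 0 \<noteq> 0" "R > 0"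
  obtains zs h where "h holomorphic_on UNIV" "\<And>z. f z = (\<Prod>\<zeta>\<leftarrow>zs. 1 - z / \<zeta>) * h z"
    "\<And>\<zeta>. \<zeta> \<in> set zs \<Longrightarrow> f \<zeta> = 0 \<and> norm \<zeta> \<le> R" "\<And>z. norm z \<le> R \<Longrightarrow> h z \<noteq> 0"
proof -
  define P where "P = (\<lambda>zs. (\<forall>\<zeta>\<in>set zs. f \<zeta> = 0 \<and> norm \<zeta> \<le> R) \<and>
     (\<exists>h. h holomorphic_on UNIV \<and> (\<forall>z. f z = (\<Prod>\<zeta>\<leftarrow>zs. 1 - z / \<zeta>) * h z)))"
  have "continuous_on (sphere 0 (3 * R)) f"
    using assms(1) holomorphic_on_imp_continuous_on continuous_on_subset by blast
  then have "compact (f ` sphere 0 (3 * R))" by (intro compact_continuous_image) auto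
  then obtain B where B: "\<And>z. norm z = 3 * R \<Longrightarrow> norm (f z) \<le> B"
    using compact_imp_bounded by (fastforce simp: bounded_iff)
  obtain m where m: "B / norm (f 0) < 2 ^ m" using real_arch_pow[of 2] by auto
  have len: "length zs < m" if "P zs" for zs
  proof -
    obtain h where h: "h holomorphic_on UNIV" "\<And>z. f z = (\<Prod>\<zeta>\<leftarrow>zs. 1 - z / \<zeta>) * h z"
      and zs: "\<And>\<zeta>. \<zeta> \<in> set zs \<Longrightarrow> f \<zeta> = 0 \<and> norm \<zeta> \<le> R"
      using \<open>P zs\<close> unfolding P_def by auto
    have "norm (h 0) \<le> B / 2 ^ length zs"
      by (rule quotient_bound[OF h _ assms(3) B]) (use zs assms in auto)
    moreover have "h 0 = f 0" using h(2)[of 0] by (simp add: map_replicate_const)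
    ultimately have "2 ^ length zs \<le> B / norm (f 0)" using assms(2) by (simp add: field_simps)
    then have "(2::real) ^ length zs < 2 ^ m" using m by linarith
    then show ?thesis by simp
  qed
  have "P []" using assms(1) by (auto simp: P_def)
  then have ex: "\<exists>zs. P zs" by blast
  then obtain zs where zs: "P zs" "\<And>ys. P ys \<Longrightarrow> length ys \<le> length zs"
    using ex_has_greatest_nat[of P "[]" length m] \<open>P []\<close> len by (metis less_imp_le)
  then obtain h where h: "h holomorphic_on UNIV" "\<And>z. f z = (\<Prod>\<zeta>\<leftarrow>zs. 1 - z / \<zeta>) * h z"
    unfolding P_def by auto
  have "h \<zeta> \<noteq> 0" if "norm \<zeta> \<le> R" for \<zeta>
  proof
    assume h0: "h \<zeta> = 0"
    then have f0: "f \<zeta> = 0" using h(2) by simp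
    then have "\<zeta> \<noteq> 0" using assms(2) by auto
    then obtain h1 where h1: "h1 holomorphic_on UNIV" "\<And>z. h z = (1 - z / \<zeta>) * h1 z"
      using divide_out_zero[OF h(1) h0] by blast
    have "P (\<zeta> # zs)"
      unfolding P_def
    proof (intro conjI exI[of _ h1] allI h1(1))
      show "\<forall>\<xi>\<in>set (\<zeta> # zs). f \<xi> = 0 \<and> norm \<xi> \<le> R" using zs(1) f0 that by (auto simp: P_def)
      show "f z = (\<Prod>\<xi>\<leftarrow>\<zeta> # zs. 1 - z / \<xi>) * h1 z" for z
        by (simp add: h(2) h1(2)[of z])
    qed
    then show False using zs(2) by fastforce
  qed
  then show thesis using that[OF h] zs(1) by (auto simp: P_def)
qed

lemma power_series_holomorphic:
  assumes "\<And>x. (\<lambda>n. A n * x ^ n) sums f (x::complex)"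
  shows "f holomorphic_on UNIV" "f has_fps_expansion Abs_fps A"
proof -
  have "fps_conv_radius (Abs_fps A) = \<infinity>"
    unfolding fps_conv_radius_def using sums_summable[OF assms] by (intro conv_radius_inftyI'') simp
  moreover have "eval_fps (Abs_fps A) = f"
    using assms by (auto simp: eval_fps_def sums_iff)
  ultimately show "f holomorphic_on UNIV" "f has_fps_expansion Abs_fps A"
    using holomorphic_on_eval_fps[of UNIV "Abs_fps A"] eval_fps_has_fps_expansion[of "Abs_fps A"] by auto
qed

theorem neg_rooted_limit_of_entire:
  assumes series: "\<And>x. (\<lambda>n. A n * x ^ n) sums f x"
    and A0: "A 0 = of_real c" "(c::real) > 0"
    and zeros: "\<And>x. f x = 0 \<Longrightarrow> x \<in> \<real> \<and> Re x < 0"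
    and growth: "\<And>\<epsilon>. \<epsilon> > 0 \<Longrightarrow> \<exists>B. \<forall>x. norm (f x) \<le> B * exp (\<epsilon> * norm x)"
  shows "neg_rooted_limit A"
  unfolding neg_rooted_limit_def
proof (intro allI impI)
  fix N :: nat and e :: real assume e: "e > 0"
  have holf: "f holomorphic_on UNIV" and fps: "f has_fps_expansion Abs_fps A"
    using power_series_holomorphic[OF series] by auto
  have f0: "f 0 = of_real c" using series[of 0] A0 by (simp add: sums_iff powser_zero)
  obtain B1 where B1: "\<And>x. norm (f x) \<le> B1 * exp (1 * norm x)" using growth[of 1] by auto
  define M1 where "M1 = B1 * exp 1"
  have B1pos: "B1 > 0"
  proof -
    have "0 < norm (f 0)" using f0 A0 by simp
    also have "norm (f 0) \<le> B1" using B1[of 0] by simp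
    finally show ?thesis .
  qed
  have M1: "norm (f x) \<le> M1" if "norm x \<le> 1" for x
    using B1[of x] that B1pos unfolding M1_def by (auto intro!: order_trans[OF B1] mult_left_mono)
  have M1pos: "M1 > 0" using B1pos by (simp add: M1_def)
  \<comment> \<open>\<open>\<delta>\<close> will bound the logarithm of the normalized quotient on
    the unit disc. Then f - p is at most \<open>M1 * (2 * \<delta>)\<close> there, and by Cauchy's
    inequality so is every coefficient of the difference.\<close>
  define \<delta> where "\<delta> = min (1 / 2) (e / (4 * M1))"
  have \<delta>: "\<delta> > 0" "\<delta> \<le> 1 / 2" "M1 * (2 * \<delta>) < e"
  proof -
    show "\<delta> > 0" "\<delta> \<le> 1 / 2" using e M1pos by (auto simp: \<delta>_def)
    have "\<delta> \<le> e / (4 * M1)" by (simp add: \<delta>_def)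
    then have "M1 * (2 * \<delta>) \<le> e / 2" using M1pos by (simp add: field_simps)
    then show "M1 * (2 * \<delta>) < e" using e by linarith
  qed
  \<comment> \<open>The quotient is bounded via the circle of radius 3R, where this rate contributes
    \<delta> R/8 to \<open>M\<close>; Borel-Caratheodory on the unit disc multiplies
    \<open>M\<close> by at most 4/R, giving \<delta>/2. The radius \<open>R\<close> is chosen so
    that the remaining 4L/R is at most \<delta>/2.\<close>
  obtain B where B: "\<And>x. norm (f x) \<le> B * exp (\<delta> / 24 * norm x)" using growth[of "\<delta> / 24"] \<delta> by auto
  have Bc: "B \<ge> c" using B[of 0] A0 by (simp add: f0)
  define L where "L = ln (B / c) + 1"
  have L: "L > 0" using Bc A0 by (simp add: L_def add_nonneg_pos)
  define R where "R = max 2 (8 * L / \<delta>)"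
  have R: "R \<ge> 2" "4 * L / R \<le> \<delta> / 2"
  proof -
    show "R \<ge> 2" by (simp add: R_def)
    then have "R \<ge> 8 * L / \<delta>" "R > 0" by (auto simp: R_def)
    then show "4 * L / R \<le> \<delta> / 2" using \<delta> by (simp add: field_simps)
  qed
  obtain zs h where h: "h holomorphic_on UNIV" "\<And>z. f z = (\<Prod>\<zeta>\<leftarrow>zs. 1 - z / \<zeta>) * h z"
    and zs: "\<And>\<zeta>. \<zeta> \<in> set zs \<Longrightarrow> f \<zeta> = 0 \<and> norm \<zeta> \<le> R" and hnz: "\<And>z. norm z \<le> R \<Longrightarrow> h z \<noteq> 0"
    by (rule factor_zeros_in_disc[OF holf, of R]) (use R f0 A0 in auto)
  have h0: "h 0 = of_real c" using h(2)[of 0] f0 by (simp add: map_replicate_const)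
  define M where "M = ln (B / c) + \<delta> / 24 * (3 * R) + 1"
  have hb: "norm (h z) \<le> B * exp (\<delta> / 24 * (3 * R))" if "norm z \<le> 3 * R" for z
  proof -
    have "norm (h z) \<le> B * exp (\<delta> / 24 * (3 * R)) / 2 ^ length zs"
    proof (rule quotient_bound[OF h])
      show "norm (f z) \<le> B * exp (\<delta> / 24 * (3 * R))" if "norm z = 3 * R" for z
        using B[of z] that by simp
    qed (use zs f0 A0 R that in auto)
    also have "\<dots> \<le> B * exp (\<delta> / 24 * (3 * R)) / 1"
      using Bc A0 by (intro divide_left_mono) auto
    finally show ?thesis by simp
  qed
  have hol': "(\<lambda>z. h z / of_real c) holomorphic_on ball 0 R"
    using A0 by (intro holomorphic_intros holomorphic_on_subset[OF h(1)]) auto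
  obtain g0 where g0: "g0 holomorphic_on ball 0 R" "\<And>x. x \<in> ball 0 R \<Longrightarrow> exp (g0 x) = h x / of_real c"
    by (rule holomorphic_logarithm_exists[of "ball 0 R" "\<lambda>z. h z / of_real c" 0]) (use hol' hnz R A0 in auto)
  define g where "g = (\<lambda>z. g0 z - g0 0)"
  have eg: "exp (g z) = h z / of_real c" if "norm z < R" for z
    using g0(2)[of z] g0(2)[of 0] that R A0 by (simp add: g_def exp_diff h0)
  have gRe: "Re (g z) < M" if "norm z < R" for z
  proof -
    have "exp (Re (g z)) = norm (h z) / c" using eg[OF that] A0 by (metis norm_exp_eq_Re norm_divide norm_of_real abs_of_pos)
    also have "\<dots> \<le> B * exp (\<delta> / 24 * (3 * R)) / c"
      using hb[of z] that A0 R by (intro divide_right_mono) auto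
    also have "\<dots> = exp (ln (B / c) + \<delta> / 24 * (3 * R))"
      using Bc A0 by (simp add: exp_add)
    also have "\<dots> < exp M" by (simp add: M_def)
    finally show ?thesis by simp
  qed
  have gs: "norm (g z) \<le> \<delta>" if "norm z \<le> 1" for z
  proof -
    have "\<delta> / 24 * (3 * R) > 0" using \<delta> R by simp
    then have M0: "M > 0" using L unfolding M_def L_def by linarith
    have "norm (g z) \<le> 2 * M * norm z / (R - norm z)"
      by (rule Borel_Caratheodory) (use gRe R that g0(1) in \<open>auto simp: g_def intro!: holomorphic_intros\<close>)
    also have "\<dots> \<le> 2 * M * 1 / (R / 2)"
      using that R M0 by (intro frac_le mult_left_mono) auto
    also have "\<dots> = 4 * L / R + \<delta> / 2" using R by (simp add: M_def L_def field_simps)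
    also have "\<dots> \<le> \<delta>" using R by simp
    finally show ?thesis .
  qed
  define as where "as = map (\<lambda>\<zeta>. - 1 / Re \<zeta>) zs"
  define p where "p = smult (complex_of_real c) (\<Prod>a\<leftarrow>as. [:1, of_real a:])"
  have "neg_rooted p"
    unfolding neg_rooted_def p_def using A0 zs zeros by (intro exI[of _ c] exI[of _ as]) (auto simp: as_def)
  have polyp: "poly p z = of_real c * (\<Prod>\<zeta>\<leftarrow>zs. 1 - z / \<zeta>)" for z
  proof -
    have "1 + of_real (- 1 / Re \<zeta>) * z = 1 - z / \<zeta>" if "\<zeta> \<in> set zs" for \<zeta>
    proof -
      have "of_real (Re \<zeta>) = \<zeta>" using zs[OF that] zeros by (auto simp: complex_is_Real_iff complex_eq_iff)
      then show ?thesis by simp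
    qed
    then have "map (\<lambda>\<zeta>. 1 + of_real (- 1 / Re \<zeta>) * z) zs = map (\<lambda>\<zeta>. 1 - z / \<zeta>) zs" by (intro map_cong) auto
    then have "(\<Prod>a\<leftarrow>as. 1 + of_real a * z) = (\<Prod>\<zeta>\<leftarrow>zs. 1 - z / \<zeta>)"
      by (simp only: as_def map_map o_def)
    then show ?thesis by (simp only: p_def poly_smult poly_prod_linear)
  qed
  define D where "D = (\<lambda>z. f z - poly p z)"
  have Dfps: "D has_fps_expansion (Abs_fps A - fps_of_poly p)"
  proof -
    have "eval_fps (fps_of_poly p) = poly p" by (rule ext) simp
    then have "poly p has_fps_expansion fps_of_poly p"
      using eval_fps_has_fps_expansion[of "fps_of_poly p"] by simp
    then show ?thesis unfolding D_def by (intro fps_expansion_intros fps)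
  qed
  have Db: "norm (D z) \<le> M1 * (2 * \<delta>)" if "norm z \<le> 1" for z
  proof -
    have "norm z < R" using that R by simp
    then have hz: "h z = of_real c * exp (g z)" using eg[of z] A0 by simp
    \<comment> \<open>The polynomial p is the constant times the product over the zeros, so that f =
      p exp g.\<close>
    have "D z = f z * (1 - exp (- g z))"
      unfolding D_def polyp h(2)[of z] hz exp_minus by (simp add: field_simps)
    moreover have "norm (1 - exp (- g z)) \<le> 2 * \<delta>"
    proof -
      have "norm (exp (- g z) - 1) \<le> exp \<bar>Re (- g z)\<bar> * norm (- g z)"
        using Taylor_exp[of "- g z" 0] by simp
      also have "exp \<bar>Re (- g z)\<bar> \<le> 2"
      proof -
        have "\<bar>Re (- g z)\<bar> \<le> 1 / 2" using abs_Re_le_cmod[of "g z"] gs[OF that] \<delta>(2) by simp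
        then have "exp \<bar>Re (- g z)\<bar> \<le> exp (1 / 2)" by (simp only: exp_le_cancel_iff)
        then show ?thesis by (rule order_trans) (use real_exp_bound_lemma[of "1 / 2"] in simp)
      qed
      finally have "norm (exp (- g z) - 1) \<le> 2 * norm (- g z)" by (simp add: mult_right_mono)
      then show ?thesis using gs[OF that] by (simp add: norm_minus_commute)
    qed
    ultimately show ?thesis
      using M1[OF that] M1pos by (auto simp: norm_mult intro!: mult_mono)
  qed
  have "norm (coeff p n - A n) < e" for n
  proof -
    have holD: "D holomorphic_on UNIV" unfolding D_def by (intro holomorphic_intros holf)
    have "norm ((deriv ^^ n) D 0) \<le> fact n * (M1 * (2 * \<delta>)) / 1 ^ n"
      using holD Db by (intro Cauchy_inequality) (auto intro: holomorphic_on_subset holomorphic_on_imp_continuous_on)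
    moreover have "A n - coeff p n = (deriv ^^ n) D 0 / fact n"
      using fps_nth_fps_expansion[OF Dfps, of n] by simp
    then have "norm (A n - coeff p n) = norm ((deriv ^^ n) D 0) / fact n"
      by (simp only: norm_divide norm_fact)
    ultimately have "norm (A n - coeff p n) \<le> M1 * (2 * \<delta>)"
      by (simp add: divide_le_eq mult.commute)
    then show ?thesis using \<delta>(3) by (simp add: norm_minus_commute)
  qed
  then show "\<exists>p. neg_rooted p \<and> (\<forall>n\<le>N. norm (coeff p n - A n) < e)" using \<open>neg_rooted p\<close> by blast
qed

section \<open>Hutchinson's criterion\<close>

lemma alternating_sum_bounds:
  fixes u :: "nat \<Rightarrow> real"
  assumes "\<And>j. j \<le> m \<Longrightarrow> 0 \<le> u j" "\<And>j. j < m \<Longrightarrow> u (Suc j) \<le> u j"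
  shows "0 \<le> (\<Sum>j\<le>m. (-1) ^ j * u j) \<and> (\<Sum>j\<le>m. (-1) ^ j * u j) \<le> u 0"
  using assms
proof (induction m arbitrary: u)
  case (Suc m)
  have "0 \<le> (\<Sum>j\<le>m. (-1) ^ j * u (Suc j)) \<and> (\<Sum>j\<le>m. (-1) ^ j * u (Suc j)) \<le> u 1"
    using Suc.IH[of "\<lambda>j. u (Suc j)"] Suc.prems by simp
  moreover have "(\<Sum>j\<le>Suc m. (-1) ^ j * u j) = u 0 - (\<Sum>j\<le>m. (-1) ^ j * u (Suc j))"
    by (subst sum.atMost_Suc_shift) (simp add: sum_negf)
  ultimately show ?case using Suc.prems(2)[of 0] by simp
qed simp

text \<open>
  At a point where the \<open>k\<close>-th term exceeds twice each of its neighbours, the terms decrease on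
  both sides of it, and it dominates the two alternating sums.
\<close>
lemma dominant_term_sign:
  fixes t :: "nat \<Rightarrow> real"
  assumes pos: "\<And>n. t n > 0" and lc: "\<And>n. (t (Suc n))\<^sup>2 > 4 * t n * t (n + 2)"
    and up: "2 * t (Suc k) < t k" and down: "k > 0 \<Longrightarrow> 2 * t (k - 1) < t k" and "k \<le> N"
  shows "0 < (-1) ^ k * (\<Sum>n\<le>N. (-1) ^ n * t n)"
proof -
  have dec_up: "t (Suc (k + j)) \<le> t (k + j)" for j
  proof (induction j)
    case 0 then show ?case using up pos[of "Suc k"] by simp
  next
    case (Suc j)
    have "4 * t (k + j) * t (Suc (k + Suc j)) \<le> t (Suc (k + j)) * t (Suc (k + j))"
      using lc[of "k + j"] by (simp add: power2_eq_square)
    also have "\<dots> \<le> t (k + j) * t (Suc (k + j))" using Suc pos by (intro mult_right_mono) (auto simp: less_imp_le)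
    finally have "4 * t (Suc (k + Suc j)) \<le> t (Suc (k + j))"
      using pos[of "k+j"] by (simp add: mult.assoc mult.left_commute)
    then show ?case using pos[of "Suc (k + Suc j)"] by simp
  qed
  have dec_down: "Suc j \<le> k \<Longrightarrow> t (k - Suc j) \<le> t (k - j)" for j
  proof (induction j)
    case 0 then show ?case using down pos[of "k - 1"] by simp
  next
    case (Suc j)
    define i where "i = k - Suc (Suc j)"
    have i: "k - Suc j = Suc i" "k - j = i + 2" using Suc.prems by (auto simp: i_def)
    have "4 * t i * t (i + 2) \<le> t (Suc i) * t (Suc i)"
      using lc[of i] by (simp add: power2_eq_square)
    also have "\<dots> \<le> t (Suc i) * t (i + 2)" using Suc pos[of "Suc i"] by (intro mult_left_mono) (auto simp: i less_imp_le)
    finally have "4 * t i \<le> t (Suc i)"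
      using pos[of "i + 2"] by (simp add: mult.assoc mult.left_commute)
    then show ?case using pos[of i] i by (simp add: i_def)
  qed
  have split: "(\<Sum>n\<le>N. (-1) ^ n * t n) = (\<Sum>n<k. (-1) ^ n * t n) + (-1) ^ k * t k + (\<Sum>n\<in>{k<..N}. (-1) ^ n * t n)"
  proof -
    have *: "{..N} = {..<k} \<union> ({k} \<union> {k<..N})" using assms(5) by auto
    show ?thesis unfolding * by (subst sum.union_disjoint, simp, simp, force, subst sum.union_disjoint) auto
  qed
  have U: "(-1) ^ k * (\<Sum>n\<in>{k<..N}. (-1) ^ n * t n) \<ge> - t (Suc k)"
  proof (cases "k = N")
    case True then show ?thesis using pos[of "Suc k"] by simp
  next
    case False
    define m where "m = N - Suc k"
    have "(\<Sum>n\<in>{k<..N}. (-1) ^ n * t n) = (\<Sum>j\<le>m. (-1) ^ (Suc k + j) * t (Suc k + j))"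
      using False assms(5)
      by (intro sum.reindex_bij_witness[of _ "\<lambda>j. Suc k + j" "\<lambda>n. n - Suc k"]) (auto simp: m_def)
    then have "(-1) ^ k * (\<Sum>n\<in>{k<..N}. (-1) ^ n * t n) = (\<Sum>j\<le>m. - ((-1) ^ (2 * k) * ((-1) ^ j * t (Suc k + j))))"
      by (simp add: sum_distrib_left power_add mult_2 mult_ac)
    then have "(-1) ^ k * (\<Sum>n\<in>{k<..N}. (-1) ^ n * t n) = - (\<Sum>j\<le>m. (-1) ^ j * t (Suc k + j))"
      by (simp add: sum_negf)
    moreover have "(\<Sum>j\<le>m. (-1) ^ j * t (Suc k + j)) \<le> t (Suc k + 0)"
      by (rule alternating_sum_bounds[THEN conjunct2]) (use pos dec_up[of "Suc _"] in \<open>auto simp: less_imp_le\<close>)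
    ultimately show ?thesis by simp
  qed
  have D: "(-1) ^ k * (\<Sum>n<k. (-1) ^ n * t n) \<ge> - (if k = 0 then 0 else t (k - 1))"
  proof (cases k)
    case (Suc m)
    have "(\<Sum>n<k. (-1) ^ n * t n) = (\<Sum>j\<le>m. (-1) ^ (m - j) * t (m - j))"
      by (intro sum.reindex_bij_witness[of _ "\<lambda>j. m - j" "\<lambda>n. m - n"]) (auto simp: Suc)
    also have "\<dots> = (-1) ^ m * (\<Sum>j\<le>m. (-1) ^ j * t (m - j))"
      unfolding sum_distrib_left
    proof (intro sum.cong refl)
      fix j assume "j \<in> {..m}"
      then show "(-1) ^ (m - j) * t (m - j) = (-1) ^ m * ((-1) ^ j * t (m - j))"
        by (auto simp: minus_one_power_iff)
    qed
    finally have "(-1) ^ k * (\<Sum>n<k. (-1) ^ n * t n) = - ((-1) ^ m * (-1) ^ m) * (\<Sum>j\<le>m. (-1) ^ j * t (m - j))"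
      by (simp add: Suc)
    also have "(-1) ^ m * (-1) ^ m = (1::real)" by (simp add: power_add[symmetric] mult_2[symmetric])
    finally have "(-1) ^ k * (\<Sum>n<k. (-1) ^ n * t n) = - (\<Sum>j\<le>m. (-1) ^ j * t (m - j))" by simp
    moreover have "(\<Sum>j\<le>m. (-1) ^ j * t (m - j)) \<le> t (m - 0)"
      by (rule alternating_sum_bounds[THEN conjunct2]) (use pos dec_down[of "Suc _"] in \<open>auto simp: less_imp_le Suc\<close>)
    ultimately show ?thesis by (simp add: Suc)
  qed simp
  have "(-1) ^ k * ((-1) ^ k * t k) = t k" by (simp add: mult.assoc[symmetric] power_add[symmetric] mult_2[symmetric])
  then have "(-1) ^ k * (\<Sum>n\<le>N. (-1) ^ n * t n) \<ge> t k - t (Suc k) - (if k = 0 then 0 else t (k - 1))"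
    using U D unfolding split distrib_left by linarith
  moreover have "t k - t (Suc k) - (if k = 0 then 0 else t (k - 1)) > 0"
    using up down pos[of k] pos[of "Suc k"] by (cases "k = 0") auto
  ultimately show ?thesis by linarith
qed

text \<open>At N + 1 points -r_k the k-th term dominates, so the values there alternate in sign. The
  N zeros in between exhaust a polynomial of degree at most N.\<close>

lemma neg_rooted_truncation:
  fixes a :: "nat \<Rightarrow> real"
  assumes pos: "\<And>n. a n > 0" and lc: "\<And>n. (a (Suc n))\<^sup>2 > 4 * a n * a (n + 2)"
  shows "neg_rooted (\<Sum>n\<le>N. monom (of_real (a n)) n)" (is "neg_rooted ?p")
proof -
  define q where "q = (\<lambda>x. \<Sum>n\<le>N. a n * x ^ n)"
  have pq: "poly ?p (of_real x) = of_real (q x)" for x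
    by (simp add: poly_sum poly_monom q_def)
  \<comment> \<open>At this radius the terms of index k-1 and k+1 coincide, so exceeding twice
    either of them is the same condition, namely a_k^2 > 4 a_{k-1} a_{k+1}. The point for k = 0 is
    the origin.\<close>
  define r where "r = (\<lambda>k. if k = 0 then 0 else sqrt (a (k - 1) / a (k + 1)))"
  have r_pos: "r (Suc k) > 0" for k using pos by (simp add: r_def)
  have r2: "r (Suc k) ^ 2 = a k / a (k + 2)" for k using pos by (simp add: r_def less_imp_le)
  have low: "2 * a k < r (Suc k) * a (Suc k)" for k
  proof (rule power_less_imp_less_base[where n = 2])
    have "(2 * a k)\<^sup>2 * a (k + 2) < a k * (a (Suc k))\<^sup>2"
      using mult_strict_left_mono[OF lc[of k] pos[of k]] by (simp add: power2_eq_square mult_ac)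
    then show "(2 * a k)\<^sup>2 < (r (Suc k) * a (Suc k))\<^sup>2"
      using pos[of "k + 2"] by (simp add: power_mult_distrib r2 field_simps)
  qed (use r_pos pos in \<open>auto simp: less_imp_le\<close>)
  have high: "2 * r (Suc k) * a (k + 2) < a (Suc k)" for k
  proof (rule power_less_imp_less_base[where n = 2])
    have "4 * a k * a (k + 2) < (a (Suc k))\<^sup>2" by (rule lc)
    moreover have "(2 * r (Suc k) * a (k + 2))\<^sup>2 = 4 * a k * a (k + 2)"
      unfolding power_mult_distrib r2 using pos[of "k + 2"] by (simp add: power2_eq_square)
    ultimately show "(2 * r (Suc k) * a (k + 2))\<^sup>2 < (a (Suc k))\<^sup>2" by simp
  qed (use pos in \<open>auto simp: less_imp_le\<close>)
  have r_mono: "r k < r (Suc k)" for k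
  proof (cases k)
    case 0 then show ?thesis using r_pos[of 0] by (simp add: r_def)
  next
    case (Suc j)
    have "2 * r (Suc j) * a (j + 2) < r (Suc (Suc j)) * a (Suc (Suc j))"
      using high[of j] low[of "Suc j"] pos[of "Suc j"] by simp
    then have "2 * r (Suc j) < r (Suc (Suc j))" using pos[of "j + 2"] by simp
    then show ?thesis using r_pos[of j] Suc by simp
  qed
  have sign: "0 < (-1) ^ k * q (- r k)" if "k \<le> N" for k
  proof (cases k)
    case 0
    have "q 0 = (\<Sum>n\<in>{0}. a n * 0 ^ n)" unfolding q_def by (rule sum.mono_neutral_right) auto
    then show ?thesis using pos[of 0] 0 by (simp add: r_def)
  next
    case (Suc j)
    define t where "t = (\<lambda>n. a n * r k ^ n)"
    have "q (- r k) = (\<Sum>n\<le>N. (-1) ^ n * t n)"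
      unfolding q_def t_def by (intro sum.cong refl, subst power_minus) simp
    moreover have "0 < (-1) ^ k * (\<Sum>n\<le>N. (-1) ^ n * t n)"
    proof (rule dominant_term_sign[OF _ _ _ _ that])
      have rk: "r k > 0" using r_pos Suc by simp
      show "t n > 0" for n using rk pos by (simp add: t_def)
      show "4 * t n * t (n + 2) < (t (Suc n))\<^sup>2" for n
      proof -
        have "4 * t n * t (n + 2) = 4 * a n * a (n + 2) * (r k ^ Suc n)\<^sup>2"
          by (simp add: t_def power2_eq_square)
        also have "\<dots> < (a (Suc n))\<^sup>2 * (r k ^ Suc n)\<^sup>2"
          using rk by (intro mult_strict_right_mono lc) auto
        finally show ?thesis by (simp add: t_def power_mult_distrib)
      qed
      show "2 * t (Suc k) < t k"
        using mult_strict_right_mono[OF high[of j], of "r k ^ Suc j"] rk by (simp add: t_def Suc mult_ac)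
      show "2 * t (k - 1) < t k"
        using mult_strict_right_mono[OF low[of j], of "r k ^ j"] rk by (simp add: t_def Suc mult_ac)
    qed
    ultimately show ?thesis by simp
  qed
  have cont: "continuous_on S q" for S unfolding q_def by (intro continuous_intros)
  have "\<exists>x. - r (Suc k) < x \<and> x < - r k \<and> q x = 0" if "k < N" for k
  proof -
    have s: "0 < (-1) ^ k * q (- r k)" "0 < (-1) ^ Suc k * q (- r (Suc k))" using sign[of k] sign[of "Suc k"] that by auto
    have "\<exists>x\<ge>- r (Suc k). x \<le> - r k \<and> (-1) ^ k * q x = 0"
      using s r_mono[of k] by (intro IVT') (auto intro!: continuous_intros cont)
    then obtain x where x: "- r (Suc k) \<le> x" "x \<le> - r k" "q x = 0" by auto
    moreover have "x \<noteq> - r k" "x \<noteq> - r (Suc k)" using s x(3) by auto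
    ultimately show ?thesis by (intro exI[of _ x]) auto
  qed
  then obtain x where x: "\<And>k. k < N \<Longrightarrow> - r (Suc k) < x k" "\<And>k. k < N \<Longrightarrow> x k < - r k" "\<And>k. k < N \<Longrightarrow> q (x k) = 0"
    by metis
  have r_mono': "r i \<le> r j" if "i \<le> j" for i j
    by (rule lift_Suc_mono_le[of r, OF less_imp_le[OF r_mono] that])
  have inj: "inj_on x {..<N}"
  proof (rule linorder_inj_onI')
    fix i j assume ij: "i \<in> {..<N}" "j \<in> {..<N}" "i < j"
    then have "x j < - r j" "- r j \<le> - r (Suc i)" "- r (Suc i) < x i" using x r_mono' by auto
    then show "x i \<noteq> x j" by linarith
  qed
  have coeff: "coeff ?p n = (if n \<le> N then of_real (a n) else 0)" for n
    by (simp add: coeff_sum)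
  have p0: "?p \<noteq> 0" using coeff[of 0] pos[of 0] by (metis coeff_0 le0 of_real_eq_0_iff less_irrefl)
  have deg: "degree ?p \<le> N" by (rule degree_le) (simp add: coeff)
  define Z where "Z = (\<lambda>k. complex_of_real (x k)) ` {..<N}"
  have "inj_on (\<lambda>k. complex_of_real (x k)) {..<N}" using inj by (auto simp: inj_on_def)
  then have cardZ: "card Z = N" unfolding Z_def by (simp add: card_image)
  have Zsub: "Z \<subseteq> {z. poly ?p z = 0}" using x(3) by (auto simp: Z_def pq)
  have fin: "finite {z. poly ?p z = 0}" by (rule poly_roots_finite[OF p0])
  have "card {z. poly ?p z = 0} \<le> degree ?p" by (rule card_poly_roots_bound[OF p0])
  then have "card {z. poly ?p z = 0} \<le> card Z" using deg cardZ by simp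
  then have Z: "Z = {z. poly ?p z = 0}" using card_seteq[OF fin Zsub] by simp
  show ?thesis
  proof (rule neg_rootedI_roots)
    show "coeff ?p 0 = of_real (a 0)" by (simp add: coeff)
    fix z assume "poly ?p z = 0"
    then obtain k where k: "k < N" "z = of_real (x k)" using Z by (auto simp: Z_def)
    then have "x k < - r k" "r 0 \<le> r k" using x(2) r_mono' by auto
    then show "z \<in> \<real> \<and> Re z < 0" using k by (simp add: r_def split: if_splits)
  qed (rule pos)
qed

lemma neg_rooted_limit_Hutchinson:
  fixes a :: "nat \<Rightarrow> real"
  assumes "\<And>n. a n > 0" "\<And>n. (a (Suc n))\<^sup>2 > 4 * a n * a (n + 2)"
  shows "neg_rooted_limit (\<lambda>n. of_real (a n))"
  unfolding neg_rooted_limit_def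
proof (intro allI impI)
  fix N :: nat and e :: real assume "e > 0"
  then show "\<exists>p. neg_rooted p \<and> (\<forall>n\<le>N. norm (coeff p n - of_real (a n)) < e)"
    by (intro exI[of _ "\<Sum>n\<le>N. monom (of_real (a n)) n"] conjI neg_rooted_truncation assms) (simp add: coeff_sum)
qed

section \<open>The inversion formula of the theta function\<close>

lemma sum_roots_of_unity:
  fixes d :: int and l :: nat
  assumes "l > 0"
  shows "(\<Sum>\<nu><l. exp (2 * of_real pi * \<i> * of_int d / of_nat l) ^ \<nu>) = (if int l dvd d then of_nat l else 0)"
proof -
  define w where "w = exp (2 * of_real pi * \<i> * of_int d / of_nat l)"
  have wl: "w ^ l = 1"
  proof -
    have "w ^ l = exp (2 * of_real pi * \<i> * of_int d)"
      unfolding w_def exp_of_nat_mult[symmetric] using assms by simp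
    also have "\<dots> = 1" by (subst exp_eq_1) auto
    finally show ?thesis .
  qed
  have w1: "w = 1 \<longleftrightarrow> int l dvd d"
  proof -
    have "w = 1 \<longleftrightarrow> (\<exists>n::int. 2 * pi * of_int d / of_nat l = of_int (2 * n) * pi)"
      unfolding w_def exp_eq_1 by (simp add: Re_divide_of_nat Im_divide_of_nat)
    also have "\<dots> \<longleftrightarrow> (\<exists>n::int. d = int l * n)"
    proof (intro ex_cong1)
      fix n :: int
      have "2 * pi * of_int d / of_nat l = of_int (2 * n) * pi \<longleftrightarrow> real_of_int d = real_of_int (int l * n)"
        using assms by (auto simp: field_simps)
      then show "2 * pi * of_int d / of_nat l = of_int (2 * n) * pi \<longleftrightarrow> d = int l * n"
        by (simp only: of_int_eq_iff)
    qed
    finally show ?thesis by (simp add: dvd_def)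
  qed
  show ?thesis
    unfolding w_def[symmetric]
  proof (cases "int l dvd d")
    case True
    then show "(\<Sum>\<nu><l. w ^ \<nu>) = (if int l dvd d then of_nat l else 0)" using w1 by simp
  next
    case False
    then show "(\<Sum>\<nu><l. w ^ \<nu>) = (if int l dvd d then of_nat l else 0)"
      using geometric_sum[of w l] w1 wl by simp
  qed
qed

lemma cos_power_binomial:
  "complex_of_real ((2 * cos x) ^ (2 * m)) = (\<Sum>j\<le>2 * m. of_nat ((2 * m) choose j) * exp (2 * \<i> * of_real x * of_int (int j - int m)))"
proof -
  have "2 * complex_of_real (cos x) = exp (\<i> * x) + exp (- (\<i> * x))"
    by (simp add: cos_of_real[symmetric] cos_exp_eq)
  then have "complex_of_real ((2 * cos x) ^ (2 * m)) = (exp (\<i> * x) + exp (- (\<i> * x))) ^ (2 * m)"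
    by (simp only: of_real_power of_real_mult of_real_numeral)
  also have "\<dots> = (\<Sum>j\<le>2 * m. of_nat ((2 * m) choose j) * exp (\<i> * x) ^ j * exp (- (\<i> * x)) ^ (2 * m - j))"
    by (rule binomial_ring)
  also have "\<dots> = (\<Sum>j\<le>2 * m. of_nat ((2 * m) choose j) * exp (2 * \<i> * of_real x * of_int (int j - int m)))"
  proof (intro sum.cong refl)
    fix j assume "j \<in> {..2 * m}"
    then have "exp (\<i> * x) ^ j * exp (- (\<i> * x)) ^ (2 * m - j) = exp (2 * \<i> * of_real x * of_int (int j - int m))"
      by (simp add: exp_of_nat_mult[symmetric] exp_add[symmetric] of_nat_diff algebra_simps)
    then show "of_nat ((2 * m) choose j) * exp (\<i> * x) ^ j * exp (- (\<i> * x)) ^ (2 * m - j) =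
        of_nat ((2 * m) choose j) * exp (2 * \<i> * of_real x * of_int (int j - int m))" by (simp add: mult.assoc)
  qed
  finally show ?thesis .
qed

lemma sum_cos_power:
  assumes "l > 0"
  shows "(\<Sum>\<nu><l. (2 * cos (pi * real \<nu> / l)) ^ (2 * m)) = real l * (\<Sum>j\<le>2 * m. if int l dvd int j - int m then real ((2 * m) choose j) else 0)"
proof -
  have "complex_of_real (\<Sum>\<nu><l. (2 * cos (pi * real \<nu> / l)) ^ (2 * m)) =
      (\<Sum>\<nu><l. \<Sum>j\<le>2 * m. of_nat ((2 * m) choose j) * exp (2 * of_real pi * \<i> * of_int (int j - int m) / of_nat l) ^ \<nu>)"
    unfolding of_real_sum cos_power_binomial
    by (intro sum.cong refl) (simp add: exp_of_nat_mult[symmetric] mult_ac)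
  also have "\<dots> = (\<Sum>j\<le>2 * m. of_nat ((2 * m) choose j) * (\<Sum>\<nu><l. exp (2 * of_real pi * \<i> * of_int (int j - int m) / of_nat l) ^ \<nu>))"
    by (subst sum.swap) (simp add: sum_distrib_left)
  also have "\<dots> = complex_of_real (real l * (\<Sum>j\<le>2 * m. if int l dvd int j - int m then real ((2 * m) choose j) else 0))"
    unfolding sum_roots_of_unity[OF assms] of_real_mult of_real_sum sum_distrib_left
    by (intro sum.cong refl) auto
  finally show ?thesis by (simp only: of_real_eq_iff)
qed

text \<open>The central index stands alone and the others pair under j -> 2m - j. Indices beyond 2m
  contribute vanishing binomial coefficients.\<close>

lemma sum_binomial_multiples:
  assumes "l > 0"
  shows "(\<Sum>j\<le>2 * m. if int l dvd int j - int m then real ((2 * m) choose j) else 0)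
    = real ((2 * m) choose m) + 2 * (\<Sum>k<m. real ((2 * m) choose (m + l * Suc k)))"
proof -
  define h where "h = (\<lambda>j. if int l dvd int j - int m then real ((2 * m) choose j) else 0)"
  have *: "{..2 * m} = {..<m} \<union> ({m} \<union> {m<..2 * m})" by auto
  have s: "(\<Sum>j\<le>2 * m. h j) = (\<Sum>j<m. h j) + (h m + (\<Sum>j\<in>{m<..2*m}. h j))"
    unfolding * by (subst sum.union_disjoint, simp, simp, force, subst sum.union_disjoint) auto
  have refl: "(\<Sum>j<m. h j) = (\<Sum>j\<in>{m<..2*m}. h j)"
  proof (intro sum.reindex_bij_witness[of _ "\<lambda>j. 2 * m - j" "\<lambda>j. 2 * m - j"])
    fix j assume j: "j \<in> {..<m}"
    have "int (2 * m - j) - int m = - (int j - int m)" using j by (simp add: of_nat_diff)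
    then have "int l dvd int (2 * m - j) - int m \<longleftrightarrow> int l dvd int j - int m" by (simp only: dvd_minus_iff)
    then show "h (2 * m - j) = h j" using j by (simp add: h_def binomial_symmetric[of j "2 * m"])
  qed auto
  have up: "(\<Sum>j\<in>{m<..2*m}. h j) = (\<Sum>k<m. real ((2 * m) choose (m + l * Suc k)))"
  proof -
    have "(\<Sum>k<m. real ((2 * m) choose (m + l * Suc k))) = (\<Sum>k\<in>{k. k < m \<and> l * Suc k \<le> m}. real ((2 * m) choose (m + l * Suc k)))"
      by (intro sum.mono_neutral_right) (auto simp: binomial_eq_0)
    also have "\<dots> = (\<Sum>j\<in>{j\<in>{m<..2*m}. int l dvd int j - int m}. real ((2 * m) choose j))"
    proof (intro sum.reindex_bij_witness[of _ "\<lambda>j. (j - m) div l - 1" "\<lambda>k. m + l * Suc k"])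
      fix j assume j: "j \<in> {j\<in>{m<..2*m}. int l dvd int j - int m}"
      then have "int l dvd int (j - m)" by (simp add: of_nat_diff)
      then have "l dvd j - m" by (simp only: int_dvd_int_iff)
      then obtain c where c: "j - m = l * c" by blast
      then have c0: "c > 0" using j by (cases c) auto
      then have jc: "j = m + l * Suc (c - 1)" using c j by auto
      have "c \<le> m"
      proof -
        have "1 * c \<le> l * c" using assms by (intro mult_le_mono1) simp
        also have "l * c \<le> m" using c j by auto
        finally show ?thesis by simp
      qed
      have e: "(j - m) div l - 1 = c - 1" using c assms by simp
      show "m + l * Suc ((j - m) div l - 1) = j" unfolding e by (rule jc[symmetric])
      have "m + l * Suc (c - 1) \<le> 2 * m" using j jc by auto
      then have "l * Suc (c - 1) \<le> m" by linarith
      then show "(j - m) div l - 1 \<in> {k. k < m \<and> l * Suc k \<le> m}" unfolding e using c0 \<open>c \<le> m\<close> by (auto simp del: mult_Suc_right)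
    qed (use assms in auto)
    also have "\<dots> = (\<Sum>j\<in>{m<..2*m}. h j)"
      unfolding h_def by (simp add: sum.If_cases Int_def conj_commute cong: conj_cong)
    finally show ?thesis by simp
  qed
  have "h m = real ((2 * m) choose m)" by (simp add: h_def)
  then show ?thesis unfolding h_def[symmetric] s refl up by simp
qed

text \<open>
  Both sides count the exponents divisible by \<open>l\<close> in the expansion of
  \<open>(z + 1 / z)\<^sup>2\<^sup>m\<close>; letting \<open>l\<close> and \<open>m\<close> grow with \<open>l\<^sup>2 / m\<close> tending to \<open>t\<close> turns the identity
  into the inversion formula of the theta function (Polya).
\<close>
lemma theta_finite_identity:
  assumes l: "l = 2 * q + 1"
  shows "1 + 2 * (\<Sum>j<q. ((cos (pi * Suc j / l))\<^sup>2) ^ m)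
    = real l * (real ((2 * m) choose m) / 4 ^ m) *
      (1 + 2 * (\<Sum>k<m. real ((2 * m) choose (m + l * Suc k)) / real ((2 * m) choose m)))"
proof -
  define c where "c = (\<lambda>\<nu>. (2 * cos (pi * real \<nu> / l)) ^ (2 * m))"
  have "(\<Sum>\<nu><l. c \<nu>) = c 0 + (\<Sum>j<2 * q. c (Suc j))"
    unfolding l by (simp add: sum.lessThan_Suc_shift del: sum.lessThan_Suc)
  also have "(\<Sum>j<2 * q. c (Suc j)) = (\<Sum>j<q. c (Suc j)) + (\<Sum>j\<in>{q..<2*q}. c (Suc j))"
  proof -
    have *: "{..<2 * q} = {..<q} \<union> {q..<2*q}" by auto
    show ?thesis unfolding * by (rule sum.union_disjoint) auto
  qed
  \<comment> \<open>As \<open>l\<close> is odd, the indices 1, ..., 2q pair under \<nu> -> l -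
    \<nu>, which changes only the sign of the cosine.\<close>
  also have "(\<Sum>j\<in>{q..<2*q}. c (Suc j)) = (\<Sum>j<q. c (Suc j))"
  proof (intro sum.reindex_bij_witness[of _ "\<lambda>j. 2 * q - 1 - j" "\<lambda>j. 2 * q - 1 - j"])
    fix j assume j: "j \<in> {q..<2*q}"
    have "real (Suc (2 * q - 1 - j)) = real l - real (Suc j)" using j by (simp add: l of_nat_diff)
    then have "pi * real (Suc (2 * q - 1 - j)) / l = pi - pi * real (Suc j) / l"
      using l by (simp add: field_simps)
    then have "cos (pi * real (Suc (2 * q - 1 - j)) / l) = - cos (pi * real (Suc j) / l)"
      by (simp only: cos_pi_minus)
    then show "c (Suc (2 * q - 1 - j)) = c (Suc j)" by (simp only: c_def power_mult) simp
  qed auto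
  finally have cs: "(\<Sum>\<nu><l. c \<nu>) = c 0 + ((\<Sum>j<q. c (Suc j)) + (\<Sum>j<q. c (Suc j)))" .
  have lpos: "l > 0" using l by simp
  define b where "b = real ((2 * m) choose m)"
  define S where "S = (\<Sum>k<m. real ((2 * m) choose (m + l * Suc k)))"
  define A where "A = (\<Sum>j<q. ((cos (pi * Suc j / l))\<^sup>2) ^ m)"
  have tot: "(\<Sum>\<nu><l. c \<nu>) = real l * (b + 2 * S)"
    unfolding c_def sum_cos_power[OF lpos] sum_binomial_multiples[OF lpos] b_def S_def ..
  have "c (Suc j) = 4 ^ m * ((cos (pi * Suc j / l))\<^sup>2) ^ m" for j
    by (simp only: c_def power_mult power_mult_distrib) simp
  then have "(\<Sum>j<q. c (Suc j)) = 4 ^ m * A" by (simp only: A_def sum_distrib_left)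
  moreover have "c 0 = 4 ^ m" by (simp add: c_def power_mult)
  ultimately have eq: "4 ^ m + (4 ^ m * A + 4 ^ m * A) = real l * (b + 2 * S)" using cs tot by simp
  have b: "b > 0" by (simp add: b_def)
  have "real l * (b / 4 ^ m) * (1 + 2 * (S / b)) = real l * (b + 2 * S) / 4 ^ m"
    using b by (simp add: field_simps)
  also have "\<dots> = 1 + 2 * A" unfolding eq[symmetric] by (simp add: field_simps)
  finally show ?thesis by (simp only: A_def S_def b_def sum_divide_distrib)
qed

text \<open>An exact reciprocal of a partial Wallis product: this is how \<pi> enters the factor in
  front of the inverted theta series.\<close>

lemma central_binomial_wallis:
  "(real ((2 * n) choose n) / 4 ^ n)\<^sup>2 * (2 * real n + 1) = 1 / (\<Prod>k=1..n. (4*real k^2) / (4*real k^2 - 1))"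
proof (induction n)
  case (Suc n)
  have "real ((2 * Suc n) choose Suc n) * real (Suc n) = 2 * (2 * real n + 1) * real ((2 * n) choose n)"
  proof -
    have "Suc n * ((2 * Suc n) choose Suc n) = (2 * Suc n) * ((2 * n + 1) choose n)"
      using Suc_times_binomial_eq[of "2 * n + 1" n] by (simp add: mult_ac)
    moreover have "Suc n * ((2 * n + 1) choose n) = (2 * n + 1) * ((2 * n) choose n)"
      using Suc_times_binomial_add[of n n] binomial_symmetric[of n "2 * n + 1"] Suc_times_binomial_eq[of "2 * n" n] by (simp add: mult_2)
    ultimately have "Suc n * (Suc n * ((2 * Suc n) choose Suc n)) = Suc n * (2 * (2 * n + 1) * ((2 * n) choose n))"
      by (metis mult.assoc mult.left_commute)
    then have "Suc n * ((2 * Suc n) choose Suc n) = 2 * (2 * n + 1) * ((2 * n) choose n)"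
      by (simp only: mult_cancel1) simp
    then have "real (Suc n * ((2 * Suc n) choose Suc n)) = real (2 * (2 * n + 1) * ((2 * n) choose n))"
      by (simp only:)
    then show ?thesis by (simp only: of_nat_mult of_nat_add mult_ac of_nat_numeral of_nat_1)
  qed
  moreover define X Y where "X = real ((2 * Suc n) choose Suc n)" and "Y = real ((2 * n) choose n)"
  ultimately have e: "X * real (Suc n) = 2 * (2 * real n + 1) * Y" by (simp only: X_def Y_def)
  have r: "X / 4 ^ Suc n = (2 * real n + 1) / (2 * real (Suc n)) * (Y / 4 ^ n)"
  proof -
    have "X = 2 * (2 * real n + 1) * Y / real (Suc n)" using e by (simp add: field_simps del: of_nat_Suc)
    then show ?thesis by (simp add: field_simps del: of_nat_Suc)
  qed
  define P where "P = (\<Prod>k=1..n. (4*real k^2) / (4*real k^2 - 1))"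
  have P: "(\<Prod>k=1..Suc n. (4*real k^2) / (4*real k^2 - 1)) = P * ((4*real (Suc n)^2) / (4*real (Suc n)^2 - 1))"
    unfolding P_def by (simp del: of_nat_Suc)
  have IH: "(Y / 4 ^ n)\<^sup>2 * (2 * real n + 1) = 1 / P" using Suc.IH by (simp only: Y_def P_def)
  have "(X / 4 ^ Suc n)\<^sup>2 * (2 * real (Suc n) + 1) =
     (2 * real n + 1) * (2 * real (Suc n) + 1) / (2 * real (Suc n))\<^sup>2 * ((Y / 4 ^ n)\<^sup>2 * (2 * real n + 1))"
    unfolding r power_mult_distrib power_divide by (simp add: power2_eq_square)
  also have "(2 * real n + 1) * (2 * real (Suc n) + 1) = 4 * (real (Suc n))\<^sup>2 - 1" by (simp add: power2_eq_square algebra_simps)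
  also have "(4 * (real (Suc n))\<^sup>2 - 1) / (2 * real (Suc n))\<^sup>2 * ((Y / 4 ^ n)\<^sup>2 * (2 * real n + 1)) =
      1 / (P * ((4*real (Suc n)^2) / (4*real (Suc n)^2 - 1)))"
    unfolding IH power_mult_distrib by (simp del: of_nat_Suc)
  finally show ?case unfolding P X_def .
qed simp

section \<open>Gaussian bounds for binomial coefficients\<close>

lemma binomial_ratio:
  assumes "j \<le> m"
  shows "real ((2 * m) choose (m + j)) / real ((2 * m) choose m) = (\<Prod>i=1..j. 1 - real j / real (m + i))"
proof -
  have "real ((2 * m) choose (m + j)) = fact (2 * m) / (fact (m + j) * fact (m - j))"
    using assms by (simp add: binomial_fact)
  moreover have "real ((2 * m) choose m) = fact (2 * m) / (fact m * fact m)"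
    by (simp add: binomial_fact)
  ultimately have "real ((2 * m) choose (m + j)) / real ((2 * m) choose m) = (fact m / fact (m - j)) / (fact (m + j) / fact m)"
    by (simp add: field_simps)
  also have "fact (m + j) / fact m = (\<Prod>i=1..j. real (m + i))"
  proof (induction j)
    case (Suc j)
    then show ?case by (simp add: field_simps)
  qed simp
  also have "fact m / fact (m - j) = (\<Prod>i=1..j. real (m - j + i))"
  proof -
    have "fact (k + j) / fact k = (\<Prod>i=1..j. real (k + i))" for k
      by (induction j) (auto simp: field_simps)
    from this[of "m - j"] assms show ?thesis by simp
  qed
  also have "(\<Prod>i=1..j. real (m - j + i)) / (\<Prod>i=1..j. real (m + i)) = (\<Prod>i=1..j. 1 - real j / real (m + i))"
    unfolding prod_dividef[symmetric] using assms by (intro prod.cong refl) (auto simp: field_simps of_nat_diff)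
  finally show ?thesis .
qed

text \<open>Valid on the whole range j <= m, the bound serves both as summable majorant and as the
  upper half of the limit. Each factor is estimated with the largest denominator m + j.\<close>

lemma binomial_ratio_upper:
  assumes "j \<le> m" "m > 0"
  shows "real ((2 * m) choose (m + j)) / real ((2 * m) choose m) \<le> exp (- (real j)\<^sup>2 / real (m + j))"
proof -
  have "(\<Prod>i=1..j. 1 - real j / real (m + i)) \<le> (\<Prod>i=1..j. exp (- (real j / real (m + j))))"
  proof (intro prod_mono conjI)
    fix i assume i: "i \<in> {1..j}"
    then have mi: "real (m + i) > 0" using assms by simp
    have "real j \<le> real (m + i)" using assms by simp
    then show "0 \<le> 1 - real j / real (m + i)" using mi by (simp add: field_simps)
    have "1 - real j / real (m + i) \<le> exp (- (real j / real (m + i)))"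
      using exp_ge_add_one_self[of "- (real j / real (m + i))"] by simp
    also have "real j / real (m + j) \<le> real j / real (m + i)"
      using i assms by (intro divide_left_mono) auto
    then have "exp (- (real j / real (m + i))) \<le> exp (- (real j / real (m + j)))" by simp
    finally show "1 - real j / real (m + i) \<le> exp (- (real j / real (m + j)))" .
  qed
  also have "\<dots> = exp (- (real j)\<^sup>2 / real (m + j))"
    by (simp add: exp_of_nat_mult[symmetric] power2_eq_square)
  finally show ?thesis unfolding binomial_ratio[OF assms(1)] .
qed

lemma exp_lower_one_minus:
  assumes "0 \<le> u" "u \<le> (1/2::real)"
  shows "exp (- u - 2 * u\<^sup>2) \<le> 1 - u"
proof -
  have "- u - 2 * u\<^sup>2 \<le> ln (1 - u)"
    using ln_one_minus_pos_lower_bound[OF assms] by simp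
  then have "exp (- u - 2 * u\<^sup>2) \<le> exp (ln (1 - u))" by simp
  then show ?thesis using assms by simp
qed

text \<open>The cubic correction vanishes in the limit, where j is of the order of the square root
  of m.\<close>

lemma binomial_ratio_lower:
  assumes "2 * j \<le> m" "m > 0"
  shows "exp (- (real j)\<^sup>2 / real m - 2 * (real j) ^ 3 / (real m)\<^sup>2) \<le> real ((2 * m) choose (m + j)) / real ((2 * m) choose m)"
proof -
  define u where "u = real j / real m"
  have u: "0 \<le> u" "u \<le> 1/2" using assms by (auto simp: u_def field_simps)
  have "- (real j)\<^sup>2 / real m - 2 * (real j) ^ 3 / (real m)\<^sup>2 = real j * (- u - 2 * u\<^sup>2)"
    by (simp add: u_def power2_eq_square power3_eq_cube algebra_simps)
  then have "exp (- (real j)\<^sup>2 / real m - 2 * (real j) ^ 3 / (real m)\<^sup>2) = exp (- u - 2 * u\<^sup>2) ^ j"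
    by (simp only: exp_of_nat_mult)
  also have "\<dots> \<le> (1 - u) ^ j" using exp_lower_one_minus[OF u] by (intro power_mono) auto
  also have "\<dots> = (\<Prod>i=1..j. 1 - u)" by simp
  also have "\<dots> \<le> (\<Prod>i=1..j. 1 - real j / real (m + i))"
    using u assms by (intro prod_mono) (auto simp: u_def intro!: divide_left_mono)
  finally show ?thesis using binomial_ratio[of j m] assms by simp
qed

lemma tendsto_one_minus_power:
  assumes s0: "\<And>q. 0 \<le> s q" and s: "s \<longlonglongrightarrow> (0::real)" and ms: "(\<lambda>q. real (m q) * s q) \<longlonglongrightarrow> c"
  shows "(\<lambda>q. (1 - s q) ^ m q) \<longlonglongrightarrow> exp (- c)"
proof (rule tendsto_sandwich)
  have ev: "\<forall>\<^sub>F q in sequentially. s q < 1 / 2" using s by (rule order_tendstoD) simp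
  show "\<forall>\<^sub>F q in sequentially. exp (- (real (m q) * s q) - 2 * (real (m q) * s q) * s q) \<le> (1 - s q) ^ m q"
    using ev
  proof eventually_elim
    case (elim q)
    have "exp (- (real (m q) * s q) - 2 * (real (m q) * s q) * s q) = exp (real (m q) * (- s q - 2 * (s q)\<^sup>2))"
      by (simp add: power2_eq_square algebra_simps)
    also have "\<dots> = exp (- s q - 2 * (s q)\<^sup>2) ^ m q" by (rule exp_of_nat_mult)
    also have "\<dots> \<le> (1 - s q) ^ m q" using exp_lower_one_minus[OF s0] elim by (intro power_mono) auto
    finally show ?case .
  qed
  show "\<forall>\<^sub>F q in sequentially. (1 - s q) ^ m q \<le> exp (- (real (m q) * s q))"
    using ev
  proof eventually_elim
    case (elim q)
    have "(1 - s q) ^ m q \<le> exp (- s q) ^ m q"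
      using elim exp_ge_add_one_self[of "- s q"] by (intro power_mono) auto
    then show ?case by (simp add: exp_of_nat_mult[symmetric])
  qed
  have "(\<lambda>q. exp (- (real (m q) * s q) - 2 * (real (m q) * s q) * s q)) \<longlonglongrightarrow> exp (- c - 2 * c * 0)"
    by (intro tendsto_intros s ms)
  then show "(\<lambda>q. exp (- (real (m q) * s q) - 2 * (real (m q) * s q) * s q)) \<longlonglongrightarrow> exp (- c)" by simp
  show "(\<lambda>q. exp (- (real (m q) * s q))) \<longlonglongrightarrow> exp (- c)" by (intro tendsto_intros ms)
qed

text \<open>A crude form of Jordan's inequality, enough to dominate powers of the cosine by a
  Gaussian.\<close>

lemma sin_ge_half:
  assumes "0 \<le> x" "x \<le> pi / 2"
  shows "x / 2 \<le> sin x"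
proof -
  have "\<bar>sin x - (\<Sum>m<3. sin_coeff m * x ^ m)\<bar> \<le> inverse (fact 3) * \<bar>x\<bar> ^ 3"
    by (rule Maclaurin_sin_bound)
  then have "\<bar>sin x - x\<bar> \<le> x ^ 3 / 6"
    using assms by (simp add: eval_nat_numeral sin_coeff_def fact_numeral)
  moreover have "x ^ 3 / 6 \<le> x / 2"
  proof -
    have "x \<le> 17 / 10" using assms pi_approx by simp
    then have "x\<^sup>2 \<le> (17 / 10)\<^sup>2" using assms by (intro power_mono) auto
    also have "\<dots> \<le> 3" by (simp add: power2_eq_square)
    finally have "x * x\<^sup>2 \<le> x * 3" using assms by (intro mult_left_mono) auto
    then show ?thesis by (simp add: power3_eq_cube power2_eq_square)
  qed
  ultimately show ?thesis by linarith
qed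

lemma summable_exp_neg_square:
  assumes "c > 0"
  shows "summable (\<lambda>k. exp (- c * (real (Suc k))\<^sup>2))"
proof (rule summable_comparison_test')
  show "summable (\<lambda>k. exp (- c) ^ k)" using assms by (intro summable_geometric) simp
  show "norm (exp (- c * (real (Suc k))\<^sup>2)) \<le> exp (- c) ^ k" for k
  proof -
    have "real k \<le> (real (Suc k))\<^sup>2" by (simp add: power2_eq_square algebra_simps)
    then have "- c * (real (Suc k))\<^sup>2 \<le> real k * (- c)" using assms by (simp add: mult.commute)
    then show ?thesis by (simp add: exp_of_nat_mult[symmetric])
  qed
qed

theorem theta_inversion:
  assumes t: "t > 0"
  shows "1 + 2 * (\<Sum>k. exp (- (pi\<^sup>2 / t) * (real (Suc k))\<^sup>2)) = sqrt (t / pi) * (1 + 2 * (\<Sum>k. exp (- t * (real (Suc k))\<^sup>2)))"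
proof -
  define l where "l = (\<lambda>q::nat. 2 * q + 1)"
  define m where "m = (\<lambda>q. nat \<lfloor>(real (l q))\<^sup>2 / t\<rfloor>)"
  have m_bounds: "(real (l q))\<^sup>2 / t - 1 \<le> m q" "m q \<le> (real (l q))\<^sup>2 / t" for q
    using t by (auto simp: m_def)
  have lm: "(\<lambda>q. real (m q) / (real (l q))\<^sup>2) \<longlonglongrightarrow> 1 / t"
  proof (rule tendsto_sandwich[OF always_eventually always_eventually])
    show "\<forall>q. 1 / t - 1 / (real (l q))\<^sup>2 \<le> real (m q) / (real (l q))\<^sup>2"
    proof
      fix q
      have "((real (l q))\<^sup>2 / t - 1) / (real (l q))\<^sup>2 \<le> real (m q) / (real (l q))\<^sup>2"
        using m_bounds(1) by (intro divide_right_mono) auto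
      then show "1 / t - 1 / (real (l q))\<^sup>2 \<le> real (m q) / (real (l q))\<^sup>2"
        by (simp add: diff_divide_distrib l_def)
    qed
    show "\<forall>q. real (m q) / (real (l q))\<^sup>2 \<le> 1 / t"
    proof
      fix q
      have "real (m q) / (real (l q))\<^sup>2 \<le> ((real (l q))\<^sup>2 / t) / (real (l q))\<^sup>2"
        using m_bounds(2) by (intro divide_right_mono) auto
      then show "real (m q) / (real (l q))\<^sup>2 \<le> 1 / t" by (simp add: l_def)
    qed
    show "(\<lambda>q. 1 / t - 1 / (real (l q))\<^sup>2) \<longlonglongrightarrow> 1 / t" unfolding l_def by real_asymp
  qed auto
  have linf: "filterlim (\<lambda>q. real (l q)) at_top sequentially" unfolding l_def by real_asymp
  have l0: "(\<lambda>q. 1 / real (l q)) \<longlonglongrightarrow> 0" unfolding l_def by real_asymp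
  have lpos: "real (l q) > 0" for q by (simp add: l_def)
  have lm': "(\<lambda>q. (real (l q))\<^sup>2 / real (m q)) \<longlonglongrightarrow> t"
    using tendsto_divide[OF tendsto_const[of 1] lm] t by simp
  have minf: "filterlim (\<lambda>q. real (m q)) at_top sequentially"
  proof -
    have "filterlim (\<lambda>q. real (m q) / (real (l q))\<^sup>2 * (real (l q))\<^sup>2) at_top sequentially"
      by (rule filterlim_tendsto_pos_mult_at_top[OF lm]) (use t linf in \<open>auto intro!: filterlim_pow_at_top\<close>)
    moreover have "real (m q) / (real (l q))\<^sup>2 * (real (l q))\<^sup>2 = real (m q)" for q by (simp add: l_def)
    ultimately show ?thesis by simp
  qed
  have mpos: "\<forall>\<^sub>F q in sequentially. m q > 0"
    by (rule eventually_mono[OF filterlim_at_top_dense[THEN iffD1, OF minf, rule_format, of 0]]) simp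
  define A where "A = (\<lambda>j q. if j < q then ((cos (pi * Suc j / l q))\<^sup>2) ^ m q else 0)"
  have A_lim: "(\<lambda>q. \<Sum>j. A j q) \<longlonglongrightarrow> (\<Sum>k. exp (- (pi\<^sup>2 / t) * (real (Suc k))\<^sup>2))"
  proof (rule tannerys_theorem[THEN conjunct2, THEN conjunct2])
    \<comment> \<open>The rate comes from sin x >= x/2, which puts \<pi>^2 m j^2 / (4 l^2) into the
      exponent, together with m/l^2 > 1/(2t) for large \<open>q\<close> and \<pi>^2/4 >= 1.\<close>
    show "summable (\<lambda>k. exp (- (1 / (2 * t)) * (real (Suc k))\<^sup>2))"
      using t by (intro summable_exp_neg_square) simp
    have "\<forall>\<^sub>F q in sequentially. real (m q) / (real (l q))\<^sup>2 > 1 / (2 * t)"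
      using lm t by (intro order_tendstoD(1)[OF lm]) (simp add: field_simps)
    then have "\<forall>\<^sub>F q in sequentially. \<forall>j. norm (A j q) \<le> exp (- (1 / (2 * t)) * (real (Suc j))\<^sup>2)"
    proof eventually_elim
      case (elim q)
      show ?case
      proof
        fix j
        show "norm (A j q) \<le> exp (- (1 / (2 * t)) * (real (Suc j))\<^sup>2)"
        proof (cases "j < q")
          case True
          define x where "x = pi * Suc j / l q"
          have "2 * real (Suc j) \<le> real (l q)" using True by (simp add: l_def)
          then have "pi * (2 * real (Suc j)) \<le> pi * real (l q)" by (intro mult_left_mono) auto
          then have x: "0 \<le> x" "x \<le> pi / 2" using lpos[of q] by (auto simp: x_def field_simps)
          have s: "x\<^sup>2 / 4 \<le> (sin x)\<^sup>2"
            using power_mono[OF sin_ge_half[OF x], of 2] x by (simp add: power_divide)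
          have "A j q = (1 - (sin x)\<^sup>2) ^ m q" using True by (simp add: A_def x_def cos_squared_eq)
          also have "\<dots> \<le> exp (- (x\<^sup>2 / 4)) ^ m q"
          proof (rule power_mono)
            show "1 - (sin x)\<^sup>2 \<le> exp (- (x\<^sup>2 / 4))"
              using exp_ge_add_one_self[of "- (x\<^sup>2 / 4)"] s by linarith
          qed (simp add: cos_squared_eq[symmetric])
          also have "\<dots> = exp (- (pi\<^sup>2 / 4 * (real (m q) / (real (l q))\<^sup>2) * (real (Suc j))\<^sup>2))"
            unfolding exp_of_nat_mult[symmetric] x_def by (simp add: power_divide power_mult_distrib mult_ac)
          also have "\<dots> \<le> exp (- (1 / (2 * t) * (real (Suc j))\<^sup>2))"
          proof -
            have "1 \<le> pi\<^sup>2 / 4" using pi_ge_two power_mono[of 2 pi 2] by simp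
            then have "1 * (1 / (2 * t)) \<le> pi\<^sup>2 / 4 * (real (m q) / (real (l q))\<^sup>2)"
              using elim t by (intro mult_mono) auto
            then have "1 / (2 * t) * (real (Suc j))\<^sup>2 \<le> pi\<^sup>2 / 4 * (real (m q) / (real (l q))\<^sup>2) * (real (Suc j))\<^sup>2"
              by (intro mult_right_mono) auto
            then show ?thesis by simp
          qed
          finally have "A j q \<le> exp (- (1 / (2 * t)) * (real (Suc j))\<^sup>2)" by simp
          moreover have "A j q \<ge> 0" by (simp add: A_def)
          ultimately show ?thesis by simp
        qed (simp add: A_def)
      qed
    qed
    then show "\<forall>\<^sub>F (j, q) in at_top \<times>\<^sub>F sequentially. norm (A j q) \<le> exp (- (1 / (2 * t)) * (real (Suc j))\<^sup>2)"
      unfolding eventually_prod_filter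
      by (intro exI[of _ "\<lambda>_. True"] exI[of _ "\<lambda>q. \<forall>j. norm (A j q) \<le> exp (- (1 / (2 * t)) * (real (Suc j))\<^sup>2)"]) auto
    show "(\<lambda>q. A j q) \<longlonglongrightarrow> exp (- (pi\<^sup>2 / t) * (real (Suc j))\<^sup>2)" for j
    proof -
      define x where "x = (\<lambda>q. pi * Suc j / l q)"
      have x0: "x \<longlonglongrightarrow> 0" using tendsto_mult[OF tendsto_const[of "pi * Suc j"] l0] by (simp add: x_def)
      have xpos: "x q > 0" for q using lpos[of q] by (simp add: x_def)
      have sx: "(\<lambda>q. sin (x q) / x q) \<longlonglongrightarrow> 1"
      proof -
        have "((\<lambda>x::real. sin x / x) \<longlongrightarrow> 1) (at 0)" by real_asymp
        moreover have "filterlim x (at 0) sequentially"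
          using x0 xpos by (auto simp: filterlim_at less_imp_neq[symmetric] intro!: always_eventually)
        ultimately show ?thesis by (rule filterlim_compose)
      qed
      have ms: "(\<lambda>q. real (m q) * (sin (x q))\<^sup>2) \<longlonglongrightarrow> 1 / t * (pi * Suc j)\<^sup>2 * 1\<^sup>2"
      proof -
        have "(\<lambda>q. real (m q) / (real (l q))\<^sup>2 * (pi * Suc j)\<^sup>2 * (sin (x q) / x q)\<^sup>2) \<longlonglongrightarrow> 1 / t * (pi * Suc j)\<^sup>2 * 1\<^sup>2"
          by (intro tendsto_intros lm sx)
        moreover have "real (m q) / (real (l q))\<^sup>2 * (pi * Suc j)\<^sup>2 * (sin (x q) / x q)\<^sup>2 = real (m q) * (sin (x q))\<^sup>2" for q
        proof -
          have "(pi * Suc j)\<^sup>2 = (x q)\<^sup>2 * (real (l q))\<^sup>2" using lpos[of q] by (simp add: x_def power_divide)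
          then show ?thesis using lpos[of q] xpos[of q] by (simp add: power_divide)
        qed
        ultimately show ?thesis by simp
      qed
      have "(\<lambda>q. (sin (x q))\<^sup>2) \<longlonglongrightarrow> (sin 0)\<^sup>2" by (intro tendsto_intros x0)
      then have "(\<lambda>q. (1 - (sin (x q))\<^sup>2) ^ m q) \<longlonglongrightarrow> exp (- (1 / t * (pi * Suc j)\<^sup>2 * 1\<^sup>2))"
        using ms by (intro tendsto_one_minus_power) auto
      also have "exp (- (1 / t * (pi * Suc j)\<^sup>2 * 1\<^sup>2)) = exp (- (pi\<^sup>2 / t) * (real (Suc j))\<^sup>2)"
        by (simp add: power_mult_distrib)
      finally show ?thesis
      proof (rule Lim_transform_eventually)
        show "\<forall>\<^sub>F q in sequentially. (1 - (sin (x q))\<^sup>2) ^ m q = A j q"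
          using eventually_gt_at_top[of j] by eventually_elim (simp add: A_def x_def cos_squared_eq)
      qed
    qed
  qed auto
  define B where "B = (\<lambda>k q. real ((2 * m q) choose (m q + l q * Suc k)) / real ((2 * m q) choose (m q)))"
  have B_lim: "(\<lambda>q. \<Sum>k. B k q) \<longlonglongrightarrow> (\<Sum>k. exp (- t * (real (Suc k))\<^sup>2))"
  proof (rule tannerys_theorem[THEN conjunct2, THEN conjunct2])
    \<comment> \<open>One factor 2 is lost in l^2/m > t/2, valid for large \<open>q\<close>, and
      another in replacing m + j by 2m.\<close>
    show "summable (\<lambda>k. exp (- (t / 4) * (real (Suc k))\<^sup>2))"
      using t by (intro summable_exp_neg_square) simp
    have "\<forall>\<^sub>F q in sequentially. (real (l q))\<^sup>2 / real (m q) > t / 2"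
      by (intro order_tendstoD(1)[OF lm']) (use t in simp)
    then have "\<forall>\<^sub>F q in sequentially. \<forall>k. norm (B k q) \<le> exp (- (t / 4) * (real (Suc k))\<^sup>2)"
      using mpos
    proof eventually_elim
      case (elim q)
      show ?case
      proof
        fix k
        define j where "j = l q * Suc k"
        show "norm (B k q) \<le> exp (- (t / 4) * (real (Suc k))\<^sup>2)"
        proof (cases "j \<le> m q")
          case True
          have "B k q \<le> exp (- (real j)\<^sup>2 / real (m q + j))"
            unfolding B_def j_def[symmetric] by (rule binomial_ratio_upper[OF True elim(2)])
          also have "\<dots> \<le> exp (- (t / 4) * (real (Suc k))\<^sup>2)"
          proof -
            have "t / 2 / 2 \<le> (real (l q))\<^sup>2 / real (m q) / 2"
              using elim(1) by (intro divide_right_mono) auto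
            then have "t / 4 \<le> (real (l q))\<^sup>2 / real (m q) / 2" by simp
            then have "t / 4 * (real (Suc k))\<^sup>2 \<le> (real (l q))\<^sup>2 / real (m q) / 2 * (real (Suc k))\<^sup>2"
              by (intro mult_right_mono) auto
            also have "\<dots> = (real j)\<^sup>2 / (2 * real (m q))"
              unfolding j_def of_nat_mult power_mult_distrib by (simp del: of_nat_Suc)
            also have "\<dots> \<le> (real j)\<^sup>2 / real (m q + j)"
              using True elim by (intro divide_left_mono) (auto intro!: mult_pos_pos)
            finally show ?thesis by simp
          qed
          finally show ?thesis by (simp add: B_def)
        next
          case False
          then have "B k q = 0" unfolding B_def j_def by (simp add: binomial_eq_0)
          then show ?thesis by simp
        qed
      qed
    qed
    then show "\<forall>\<^sub>F (j, q) in at_top \<times>\<^sub>F sequentially. norm (B j q) \<le> exp (- (t / 4) * (real (Suc j))\<^sup>2)"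
      unfolding eventually_prod_filter
      by (intro exI[of _ "\<lambda>_. True"] exI[of _ "\<lambda>q. \<forall>j. norm (B j q) \<le> exp (- (t / 4) * (real (Suc j))\<^sup>2)"]) auto
    show "(\<lambda>q. B k q) \<longlonglongrightarrow> exp (- t * (real (Suc k))\<^sup>2)" for k
    proof -
      define j where "j = (\<lambda>q. l q * Suc k)"
      have rj: "real (j q) = real (l q) * real (Suc k)" for q by (simp only: j_def of_nat_mult)
      have Bj: "B k q = real ((2 * m q) choose (m q + j q)) / real ((2 * m q) choose (m q))" for q
        by (simp only: B_def j_def)
      have jm2: "(\<lambda>q. (real (j q))\<^sup>2 / real (m q)) \<longlonglongrightarrow> t * (real (Suc k))\<^sup>2"
      proof -
        have "(\<lambda>q. (real (l q))\<^sup>2 / real (m q) * (real (Suc k))\<^sup>2) \<longlonglongrightarrow> t * (real (Suc k))\<^sup>2"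
          by (intro tendsto_intros lm')
        then show ?thesis by (simp add: rj power_mult_distrib del: of_nat_Suc)
      qed
      have jm: "(\<lambda>q. real (j q) / real (m q)) \<longlonglongrightarrow> 0"
      proof -
        have "(\<lambda>q. (real (j q))\<^sup>2 / real (m q) * (1 / real (l q)) * (1 / real (Suc k))) \<longlonglongrightarrow> t * (real (Suc k))\<^sup>2 * 0 * (1 / real (Suc k))"
          by (intro tendsto_intros jm2 l0)
        moreover have "(real (j q))\<^sup>2 / real (m q) * (1 / real (l q)) * (1 / real (Suc k)) = real (j q) / real (m q)" for q
          using lpos[of q] by (simp add: rj power2_eq_square del: of_nat_Suc)
        ultimately show ?thesis by simp
      qed
      show ?thesis
      proof (rule tendsto_sandwich)
        have "\<forall>\<^sub>F q in sequentially. real (j q) / real (m q) < 1 / 2" by (rule order_tendstoD(2)[OF jm]) simp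
        then have small: "\<forall>\<^sub>F q in sequentially. 2 * j q \<le> m q"
          using mpos
        proof eventually_elim
          case (elim q)
          then have "2 * real (j q) \<le> real (m q)" by (simp add: field_simps)
          then show ?case by linarith
        qed
        show "\<forall>\<^sub>F q in sequentially. exp (- ((real (j q))\<^sup>2 / real (m q)) - 2 * ((real (j q))\<^sup>2 / real (m q)) * (real (j q) / real (m q))) \<le> B k q"
          using small mpos
        proof eventually_elim
          case (elim q)
          have "- ((real (j q))\<^sup>2 / real (m q)) - 2 * ((real (j q))\<^sup>2 / real (m q)) * (real (j q) / real (m q))
              = - (real (j q))\<^sup>2 / real (m q) - 2 * (real (j q)) ^ 3 / (real (m q))\<^sup>2"
            by (simp add: power2_eq_square power3_eq_cube mult_ac)
          then show ?case using binomial_ratio_lower[OF elim] by (simp only: Bj)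
        qed
        show "\<forall>\<^sub>F q in sequentially. B k q \<le> exp (- ((real (j q))\<^sup>2 / real (m q) / (1 + real (j q) / real (m q))))"
          using small mpos
        proof eventually_elim
          case (elim q)
          have e: "1 + real (j q) / real (m q) = real (m q + j q) / real (m q)" using elim by (simp add: field_simps)
          have e2: "(real (j q))\<^sup>2 / real (m q) / (1 + real (j q) / real (m q)) = (real (j q))\<^sup>2 / real (m q + j q)"
            unfolding e using elim by simp
          have "B k q \<le> exp (- (real (j q))\<^sup>2 / real (m q + j q))"
            unfolding Bj by (rule binomial_ratio_upper) (use elim in auto)
          then show ?case unfolding e2 by simp
        qed
        have "(\<lambda>q. exp (- ((real (j q))\<^sup>2 / real (m q)) - 2 * ((real (j q))\<^sup>2 / real (m q)) * (real (j q) / real (m q))))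
           \<longlonglongrightarrow> exp (- (t * (real (Suc k))\<^sup>2) - 2 * (t * (real (Suc k))\<^sup>2) * 0)"
          by (intro tendsto_intros jm jm2)
        then show "(\<lambda>q. exp (- ((real (j q))\<^sup>2 / real (m q)) - 2 * ((real (j q))\<^sup>2 / real (m q)) * (real (j q) / real (m q))))
           \<longlonglongrightarrow> exp (- t * (real (Suc k))\<^sup>2)" by simp
        have "(\<lambda>q. exp (- ((real (j q))\<^sup>2 / real (m q) / (1 + real (j q) / real (m q)))))
           \<longlonglongrightarrow> exp (- (t * (real (Suc k))\<^sup>2 / (1 + 0)))"
          by (intro tendsto_intros jm jm2) simp
        then show "(\<lambda>q. exp (- ((real (j q))\<^sup>2 / real (m q) / (1 + real (j q) / real (m q)))))
           \<longlonglongrightarrow> exp (- t * (real (Suc k))\<^sup>2)" by simp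
      qed
    qed
  qed auto
  define c where "c = (\<lambda>q. real (l q) * (real ((2 * m q) choose m q) / 4 ^ m q))"
  \<comment> \<open>By the Wallis identity c^2 is the product of l^2/m, 1/(2 + 1/m) and 1/W with W
    tending to \<pi>/2. As \<open>c\<close> is nonnegative, the limit of its squares determines its
    own.\<close>
  have c_lim: "c \<longlonglongrightarrow> sqrt (t / pi)"
  proof -
    have "(\<lambda>q. (real (l q))\<^sup>2 / real (m q) * (1 / (2 + 1 / real (m q))) * (1 / (\<Prod>k=1..m q. (4*real k^2) / (4*real k^2 - 1)))) \<longlonglongrightarrow> t * (1 / (2 + 0)) * (1 / (pi / 2))"
    proof (intro tendsto_intros lm')
      show "(\<lambda>q. 1 / real (m q)) \<longlonglongrightarrow> 0" using minf by (intro tendsto_divide_0[OF tendsto_const] filterlim_at_top_imp_at_infinity)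
      have "filterlim m at_top sequentially"
        using minf by (simp add: filterlim_real_sequentially filterlim_nat_sequentially filterlim_sequentially_iff_filterlim_real)
      then show "(\<lambda>q. \<Prod>k=1..m q. (4*real k^2) / (4*real k^2 - 1)) \<longlonglongrightarrow> pi / 2"
        by (rule filterlim_compose[OF wallis])
    qed auto
    then have "(\<lambda>q. (c q)\<^sup>2) \<longlonglongrightarrow> t * (1 / (2 + 0)) * (1 / (pi / 2))"
    proof (rule Lim_transform_eventually)
      show "\<forall>\<^sub>F q in sequentially. (real (l q))\<^sup>2 / real (m q) * (1 / (2 + 1 / real (m q))) * (1 / (\<Prod>k=1..m q. (4*real k^2) / (4*real k^2 - 1))) = (c q)\<^sup>2"
        using mpos
      proof eventually_elim
        case (elim q)
        define b where "b = real ((2 * m q) choose m q) / 4 ^ m q"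
        have "2 + 1 / real (m q) = (2 * real (m q) + 1) / real (m q)" using elim by (simp add: field_simps)
        then have e: "(real (l q))\<^sup>2 / real (m q) * (1 / (2 + 1 / real (m q))) = (real (l q))\<^sup>2 / (2 * real (m q) + 1)"
          using elim by (simp only:) simp
        have "2 * real (m q) + 1 \<noteq> 0" by linarith
        then show ?case unfolding e central_binomial_wallis[symmetric] c_def b_def[symmetric]
          by (simp add: power_mult_distrib)
      qed
    qed
    then have "(\<lambda>q. sqrt ((c q)\<^sup>2)) \<longlonglongrightarrow> sqrt (t / pi)" by (intro tendsto_real_sqrt) simp
    moreover have "c q \<ge> 0" for q by (simp add: c_def)
    ultimately show ?thesis by simp
  qed
  have fin: "1 + 2 * (\<Sum>j. A j q) = c q * (1 + 2 * (\<Sum>k. B k q))" for q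
  proof -
    have "(\<Sum>j. A j q) = (\<Sum>j<q. A j q)" by (rule suminf_finite) (auto simp: A_def)
    also have "\<dots> = (\<Sum>j<q. ((cos (pi * Suc j / l q))\<^sup>2) ^ m q)" by (intro sum.cong) (auto simp: A_def)
    finally have a: "(\<Sum>j. A j q) = (\<Sum>j<q. ((cos (pi * Suc j / l q))\<^sup>2) ^ m q)" .
    have b: "(\<Sum>k. B k q) = (\<Sum>k<m q. B k q)"
    proof (rule suminf_finite)
      fix k assume "k \<notin> {..<m q}"
      then have "m q < 1 * Suc k" by simp
      also have "\<dots> \<le> l q * Suc k" by (intro mult_le_mono1) (simp add: l_def)
      finally show "B k q = 0" by (simp add: B_def binomial_eq_0)
    qed simp
    show ?thesis unfolding a b unfolding B_def c_def by (rule theta_finite_identity) (simp add: l_def)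
  qed
  have "(\<lambda>q. 1 + 2 * (\<Sum>j. A j q)) \<longlonglongrightarrow> 1 + 2 * (\<Sum>k. exp (- (pi\<^sup>2 / t) * (real (Suc k))\<^sup>2))"
    by (intro tendsto_intros A_lim)
  moreover have "(\<lambda>q. 1 + 2 * (\<Sum>j. A j q)) \<longlonglongrightarrow> sqrt (t / pi) * (1 + 2 * (\<Sum>k. exp (- t * (real (Suc k))\<^sup>2)))"
    unfolding fin by (intro tendsto_intros B_lim c_lim)
  ultimately show ?thesis by (rule LIMSEQ_unique)
qed

section \<open>The kernel of the Xi function\<close>

definition vfun :: "nat \<Rightarrow> real \<Rightarrow> real" where
  "vfun n t = pi * (real (Suc n))\<^sup>2 * exp (2 * t)"

text \<open>Because dv/dt = 2v, this family is closed under differentiation up to linear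
  combinations, so the kernel and its derivatives are expressed in it. The moment of order 0 is half
  of the theta function minus 1.\<close>

definition theta_mom :: "nat \<Rightarrow> real \<Rightarrow> real" where
  "theta_mom k t = (\<Sum>n. vfun n t ^ k * exp (- vfun n t))"

text \<open>
  The kernel is \<open>(d\<^sup>2/dt\<^sup>2 - 1/4) (e\<^bsup>t/2\<^esup> \<Sum> e\<^bsup>-v\<^esup>)\<close> with \<open>v = \<pi> n\<^sup>2 e\<^bsup>2t\<^esup>\<close>. The operator annihilates \<open>e\<^bsup>t/2\<^esup>\<close>, so
  that the sum may be replaced by half of the theta function, which makes the kernel even.
\<close>
definition Phi :: "real \<Rightarrow> real" where
  "Phi t = exp (t / 2) * (4 * theta_mom 2 t - 6 * theta_mom 1 t)"

lemma vfun_pos: "vfun n t > 0"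
  by (simp add: vfun_def)

lemma power_exp_neg_le:
  assumes "(v::real) > 0"
  shows "v ^ k * exp (- v) \<le> fact (Suc k) / v"
proof -
  have "v ^ Suc k / fact (Suc k) \<le> exp v"
  proof -
    have "(\<Sum>n\<in>{Suc k}. v ^ n / fact n) \<le> (\<Sum>n. v ^ n / fact n)"
      using assms summable_exp_generic[of v] by (intro sum_le_suminf) (auto simp: divide_inverse mult.commute)
    then show ?thesis by (simp add: exp_def divide_inverse mult.commute)
  qed
  then show ?thesis using assms by (simp add: exp_minus field_simps del: fact_Suc)
qed

text \<open>The majorant is uniform for t >= a, as differentiating the series term by term
  requires.\<close>

lemma vfun_term_le:
  assumes "a \<le> t"
  shows "vfun n t ^ k * exp (- vfun n t) \<le> fact (Suc k) / (pi * exp (2 * a)) * (1 / (real (Suc n))\<^sup>2)"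
proof -
  have "pi * (real (Suc n))\<^sup>2 * exp (2 * a) \<le> vfun n t"
    unfolding vfun_def using assms by (intro mult_left_mono) auto
  then have "fact (Suc k) / vfun n t \<le> fact (Suc k) / (pi * (real (Suc n))\<^sup>2 * exp (2 * a))"
    by (intro divide_left_mono mult_pos_pos) (auto simp: vfun_pos)
  then have "vfun n t ^ k * exp (- vfun n t) \<le> fact (Suc k) / (pi * (real (Suc n))\<^sup>2 * exp (2 * a))"
    using power_exp_neg_le[OF vfun_pos[of n t], of k] by linarith
  then show ?thesis by (simp add: mult_ac del: fact_Suc of_nat_Suc)
qed

lemma summable_inverse_squares: "summable (\<lambda>n. c * (1 / (real (Suc n))\<^sup>2))"
proof (intro summable_mult)
  have "summable (\<lambda>j. inverse (real j ^ 2))" by (rule inverse_power_summable) simp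
  then have "summable (\<lambda>j. inverse (real (Suc j) ^ 2))" by (subst summable_Suc_iff)
  then show "summable (\<lambda>j. 1 / real (Suc j) ^ 2)" by (simp only: inverse_eq_divide)
qed

lemma summable_vfun: "summable (\<lambda>n. vfun n t ^ k * exp (- vfun n t))"
  by (rule summable_comparison_test'[OF summable_inverse_squares[of "fact (Suc k) / (pi * exp (2 * t))"]])
     (use vfun_term_le[of t t] vfun_pos less_imp_le in \<open>auto simp: abs_mult power_abs abs_of_pos\<close>)

lemma theta_mom_sums: "(\<lambda>n. vfun n t ^ k * exp (- vfun n t)) sums theta_mom k t"
  unfolding theta_mom_def by (rule summable_sums[OF summable_vfun])

lemma theta_mom_DERIV:
  "(theta_mom k has_real_derivative (2 * real k * theta_mom k t - 2 * theta_mom (Suc k) t)) (at t)"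
proof -
  define f where "f = (\<lambda>n s. vfun n s ^ k * exp (- vfun n s))"
  define f' where "f' = (\<lambda>n s. 2 * real k * (vfun n s ^ k * exp (- vfun n s)) - 2 * (vfun n s ^ Suc k * exp (- vfun n s)))"
  have der: "(f n has_real_derivative f' n s) (at s within S)" for n s S
  proof -
    have v: "((\<lambda>s. vfun n s) has_real_derivative 2 * vfun n s) (at s within S)"
      unfolding vfun_def by (auto intro!: derivative_eq_intros)
    have "(f n has_real_derivative (real k * vfun n s ^ (k - 1) * (2 * vfun n s)) * exp (- vfun n s) + vfun n s ^ k * (exp (- vfun n s) * (- (2 * vfun n s)))) (at s within S)"
      unfolding f_def by (auto intro!: derivative_eq_intros v)
    also have "(real k * vfun n s ^ (k - 1) * (2 * vfun n s)) * exp (- vfun n s) + vfun n s ^ k * (exp (- vfun n s) * (- (2 * vfun n s))) = f' n s"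
      unfolding f'_def by (cases k) (auto simp: algebra_simps)
    finally show ?thesis .
  qed
  have unif: "uniformly_convergent_on {t-1..t+1} (\<lambda>n s. \<Sum>i<n. f' i s)"
  proof (rule Weierstrass_m_test'[OF _ summable_inverse_squares])
    fix n s assume "s \<in> {t-1..t+1}"
    then have s: "t - 1 \<le> s" by simp
    define c where "c = 1 / (pi * exp (2 * (t - 1))) * (1 / (real (Suc n))\<^sup>2)"
    have c: "c \<ge> 0" by (simp add: c_def)
    have le: "vfun n s ^ k * exp (- vfun n s) \<le> fact (Suc k) * c" for k
      using vfun_term_le[OF s, of n k] by (simp add: c_def)
    have b1: "2 * real k * (vfun n s ^ k * exp (- vfun n s)) \<le> 2 * real k * (fact (Suc k) * c)"
      by (intro mult_left_mono le) simp
    have b2: "2 * (vfun n s ^ Suc k * exp (- vfun n s)) \<le> 2 * (fact (Suc (Suc k)) * c)"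
      by (intro mult_left_mono le) simp
    have p: "0 \<le> 2 * real k * (vfun n s ^ k * exp (- vfun n s))" "0 \<le> 2 * (vfun n s ^ Suc k * exp (- vfun n s))"
      using vfun_pos[of n s] by auto
    have "norm (f' n s) \<le> 2 * real k * (fact (Suc k) * c) + 2 * (fact (Suc (Suc k)) * c)"
      unfolding f'_def real_norm_def using b1 b2 p by linarith
    also have "\<dots> = (2 * real k * fact (Suc k) + 2 * fact (Suc (Suc k))) / (pi * exp (2 * (t - 1))) * (1 / (real (Suc n))\<^sup>2)"
      by (simp add: c_def add_divide_distrib algebra_simps)
    finally show "norm (f' n s) \<le> (2 * real k * fact (Suc k) + 2 * fact (Suc (Suc k))) / (pi * exp (2 * (t - 1))) * (1 / (real (Suc n))\<^sup>2)" .
  qed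
  have "((\<lambda>s. \<Sum>n. f n s) has_real_derivative (\<Sum>n. f' n t)) (at t)"
    by (rule has_field_derivative_series'(2)[of "{t-1..t+1}", OF _ der unif, of t])
       (use summable_vfun in \<open>auto simp: f_def\<close>)
  moreover have "(\<Sum>n. f' n t) = 2 * real k * theta_mom k t - 2 * theta_mom (Suc k) t"
    unfolding f'_def
    by (intro sums_unique[symmetric] sums_diff sums_mult theta_mom_sums)
  ultimately show ?thesis unfolding f_def theta_mom_def by simp
qed

text \<open>The inversion formula at T = \<pi> exp (2t): there \<pi>^2/T = \<pi> exp (-2t) and the
  square root of T/\<pi> is exp t.\<close>

lemma theta_even:
  "exp (- t / 2) * (1 + 2 * theta_mom 0 (- t)) = exp (t / 2) * (1 + 2 * theta_mom 0 t)"
proof -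
  define T where "T = pi * exp (2 * t)"
  have T: "T > 0" by (simp add: T_def)
  have p: "pi\<^sup>2 / T = pi * exp (2 * - t)" by (simp add: T_def power2_eq_square exp_minus field_simps)
  have s: "sqrt (T / pi) = exp t"
  proof -
    have "T / pi = (exp t)\<^sup>2" by (simp add: T_def exp_double)
    then show ?thesis by simp
  qed
  have "theta_mom 0 (- t) = (\<Sum>k. exp (- (pi\<^sup>2 / T) * (real (Suc k))\<^sup>2))"
    unfolding theta_mom_def p by (intro suminf_cong) (simp add: vfun_def mult_ac)
  moreover have "theta_mom 0 t = (\<Sum>k. exp (- T * (real (Suc k))\<^sup>2))"
    unfolding theta_mom_def T_def by (intro suminf_cong) (simp add: vfun_def mult_ac)
  ultimately have "1 + 2 * theta_mom 0 (- t) = exp t * (1 + 2 * theta_mom 0 t)"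
    using theta_inversion[OF T] s by simp
  then show ?thesis by (simp add: exp_add[symmetric] flip: mult.assoc)
qed

lemma Phi_even: "Phi (- t) = Phi t"
proof -
  \<comment> \<open>\<open>G1\<close> and \<open>G2\<close> are the first two derivatives of
    \<open>G\<close>, and evenness passes from \<open>G\<close> to its second derivative. The kernel
    satisfies 2 Phi = G'' - G/4.\<close>
  define G where "G = (\<lambda>t. exp (t / 2) * (1 + 2 * theta_mom 0 t))"
  define G1 where "G1 = (\<lambda>t. exp (t / 2) * (1 / 2 + theta_mom 0 t - 4 * theta_mom 1 t))"
  define G2 where "G2 = (\<lambda>t. exp (t / 2) * (1 / 4 + theta_mom 0 t / 2 - 12 * theta_mom 1 t + 8 * theta_mom 2 t))"
  note d = theta_mom_DERIV[of 0, simplified] theta_mom_DERIV[of 1, simplified]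
  have DG: "(G has_real_derivative G1 t) (at t)" for t
    unfolding G_def G1_def by (rule derivative_eq_intros d refl | simp)+ (simp add: field_simps)
  have DG1: "(G1 has_real_derivative G2 t) (at t)" for t
    unfolding G2_def G1_def by (rule derivative_eq_intros d refl | simp)+ (simp add: field_simps eval_nat_numeral)
  have even: "G (- t) = G t" for t using theta_even by (simp add: G_def)
  have odd: "G1 t = - G1 (- t)" for t
  proof -
    have "((\<lambda>t. G (- t)) has_real_derivative G1 (- t) * - 1) (at t)"
      by (rule DERIV_chain2[OF DG DERIV_minus[OF DERIV_ident]])
    then have "(G has_real_derivative - G1 (- t)) (at t)" by (simp add: even)
    from DERIV_unique[OF DG this] show ?thesis .
  qed
  have "((\<lambda>t. G1 (- t)) has_real_derivative G2 (- t) * - 1) (at t)"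
    by (rule DERIV_chain2[OF DG1 DERIV_minus[OF DERIV_ident]])
  then have "((\<lambda>t. - G1 (- t)) has_real_derivative - (G2 (- t) * - 1)) (at t)" by (rule DERIV_minus)
  then have "(G1 has_real_derivative G2 (- t)) (at t)" by (simp add: odd[symmetric])
  then have "G2 (- t) = G2 t" by (rule DERIV_unique[OF _ DG1])
  moreover have "2 * Phi t = G2 t - G t / 4" for t
    by (simp add: Phi_def G2_def G_def algebra_simps)
  ultimately show ?thesis using even by (metis mult_left_cancel zero_neq_numeral)
qed

text \<open>\<open>Phi1\<close> and \<open>Phi2\<close> are the first two derivatives of
  \<open>Phi\<close>, expanded by the differentiation rule for \<open>theta_mom\<close>.\<close>

definition Phi1 :: "real \<Rightarrow> real" where
  "Phi1 t = exp (t / 2) * (- 8 * theta_mom 3 t + 30 * theta_mom 2 t - 15 * theta_mom 1 t)"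
definition Phi2 :: "real \<Rightarrow> real" where
  "Phi2 t = exp (t / 2) * (16 * theta_mom 4 t - 112 * theta_mom 3 t + 165 * theta_mom 2 t - 75 / 2 * theta_mom 1 t)"

lemma Phi_DERIV: "(Phi has_real_derivative Phi1 t) (at t)"
  unfolding Phi_def [abs_def] Phi1_def
  by (rule derivative_eq_intros theta_mom_DERIV refl | simp)+ (simp add: field_simps eval_nat_numeral)

lemma Phi1_DERIV: "(Phi1 has_real_derivative Phi2 t) (at t)"
  unfolding Phi1_def [abs_def] Phi2_def
  by (rule derivative_eq_intros theta_mom_DERIV refl | simp)+ (simp add: field_simps eval_nat_numeral)

lemma continuous_on_Phi [continuous_intros]: "continuous_on S Phi"
  by (meson DERIV_continuous_on Phi_DERIV has_field_derivative_at_within)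

lemma Phi_sums: "(\<lambda>n. exp (t / 2) * ((4 * vfun n t ^ 2 - 6 * vfun n t) * exp (- vfun n t))) sums Phi t"
proof -
  have "(\<lambda>n. exp (t / 2) * (4 * (vfun n t ^ 2 * exp (- vfun n t)) - 6 * (vfun n t ^ 1 * exp (- vfun n t)))) sums Phi t"
    unfolding Phi_def by (intro sums_mult sums_diff theta_mom_sums)
  then show ?thesis by (simp add: algebra_simps)
qed

lemma vfun_ge_pi: "t \<ge> 0 \<Longrightarrow> vfun n t \<ge> pi"
proof -
  assume "t \<ge> 0"
  then have "1 * 1 \<le> (real (Suc n))\<^sup>2 * exp (2 * t)" by (intro mult_mono) auto
  then have "pi * 1 \<le> pi * ((real (Suc n))\<^sup>2 * exp (2 * t))" by (intro mult_left_mono) auto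
  then show ?thesis by (simp add: vfun_def mult.assoc)
qed

lemma Phi_term_pos:
  assumes "t \<ge> 0"
  shows "0 < (4 * vfun n t ^ 2 - 6 * vfun n t) * exp (- vfun n t)"
proof -
  have v: "vfun n t > 3" using vfun_ge_pi[OF assms, of n] pi_gt3 by linarith
  have "4 * vfun n t ^ 2 - 6 * vfun n t = vfun n t * (4 * vfun n t - 6)" by (simp add: power2_eq_square algebra_simps)
  also have "\<dots> > 0" using v by simp
  finally show ?thesis by simp
qed

lemma Phi_pos_nonneg: "t \<ge> 0 \<Longrightarrow> Phi t > 0"
  using suminf_pos[OF sums_summable[OF Phi_sums]] Phi_term_pos sums_unique[OF Phi_sums, of t] by simp

text \<open>For very negative t some summands are negative, since 4v^2 - 6v < 0 for v < 3/2.
  Positivity on the negative axis therefore comes from evenness.\<close>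

lemma Phi_pos: "Phi t > 0"
  using Phi_pos_nonneg[of t] Phi_pos_nonneg[of "- t"] Phi_even[of t] by (cases "t \<ge> 0") auto

lemma Phi_double_exp_bound: "\<exists>C. \<forall>t\<ge>0. Phi t \<le> C * exp (t / 2 - exp (2 * t))"
proof -
  have sm: "summable (\<lambda>n. exp (- (1::real)) ^ Suc n)" by (subst summable_Suc_iff) (intro summable_geometric, simp)
  define S where "S = (\<Sum>n. exp (- (1::real)) ^ Suc n)"
  have "Phi t \<le> (72 * S) * exp (t / 2 - exp (2 * t))" if t: "t \<ge> 0" for t
  proof -
    define E where "E = exp (2 * t)"
    have E: "E \<ge> 1" using t by (simp add: E_def)
    have le: "exp (t / 2) * ((4 * vfun n t ^ 2 - 6 * vfun n t) * exp (- vfun n t)) \<le> exp (t / 2) * (72 * exp (- E)) * exp (- 1) ^ Suc n" for n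
    proof -
      \<comment> \<open>One third of the exponent absorbs v^2 at the cost of the factor 18, whence
        72 = 4 * 18. As v >= 3 N^2 E with N = n + 1, the other two thirds leave exp (-E -
        N).\<close>
      define v where "v = vfun n t"
      have v: "v > 0" by (simp add: v_def vfun_pos)
      have "(v / 3) ^ 1 * (v / 3) \<le> fact (Suc 1) * exp (v / 3)"
        using power_exp_neg_le[of "v / 3" 1] v by (simp add: exp_minus field_simps)
      then have "v ^ 2 \<le> 18 * exp (v / 3)" by (simp add: power2_eq_square)
      then have "v ^ 2 * exp (- v) \<le> 18 * exp (v / 3) * exp (- v)" by (intro mult_right_mono) auto
      also have "\<dots> = 18 * exp (- (2 * v / 3))" by (simp add: exp_add[symmetric])
      also have "exp (- (2 * v / 3)) \<le> exp (- E - real (Suc n))"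
      proof -
        define N where "N = real (Suc n)"
        have N: "N \<ge> 1" by (simp add: N_def)
        have "1 * E \<le> N\<^sup>2 * E" using N E by (intro mult_right_mono) (auto simp: power2_eq_square intro: mult_ge1_I)
        moreover have "N * 1 \<le> N\<^sup>2 * E" using N E unfolding power2_eq_square mult.assoc by (intro mult_left_mono mult_ge1_I) auto
        moreover have "v \<ge> 3 * (N\<^sup>2 * E)" unfolding v_def vfun_def N_def E_def mult.assoc using pi_gt3 by (intro mult_right_mono) auto
        ultimately have "E + N \<le> 2 * v / 3" by simp
        then show ?thesis by (simp add: N_def)
      qed
      also have "exp (- E - real (Suc n)) = exp (- E) * exp (- 1) ^ Suc n"
      proof -
        have "- E - real (Suc n) = - E + real (Suc n) * (- 1)" by simp
        then show ?thesis by (simp only: exp_add exp_of_nat_mult)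
      qed
      finally have "4 * (v ^ 2 * exp (- v)) \<le> 72 * (exp (- E) * exp (- 1) ^ Suc n)" by linarith
      moreover have "(4 * v ^ 2 - 6 * v) * exp (- v) \<le> 4 * (v ^ 2 * exp (- v))" using v by (simp add: algebra_simps)
      ultimately have "(4 * v ^ 2 - 6 * v) * exp (- v) \<le> 72 * (exp (- E) * exp (- 1) ^ Suc n)" by linarith
      then show ?thesis unfolding v_def[symmetric] mult.assoc by (intro mult_left_mono) auto
    qed
    have "Phi t \<le> exp (t / 2) * (72 * exp (- E)) * S"
      by (rule sums_le[OF le Phi_sums]) (unfold S_def, intro sums_mult summable_sums sm)
    moreover have "exp (t / 2 - exp (2 * t)) = exp (t / 2) * exp (- E)" by (simp add: E_def exp_add[symmetric])
    ultimately show ?thesis by (simp add: mult_ac)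
  qed
  then show ?thesis by blast
qed

text \<open>That \<open>K\<close> is arbitrary makes the kernel integrable against every Gaussian
  exp (c t^2), which later gives the power series growth below exp (\<epsilon> |x|) for every
  \<epsilon> > 0, up to a constant.\<close>

lemma Phi_gauss_bound: "\<exists>C. \<forall>t. Phi t \<le> C * exp (- K * t\<^sup>2)"
proof -
  obtain C where C: "\<And>t. t \<ge> 0 \<Longrightarrow> Phi t \<le> C * exp (t / 2 - exp (2 * t))" using Phi_double_exp_bound by blast
  have "0 < C * exp (0 / 2 - exp (2 * 0))" using C[of 0] Phi_pos[of 0] by linarith
  then have C0: "C > 0" by (simp add: zero_less_mult_iff)
  define k where "k = max K 0"
  \<comment> \<open>\<open>M\<close> bounds t/2 + k t^2 up to t = k + 1. Beyond that point exp (2t)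
    >= t^3 >= (k + 1) t^2 and t^2 >= t/2 take over.\<close>
  define M where "M = (k + 1) / 2 + k * (k + 1)\<^sup>2"
  have k: "k \<ge> 0" "K \<le> k" by (auto simp: k_def)
  have ineq: "t / 2 - exp (2 * t) \<le> M - K * t\<^sup>2" if t: "t \<ge> 0" for t
  proof -
    have "K * t\<^sup>2 \<le> k * t\<^sup>2" using k by (intro mult_right_mono) auto
    moreover have "t / 2 + k * t\<^sup>2 - exp (2 * t) \<le> M"
    proof (cases "t \<le> k + 1")
      case True
      have "k * t\<^sup>2 \<le> k * (k + 1)\<^sup>2" using True t k by (intro mult_left_mono power_mono) auto
      then have "t / 2 + k * t\<^sup>2 \<le> M" unfolding M_def using True by (intro add_mono) auto
      then show ?thesis using exp_ge_zero[of "2 * t"] by linarith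
    next
      case False
      have t1: "t \<ge> 1" using False k by simp
      have "(2 * t) ^ 2 * (2 * t) \<le> fact (Suc 2) * exp (2 * t)"
        using power_exp_neg_le[of "2 * t" 2] t1 by (simp add: exp_minus field_simps)
      moreover have "(2 * t) ^ 2 * (2 * t) = 8 * (t * t\<^sup>2)" by (simp add: power2_eq_square)
      moreover have "fact (Suc 2) = (6::real)" by (simp add: eval_nat_numeral)
      ultimately have "8 * (t * t\<^sup>2) \<le> 6 * exp (2 * t)" by (simp only:)
      then have "t * t\<^sup>2 \<le> exp (2 * t)" using exp_ge_zero[of "2 * t"] by linarith
      moreover have "(k + 1) * t\<^sup>2 \<le> t * t\<^sup>2" using False by (intro mult_right_mono) auto
      moreover have "t / 2 \<le> t\<^sup>2" using t1 by (simp add: power2_eq_square) 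
      moreover have "M \<ge> 0" using k by (simp add: M_def)
      ultimately show ?thesis by (simp add: algebra_simps)
    qed
    ultimately show ?thesis by linarith
  qed
  have *: "Phi t \<le> (C * exp M) * exp (- K * t\<^sup>2)" if t: "t \<ge> 0" for t
  proof -
    have "C * exp (t / 2 - exp (2 * t)) \<le> C * exp (M - K * t\<^sup>2)" using ineq[OF t] C0 by simp
    also have "\<dots> = (C * exp M) * exp (- K * t\<^sup>2)" by (simp add: exp_diff exp_minus divide_inverse)
    finally show ?thesis using C[OF t] by linarith
  qed
  have "Phi t \<le> (C * exp M) * exp (- K * t\<^sup>2)" for t
    using *[of t] *[of "- t"] Phi_even[of t] by (cases "t \<ge> 0") auto
  then show ?thesis by blast
qed

section \<open>Logarithmic concavity of the kernel\<close>

text \<open>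
  The \<open>n\<close>-th summand of \<open>\<Phi>\<close> is \<open>\<phi> = e\<^bsup>t/2\<^esup> (4 w\<^sup>2 - 6 w) e\<^bsup>-w\<^esup>\<close> with \<open>dw/dt = 2 w\<close>. Then \<open>- \<phi>'/\<phi>\<close> is
  \<open>neg_log_slope w\<close>, and \<open>\<phi>'' + 2 L \<phi>' + L\<^sup>2 \<phi>\<close> is \<open>concavity_poly L w e\<^bsup>t/2\<^esup> e\<^bsup>-w\<^esup>\<close>.
\<close>
definition neg_log_slope :: "real \<Rightarrow> real" where "neg_log_slope w = 2 * w - 9 / 2 - 6 / (2 * w - 3)"

definition concavity_poly :: "real \<Rightarrow> real \<Rightarrow> real" where
  "concavity_poly L w = 16 * w ^ 4 - 112 * w ^ 3 + 165 * w ^ 2 - 75 / 2 * w + 2 * L * (- 8 * w ^ 3 + 30 * w ^ 2 - 15 * w) + L\<^sup>2 * (4 * w ^ 2 - 6 * w)"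

lemma concavity_poly_eq:
  "concavity_poly L w = (2 * w) * ((2 * w - 3) * (2 * w - 9 / 2 - L)\<^sup>2 - 12 * (2 * w - 9 / 2 - L) - 12 - 2 * (2 * w - 3) * (2 * w))"
  by (simp add: concavity_poly_def power2_eq_square power3_eq_cube power4_eq_xxxx field_simps)

text \<open>With its own logarithmic slope inserted, the expression is \<phi> (log \<phi>)'' up to
  the positive exponential factors. Of the negative terms only the one coming from (-w)'' = -4w is
  retained.\<close>

lemma concavity_poly_first:
  assumes "v > 3 / 2"
  shows "concavity_poly (neg_log_slope v) v \<le> - 8 * (2 * v - 3) * v\<^sup>2"
proof -
  define u where "u = 2 * v - 3"
  have u: "u > 0" using assms by (simp add: u_def)
  have x: "2 * v - 9 / 2 - neg_log_slope v = 6 / u" by (simp add: neg_log_slope_def u_def)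
  have "u * (6 / u)\<^sup>2 - 12 * (6 / u) - 12 - 2 * u * (2 * v) = - (36 / u) - 12 - 2 * u * (2 * v)"
    using u by (simp add: power2_eq_square field_simps)
  then have "concavity_poly (neg_log_slope v) v = 2 * v * (- (36 / u) - 12 - 2 * u * (2 * v))"
    unfolding concavity_poly_eq x u_def[symmetric] by simp
  also have "\<dots> \<le> 2 * v * (- 2 * u * (2 * v))"
  proof (intro mult_left_mono)
    have "36 / u > 0" using u by simp
    then show "- (36 / u) - 12 - 2 * u * (2 * v) \<le> - 2 * u * (2 * v)" by linarith
  qed (use assms in simp)
  also have "\<dots> = - 8 * (2 * v - 3) * v\<^sup>2" by (simp add: u_def power2_eq_square)
  finally show ?thesis .
qed

text \<open>The square of the slope difference d, where 0 <= d <= 2w, is the only positive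
  contribution. A crude quartic bound is affordable against the factor exp (-w).\<close>

lemma concavity_poly_later:
  assumes "v \<ge> 3" "w \<ge> v"
  shows "concavity_poly (neg_log_slope v) w \<le> 16 * w ^ 4"
proof -
  define u where "u = 2 * w - 3"
  have u: "u > 0" using assms by (simp add: u_def)
  have uv: "2 * v - 3 > 0" using assms by simp
  define d where "d = neg_log_slope w - neg_log_slope v"
  have x: "2 * w - 9 / 2 - neg_log_slope v = d + 6 / u" by (simp add: d_def neg_log_slope_def u_def)
  have d: "0 \<le> d" "d \<le> 2 * w"
  proof -
    have "6 / (2 * w - 3) \<le> 6 / (2 * v - 3)" using assms by (intro divide_left_mono) auto
    then show "0 \<le> d" using assms by (simp add: d_def neg_log_slope_def)
    have "6 / (2 * v - 3) \<le> 6" using assms by (simp add: field_simps)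
    moreover have "6 / (2 * w - 3) \<ge> 0" using u by (simp add: u_def)
    ultimately show "d \<le> 2 * w" using assms unfolding d_def neg_log_slope_def by linarith
  qed
  have "u * (d + 6 / u)\<^sup>2 - 12 * (d + 6 / u) - 12 - 2 * u * (2 * w) = u * d\<^sup>2 - 36 / u - 12 - 2 * u * (2 * w)"
    using u by (simp add: power2_eq_square field_simps)
  then have "concavity_poly (neg_log_slope v) w = 2 * w * (u * d\<^sup>2 - 36 / u - 12 - 2 * u * (2 * w))"
    unfolding concavity_poly_eq x u_def[symmetric] by simp
  also have "\<dots> \<le> 2 * w * (u * d\<^sup>2)"
  proof (intro mult_left_mono)
    have "36 / u \<ge> 0" "2 * u * (2 * w) \<ge> 0" using u assms by auto
    then show "u * d\<^sup>2 - 36 / u - 12 - 2 * u * (2 * w) \<le> u * d\<^sup>2" by linarith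
  qed (use assms in auto)
  also have "\<dots> \<le> 2 * w * ((2 * w) * (2 * w)\<^sup>2)"
    using d u assms by (intro mult_left_mono mult_mono power_mono) (auto simp: u_def)
  also have "\<dots> = 16 * w ^ 4" by (simp add: power2_eq_square power4_eq_xxxx)
  finally show ?thesis .
qed

text \<open>The numbers (n+2)^2 are the quotients w/v for the second and later summands of the
  kernel, and the right-hand side is the negative margin left by the first one.\<close>

lemma later_terms_small:
  assumes "v \<ge> 3"
  shows "summable (\<lambda>n. 16 * ((real (n + 2))\<^sup>2 * v) ^ 4 * exp (- ((real (n + 2))\<^sup>2 * v)))"
    "(\<Sum>n. 16 * ((real (n + 2))\<^sup>2 * v) ^ 4 * exp (- ((real (n + 2))\<^sup>2 * v))) \<le> 8 * (2 * v - 3) * v\<^sup>2 * exp (- v)"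
proof -
  \<comment> \<open>The ratio of a geometric majorant: 26 exceeds (3/2)^8, which bounds the growth
    of (n+2)^8 from one n to the next, and 5v comes from (n+2)^2 >= 4 + 5n.\<close>
  define r where "r = 26 * exp (- (5 * v))"
  have e5: "(5/2::real) \<le> exp 1" using exp_lower_Taylor_quadratic[of 1] by simp
  have r: "r \<le> 1 / 10" "r > 0"
  proof -
    have "(5/2::real) ^ 15 \<le> exp 1 ^ 15" using e5 by (intro power_mono) auto
    also have "exp (1::real) ^ 15 = exp 15" by (simp add: exp_of_nat_mult[symmetric])
    also have "\<dots> \<le> exp (5 * v)" using assms by simp
    finally have "260 \<le> exp (5 * v)" by (simp add: eval_nat_numeral)
    then show "r \<le> 1 / 10" by (simp add: r_def exp_minus field_simps)
  qed (simp add: r_def)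
  have n8: "real (n + 2) ^ 8 \<le> 256 * 26 ^ n" for n
  proof (induction n)
    case (Suc n)
    have p: "(3 / 2 * x) ^ 8 = 6561 / 256 * x ^ 8" for x :: real by (simp add: power_mult_distrib power_divide)
    have "real (Suc n + 2) \<le> 3 / 2 * real (n + 2)" by simp
    then have "real (Suc n + 2) ^ 8 \<le> (3 / 2 * real (n + 2)) ^ 8" by (intro power_mono) auto
    also have "\<dots> = 6561 / 256 * real (n + 2) ^ 8" by (rule p)
    also have "\<dots> \<le> 26 * real (n + 2) ^ 8" by (intro mult_right_mono) auto
    also have "\<dots> \<le> 26 * (256 * 26 ^ n)" using Suc by (intro mult_left_mono) auto
    finally show ?case by simp
  qed simp
  define c where "c = 16 * 256 * v ^ 4 * exp (- (4 * v))"
  have tm: "16 * ((real (n + 2))\<^sup>2 * v) ^ 4 * exp (- ((real (n + 2))\<^sup>2 * v)) \<le> c * r ^ n" for n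
  proof -
    have "real n \<le> (real n)\<^sup>2" by (cases n) (auto simp: power2_eq_square)
    then have "4 + 5 * real n \<le> (real (n + 2))\<^sup>2" by (simp add: power2_eq_square algebra_simps)
    then have "(4 + 5 * real n) * v \<le> (real (n + 2))\<^sup>2 * v" using assms by (intro mult_right_mono) auto
    then have "exp (- ((real (n + 2))\<^sup>2 * v)) \<le> exp (- (4 * v) + real n * (- (5 * v)))" by (simp add: algebra_simps)
    also have "\<dots> = exp (- (4 * v)) * exp (- (5 * v)) ^ n" by (simp only: exp_add exp_of_nat_mult)
    finally have e: "exp (- ((real (n + 2))\<^sup>2 * v)) \<le> exp (- (4 * v)) * exp (- (5 * v)) ^ n" .
    have "16 * ((real (n + 2))\<^sup>2 * v) ^ 4 = 16 * v ^ 4 * real (n + 2) ^ 8"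
      by (simp add: power_mult_distrib power_mult[symmetric])
    also have "\<dots> \<le> 16 * v ^ 4 * (256 * 26 ^ n)" using n8 by (intro mult_left_mono) auto
    finally have f: "16 * ((real (n + 2))\<^sup>2 * v) ^ 4 \<le> 16 * v ^ 4 * (256 * 26 ^ n)" .
    have "16 * ((real (n + 2))\<^sup>2 * v) ^ 4 * exp (- ((real (n + 2))\<^sup>2 * v)) \<le> 16 * v ^ 4 * (256 * 26 ^ n) * (exp (- (4 * v)) * exp (- (5 * v)) ^ n)"
      by (rule mult_mono[OF f e]) auto
    then show ?thesis by (simp add: c_def r_def power_mult_distrib mult_ac)
  qed
  have geo: "(\<lambda>n. c * r ^ n) sums (c * (1 / (1 - r)))"
    using r by (intro sums_mult geometric_sums) auto
  show sm: "summable (\<lambda>n. 16 * ((real (n + 2))\<^sup>2 * v) ^ 4 * exp (- ((real (n + 2))\<^sup>2 * v)))"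
    by (rule summable_comparison_test'[OF sums_summable[OF geo]])
       (use tm assms in \<open>auto simp: abs_mult power_abs\<close>)
  have "(\<Sum>n. 16 * ((real (n + 2))\<^sup>2 * v) ^ 4 * exp (- ((real (n + 2))\<^sup>2 * v))) \<le> c * (1 / (1 - r))"
    by (rule sums_le[OF tm summable_sums[OF sm] geo])
  also have "\<dots> \<le> c * (10 / 9)" using r by (intro mult_left_mono) (auto simp: c_def field_simps)
  also have "\<dots> \<le> 8 * (2 * v - 3) * v\<^sup>2 * exp (- v)"
  proof -
    \<comment> \<open>This leads to v^2 exp (-v) <= (17/20)^2. With exp (-2v) <= 1/200 it brings the
      factor 4096 * 10/9 below 8 (2v - 3), which is at least 24.\<close>
    have "v \<le> 17 / 20 * (1 + v / 2 + (v / 2)\<^sup>2 / 2)"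
    proof -
      have "17 / 20 * (1 + v / 2 + (v / 2)\<^sup>2 / 2) - v = 17 / 160 * (v - 46 / 17)\<^sup>2 + (17 / 20 - 17 / 160 * (46 / 17)\<^sup>2)"
        by (simp add: power2_eq_square algebra_simps)
      also have "\<dots> \<ge> 0" by (simp add: power2_eq_square)
      finally show ?thesis by simp
    qed
    also have "\<dots> \<le> 17 / 20 * exp (v / 2)" using exp_lower_Taylor_quadratic[of "v / 2"] assms by simp
    finally have "v\<^sup>2 \<le> (17 / 20 * exp (v / 2))\<^sup>2" using assms by (intro power_mono) auto
    also have "\<dots> = 289 / 400 * exp v"
      using exp_double[of "v / 2"] by (simp add: power_mult_distrib power_divide)
    finally have v2: "v\<^sup>2 * exp (- v) \<le> 289 / 400" by (simp add: exp_minus field_simps)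
    have "(5/2::real) ^ 6 \<le> exp 1 ^ 6" using e5 by (intro power_mono) auto
    also have "exp (1::real) ^ 6 = exp 6" by (simp add: exp_of_nat_mult[symmetric])
    also have "\<dots> \<le> exp (2 * v)" using assms by simp
    finally have "exp (- (2 * v)) \<le> 1 / 200" by (simp add: exp_minus field_simps eval_nat_numeral)
    then have "v\<^sup>2 * exp (- v) * exp (- (2 * v)) \<le> 289 / 400 * (1 / 200)" using v2 by (intro mult_mono) auto
    then have "16 * 256 * (10 / 9) * (v\<^sup>2 * exp (- v) * exp (- (2 * v))) \<le> 8 * (2 * v - 3)"
      using assms by simp
    then have "16 * 256 * (10 / 9) * (v\<^sup>2 * exp (- v) * exp (- (2 * v))) * (v\<^sup>2 * exp (- v)) \<le> 8 * (2 * v - 3) * (v\<^sup>2 * exp (- v))"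
      by (intro mult_right_mono) auto
    moreover have "c * (10 / 9) = 16 * 256 * (10 / 9) * (v\<^sup>2 * exp (- v) * exp (- (2 * v))) * (v\<^sup>2 * exp (- v))"
    proof -
      have "exp (- (4 * v)) = exp (- v) * exp (- (2 * v)) * exp (- v)" by (simp add: exp_add[symmetric])
      then show ?thesis by (simp add: c_def power2_eq_square power4_eq_xxxx)
    qed
    ultimately have "c * (10 / 9) \<le> 8 * (2 * v - 3) * (v\<^sup>2 * exp (- v))" by (simp only:)
    then show ?thesis by (simp only: mult.assoc)
  qed
  finally show "(\<Sum>n. 16 * ((real (n + 2))\<^sup>2 * v) ^ 4 * exp (- ((real (n + 2))\<^sup>2 * v))) \<le> 8 * (2 * v - 3) * v\<^sup>2 * exp (- v)" .
qed

text \<open>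
  With \<open>L\<close> the negative logarithmic derivative of the first summand of \<open>\<Phi>\<close>, one has
  \<open>\<Phi>'\<^sup>2 - \<Phi> \<Phi>'' = (\<Phi>' + L \<Phi>)\<^sup>2 - \<Phi> (\<Phi>'' + 2 L \<Phi>' + L\<^sup>2 \<Phi>)\<close>, and the last factor is negative: the first
  summand dominates it.
\<close>
lemma Phi_log_concave_ineq:
  assumes t: "t \<ge> 0"
  shows "Phi t * Phi2 t \<le> (Phi1 t)\<^sup>2"
proof -
  define v where "v = vfun 0 t"
  have v: "v \<ge> 3" using vfun_ge_pi[OF t, of 0] pi_gt3 by (simp add: v_def)
  define L where "L = neg_log_slope v"
  have vn: "vfun n t = (real (Suc n))\<^sup>2 * v" for n by (simp add: v_def vfun_def mult_ac)
  define T where "T = (\<lambda>n. concavity_poly L (vfun n t) * exp (- vfun n t))"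
  have T_sums: "T sums (16 * theta_mom 4 t - 112 * theta_mom 3 t + 165 * theta_mom 2 t - 75 / 2 * theta_mom 1 t
      + 2 * L * (- 8 * theta_mom 3 t + 30 * theta_mom 2 t - 15 * theta_mom 1 t) + L\<^sup>2 * (4 * theta_mom 2 t - 6 * theta_mom 1 t))" (is "_ sums ?Q")
  proof -
    let ?e = "\<lambda>k n. vfun n t ^ k * exp (- vfun n t)"
    have "(\<lambda>n. 16 * ?e 4 n - 112 * ?e 3 n + 165 * ?e 2 n - 75 / 2 * ?e 1 n
      + 2 * L * (- 8 * ?e 3 n + 30 * ?e 2 n - 15 * ?e 1 n) + L\<^sup>2 * (4 * ?e 2 n - 6 * ?e 1 n)) sums ?Q"
      by (intro sums_add sums_diff sums_mult theta_mom_sums)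
    moreover have "(\<lambda>n. 16 * ?e 4 n - 112 * ?e 3 n + 165 * ?e 2 n - 75 / 2 * ?e 1 n
      + 2 * L * (- 8 * ?e 3 n + 30 * ?e 2 n - 15 * ?e 1 n) + L\<^sup>2 * (4 * ?e 2 n - 6 * ?e 1 n)) = T"
      by (simp add: T_def concavity_poly_def algebra_simps)
    ultimately show ?thesis by simp
  qed
  have "?Q \<le> 0"
  proof -
    have T0: "T 0 \<le> - 8 * (2 * v - 3) * v\<^sup>2 * exp (- v)"
      unfolding T_def v_def[symmetric] L_def using concavity_poly_first[of v] v by (intro mult_right_mono) auto
    have "(\<lambda>n. T (Suc n)) sums (?Q - T 0)" using T_sums by (subst sums_Suc_iff) simp
    moreover have "T (Suc n) \<le> 16 * ((real (n + 2))\<^sup>2 * v) ^ 4 * exp (- ((real (n + 2))\<^sup>2 * v))" for n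
    proof -
      have e: "vfun (Suc n) t = (real (n + 2))\<^sup>2 * v" unfolding vn by simp
      have "1 * v \<le> (real (n + 2))\<^sup>2 * v" using v by (intro mult_right_mono) auto
      then show ?thesis unfolding T_def e L_def using concavity_poly_later[OF v] by (intro mult_right_mono) auto
    qed
    ultimately have "?Q - T 0 \<le> 8 * (2 * v - 3) * v\<^sup>2 * exp (- v)"
      using sums_le[OF _ _ summable_sums[OF later_terms_small(1)[OF v]]] later_terms_small(2)[OF v] by (meson order_trans)
    then show ?thesis using T0 by linarith
  qed
  moreover have "Phi2 t + 2 * L * Phi1 t + L\<^sup>2 * Phi t = exp (t / 2) * ?Q"
    by (simp add: Phi_def Phi1_def Phi2_def algebra_simps)
  ultimately have "Phi2 t + 2 * L * Phi1 t + L\<^sup>2 * Phi t \<le> 0" by (simp add: mult_le_0_iff)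
  then have "Phi t * (Phi2 t + 2 * L * Phi1 t + L\<^sup>2 * Phi t) \<le> 0" using Phi_pos[of t] by (simp add: mult_le_0_iff)
  moreover have "(Phi1 t)\<^sup>2 - Phi t * Phi2 t = (Phi1 t + L * Phi t)\<^sup>2 - Phi t * (Phi2 t + 2 * L * Phi1 t + L\<^sup>2 * Phi t)"
    by (simp add: power2_eq_square algebra_simps)
  moreover have "(Phi1 t + L * Phi t)\<^sup>2 \<ge> 0" by simp
  ultimately show ?thesis by linarith
qed

lemma Phi_log_concave: "convex_on {0..} (\<lambda>t. - ln (Phi t))"
proof (rule f''_ge0_imp_convex[where f' = "\<lambda>t. - (Phi1 t / Phi t)" and f'' = "\<lambda>t. ((Phi1 t)\<^sup>2 - Phi t * Phi2 t) / (Phi t)\<^sup>2"])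
  fix t :: real assume t: "t \<in> {0..}"
  show "((\<lambda>t. - ln (Phi t)) has_real_derivative - (Phi1 t / Phi t)) (at t)"
    by (rule derivative_eq_intros Phi_DERIV refl | simp add: Phi_pos)+
  show "((\<lambda>t. - (Phi1 t / Phi t)) has_real_derivative ((Phi1 t)\<^sup>2 - Phi t * Phi2 t) / (Phi t)\<^sup>2) (at t)"
    using Phi_pos[of t] by (auto intro!: derivative_eq_intros Phi_DERIV Phi1_DERIV simp: power2_eq_square field_simps)
  show "((Phi1 t)\<^sup>2 - Phi t * Phi2 t) / (Phi t)\<^sup>2 \<ge> 0"
    using Phi_log_concave_ineq[of t] t by simp
qed auto

section \<open>Moments of the kernel\<close>

lemma integrable_exp_square: "integrable lborel (\<lambda>x::real. exp (- x\<^sup>2 / 2))"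
proof -
  have "integrable lborel (\<lambda>x. sqrt (2 * pi) * normal_density 0 1 x)" by simp
  moreover have "(\<lambda>x. sqrt (2 * pi) * normal_density 0 1 x) = (\<lambda>x. exp (- x\<^sup>2 / 2))"
    by (rule ext) (simp add: normal_density_def)
  ultimately show ?thesis by simp
qed

lemma borel_measurable_Phi [measurable]: "Phi \<in> borel_measurable borel"
  by (intro borel_measurable_continuous_onI continuous_on_Phi)

lemma integrable_Phi_mult:
  fixes g :: "real \<Rightarrow> 'a :: {real_normed_algebra_1, banach, second_countable_topology}"
  assumes "continuous_on UNIV g" "\<And>t. norm (g t) \<le> D * exp (K * t\<^sup>2)"
  shows "integrable lborel (\<lambda>t. of_real (Phi t) * g t)"
proof -
  obtain C where C: "\<And>t. Phi t \<le> C * exp (- (K + 1) * t\<^sup>2)" using Phi_gauss_bound by blast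
  have C0: "C \<ge> 0" using C[of 0] Phi_pos[of 0] by simp
  have D0: "D \<ge> 0" using order_trans[OF norm_ge_zero assms(2)[of 0]] by simp
  have gm [measurable]: "g \<in> borel_measurable borel" by (rule borel_measurable_continuous_onI[OF assms(1)])
  show ?thesis
  proof (rule Bochner_Integration.integrable_bound)
    show "integrable lborel (\<lambda>t::real. (C * D) * exp (- t\<^sup>2 / 2))" using integrable_exp_square by simp
    show "AE t in lborel. norm (of_real (Phi t) * g t) \<le> norm ((C * D) * exp (- t\<^sup>2 / 2))"
    proof (rule AE_I2)
      fix t :: real
      have "norm (of_real (Phi t) * g t) \<le> Phi t * norm (g t)"
        using norm_mult_ineq[of "of_real (Phi t)" "g t"] Phi_pos[of t] by simp
      also have "\<dots> \<le> (C * exp (- (K + 1) * t\<^sup>2)) * (D * exp (K * t\<^sup>2))"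
        using C assms(2) Phi_pos[of t] C0 by (intro mult_mono) (auto intro: less_imp_le)
      also have "\<dots> = (C * D) * (exp (- (K + 1) * t\<^sup>2) * exp (K * t\<^sup>2))" by simp
      also have "exp (- (K + 1) * t\<^sup>2) * exp (K * t\<^sup>2) = exp (- t\<^sup>2)"
        by (simp add: exp_add[symmetric] algebra_simps)
      also have "(C * D) * exp (- t\<^sup>2) \<le> (C * D) * exp (- t\<^sup>2 / 2)"
        using C0 D0 by (intro mult_left_mono) auto
      finally show "norm (of_real (Phi t) * g t) \<le> norm ((C * D) * exp (- t\<^sup>2 / 2))"
        using C0 D0 by simp
    qed
  qed measurable
qed

lemma power_le_exp_square: "norm ((t::real) ^ k) \<le> fact k * exp 1 * exp (1 * t\<^sup>2)"
proof -
  have "\<bar>t\<bar> \<le> 1 + t\<^sup>2"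
  proof -
    have "0 \<le> (\<bar>t\<bar> - 1)\<^sup>2" by simp
    then show ?thesis by (simp add: power2_diff)
  qed
  then have "exp \<bar>t\<bar> \<le> exp 1 * exp (1 * t\<^sup>2)" by (simp add: exp_add[symmetric])
  moreover have "\<bar>t\<bar> ^ k / fact k \<le> exp \<bar>t\<bar>"
  proof -
    have "(\<Sum>n\<in>{k}. \<bar>t\<bar> ^ n / fact n) \<le> (\<Sum>n. \<bar>t\<bar> ^ n / fact n)"
      using summable_exp_generic[of "\<bar>t\<bar>"] by (intro sum_le_suminf) (auto simp: divide_inverse mult.commute)
    then show ?thesis by (simp add: exp_def divide_inverse mult.commute)
  qed
  ultimately have "\<bar>t\<bar> ^ k / fact k \<le> exp 1 * exp (1 * t\<^sup>2)" by linarith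
  then have "\<bar>t\<bar> ^ k \<le> exp 1 * exp (1 * t\<^sup>2) * fact k" by (simp add: divide_le_eq)
  then show ?thesis by (simp add: power_abs mult_ac)
qed

lemma integrable_Phi_power: "integrable lborel (\<lambda>t. Phi t * t ^ k)"
proof -
  have "continuous_on UNIV (\<lambda>t::real. t ^ k)" by (intro continuous_intros)
  from integrable_Phi_mult[OF this power_le_exp_square] show ?thesis by simp
qed

definition Phi_moment :: "nat \<Rightarrow> real" where
  "Phi_moment k = (LINT t|lborel. Phi t * t ^ k)"

definition xi_coeff :: "nat \<Rightarrow> real" where
  "xi_coeff n = Phi_moment (2 * n) / fact (2 * n)"

lemma Phi_moment_odd: "odd k \<Longrightarrow> Phi_moment k = 0"
proof -
  assume k: "odd k"
  have "Phi_moment k = (LINT t|lborel. Phi (0 + (-1) * t) * (0 + (-1) * t) ^ k)"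
    unfolding Phi_moment_def by (subst lborel_integral_real_affine[of "-1" _ 0]) auto
  also have "\<dots> = - Phi_moment k" using k by (simp add: Phi_even Phi_moment_def)
  finally show ?thesis by simp
qed

lemma mult_abs_le_squares: "c * \<bar>t::real\<bar> \<le> c\<^sup>2 + t\<^sup>2"
proof -
  have "0 \<le> (c - \<bar>t\<bar>)\<^sup>2" "c * \<bar>t\<bar> * 2 \<le> c\<^sup>2 + t\<^sup>2"
    using sum_squares_bound[of c "\<bar>t\<bar>"] by (simp_all add: mult_ac)
  moreover have "0 \<le> c\<^sup>2 + t\<^sup>2" by simp
  ultimately show ?thesis by linarith
qed

text \<open>The exponential series is integrated term by term under the majorant Phi(t) exp (|w|
  |t|), and the odd moments vanish.\<close>

lemma Phi_transform_sums:
  "(\<lambda>n. of_real (xi_coeff n) * w ^ (2 * n)) sums (LINT t|lborel. of_real (Phi t) * exp (w * of_real t) :: complex)"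
proof -
  define s where "s = (\<lambda>N t. of_real (Phi t) * (\<Sum>k<N. (w * of_real t) ^ k / fact k))"
  define c where "c = (\<lambda>k. w ^ k / fact k * of_real (Phi_moment k))"
  have "(\<lambda>N. LINT t|lborel. s N t) \<longlonglongrightarrow> (LINT t|lborel. of_real (Phi t) * exp (w * of_real t))"
  proof (rule integral_dominated_convergence)
    have "integrable lborel (\<lambda>t. of_real (Phi t) * exp (norm w * \<bar>t\<bar>))"
    proof (rule integrable_Phi_mult)
      show "norm (exp (norm w * \<bar>t\<bar>)) \<le> exp ((norm w)\<^sup>2) * exp (1 * t\<^sup>2)" for t :: real
        using mult_abs_le_squares[of "norm w" t] by (simp add: exp_add[symmetric])
    qed (intro continuous_intros)
    then show "integrable lborel (\<lambda>t. Phi t * exp (norm w * \<bar>t\<bar>))" by simp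
    show "AE t in lborel. (\<lambda>N. s N t) \<longlonglongrightarrow> of_real (Phi t) * exp (w * of_real t)"
    proof (rule AE_I2)
      fix t :: real
      have "(\<lambda>k. (w * of_real t) ^ k / fact k) sums exp (w * of_real t)"
        using exp_converges[of "w * of_real t"] by (simp add: scaleR_conv_of_real divide_inverse mult.commute)
      then show "(\<lambda>N. s N t) \<longlonglongrightarrow> of_real (Phi t) * exp (w * of_real t)"
        unfolding s_def sums_def by (intro tendsto_intros)
    qed
    show "AE t in lborel. norm (s N t) \<le> Phi t * exp (norm w * \<bar>t\<bar>)" for N
    proof (rule AE_I2)
      fix t :: real
      have "norm (\<Sum>k<N. (w * of_real t) ^ k / fact k) \<le> (\<Sum>k<N. (norm w * \<bar>t\<bar>) ^ k / fact k)"
        by (rule order_trans[OF norm_sum]) (simp add: norm_divide norm_power norm_mult)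
      also have "\<dots> \<le> (\<Sum>k. (norm w * \<bar>t\<bar>) ^ k / fact k)"
        using summable_exp_generic[of "norm w * \<bar>t\<bar>"] by (intro sum_le_suminf) (auto simp: divide_inverse mult.commute)
      also have "\<dots> = exp (norm w * \<bar>t\<bar>)" by (simp add: exp_def divide_inverse mult.commute)
      finally show "norm (s N t) \<le> Phi t * exp (norm w * \<bar>t\<bar>)"
        unfolding s_def norm_mult using Phi_pos[of t] by (simp add: mult_left_mono)
    qed
    have [measurable]: "(\<lambda>t. exp (w * complex_of_real t)) \<in> borel_measurable borel"
      by (intro borel_measurable_continuous_onI continuous_intros)
    show "(\<lambda>t. of_real (Phi t) * exp (w * of_real t)) \<in> borel_measurable lborel" by measurable
    show "s N \<in> borel_measurable lborel" for N unfolding s_def by measurable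
  qed
  moreover have "(LINT t|lborel. s N t) = (\<Sum>k<N. c k)" for N
  proof -
    have "(LINT t|lborel. s N t) = (LINT t|lborel. (\<Sum>k<N. (w ^ k / fact k) * complex_of_real (Phi t * t ^ k)))"
      unfolding s_def sum_distrib_left
      by (intro Bochner_Integration.integral_cong sum.cong refl) (simp add: power_mult_distrib mult_ac)
    also have "\<dots> = (\<Sum>k<N. (LINT t|lborel. (w ^ k / fact k) * complex_of_real (Phi t * t ^ k)))"
      by (intro Bochner_Integration.integral_sum integrable_mult_right integrable_of_real integrable_Phi_power)
    also have "\<dots> = (\<Sum>k<N. c k)"
      unfolding c_def by (intro sum.cong refl) (subst integral_mult_right_zero, simp only: integral_complex_of_real Phi_moment_def)
    finally show ?thesis .
  qed
  ultimately have sums: "c sums (LINT t|lborel. of_real (Phi t) * exp (w * of_real t))"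
    by (simp add: sums_def)
  have "(\<lambda>n. c (2 * n)) sums (LINT t|lborel. of_real (Phi t) * exp (w * of_real t))"
  proof (subst sums_mono_reindex)
    show "c n = 0" if "n \<notin> range ((*) 2)" for n
    proof -
      have "odd n" using that by (auto elim!: evenE)
      then show ?thesis by (simp add: c_def Phi_moment_odd)
    qed
  qed (auto intro: strict_monoI sums)
  moreover have "c (2 * n) = of_real (xi_coeff n) * w ^ (2 * n)" for n by (simp add: c_def xi_coeff_def)
  ultimately show ?thesis by simp
qed

text \<open>On [1,2] the kernel has a positive minimum and t^(2n) >= 1. The decay is thus no faster
  than that of 1/(2n)!, which y^(n(n+1)/2) outgrows for y > 1.\<close>

lemma xi_coeff_lower: "\<exists>c>0. \<forall>n. c / fact (2 * n) \<le> xi_coeff n"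
proof -
  have "compact {1..2::real}" "{1..2::real} \<noteq> {}" by auto
  then obtain x where x: "x \<in> {1..2}" "\<And>t. t \<in> {1..2} \<Longrightarrow> Phi x \<le> Phi t"
    using continuous_attains_inf[of "{1..2}" Phi] continuous_on_Phi by blast
  have "Phi x \<le> Phi_moment (2 * n)" for n
  proof -
    have "Phi x = (LINT t|lborel. Phi x * indicator {1..2::real} t)" by simp
    also have "\<dots> \<le> Phi_moment (2 * n)"
      unfolding Phi_moment_def
    proof (rule integral_mono)
      show "integrable lborel (\<lambda>t. Phi x * indicator {1..2::real} t)" by simp
      show "integrable lborel (\<lambda>t. Phi t * t ^ (2 * n))" by (rule integrable_Phi_power)
      fix t :: real
      show "Phi x * indicator {1..2} t \<le> Phi t * t ^ (2 * n)"
      proof (cases "t \<in> {1..2}")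
        case True
        then have "Phi x * 1 \<le> Phi t * t ^ (2 * n)"
          using x(2)[OF True] Phi_pos[of t] by (intro mult_mono one_le_power) auto
        then show ?thesis using True by simp
      next
        case False
        then show ?thesis using Phi_pos[of t] by (simp add: zero_le_even_power)
      qed
    qed
    finally show ?thesis .
  qed
  then show ?thesis unfolding xi_coeff_def using Phi_pos[of x]
    by (intro exI[of _ "Phi x"] conjI allI divide_right_mono) auto
qed

lemma xi_coeff_pos: "xi_coeff n > 0"
proof -
  obtain c where c: "c > 0" "c / fact (2 * n) \<le> xi_coeff n" using xi_coeff_lower by blast
  have "0 < c / fact (2 * n)" using c by simp
  then show ?thesis using c by linarith
qed

text \<open>From (t^2/\<epsilon>)^n / n! <= exp (t^2/\<epsilon>) and (n!)^2 <= (2n)!. Summation over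
  n bounds the power series by C exp (\<epsilon> |x|).\<close>

lemma xi_coeff_upper:
  assumes "\<epsilon> > 0"
  shows "\<exists>C. \<forall>n. xi_coeff n \<le> C * \<epsilon> ^ n / fact n"
proof -
  define C where "C = (LINT t|lborel. Phi t * exp (t\<^sup>2 / \<epsilon>))"
  have "continuous_on UNIV (\<lambda>t::real. exp (t\<^sup>2 / \<epsilon>))"
    by (intro continuous_intros) (use assms in auto)
  then have int: "integrable lborel (\<lambda>t. Phi t * exp (t\<^sup>2 / \<epsilon>))"
    using integrable_Phi_mult[of "\<lambda>t::real. exp (t\<^sup>2 / \<epsilon>)" 1 "1 / \<epsilon>"] by simp
  have "xi_coeff n \<le> C * \<epsilon> ^ n / fact n" for n
  proof -
    have "Phi_moment (2 * n) \<le> (LINT t|lborel. (\<epsilon> ^ n * fact n) * (Phi t * exp (t\<^sup>2 / \<epsilon>)))"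
      unfolding Phi_moment_def
    proof (rule integral_mono)
      show "integrable lborel (\<lambda>t. Phi t * t ^ (2 * n))" by (rule integrable_Phi_power)
      show "integrable lborel (\<lambda>t. (\<epsilon> ^ n * fact n) * (Phi t * exp (t\<^sup>2 / \<epsilon>)))" using int by simp
      fix t :: real
      have "(\<Sum>k\<in>{n}. (t\<^sup>2 / \<epsilon>) ^ k / fact k) \<le> (\<Sum>k. (t\<^sup>2 / \<epsilon>) ^ k / fact k)"
        using summable_exp_generic[of "t\<^sup>2 / \<epsilon>"] assms by (intro sum_le_suminf) (auto simp: divide_inverse mult.commute)
      then have "(t\<^sup>2 / \<epsilon>) ^ n / fact n \<le> exp (t\<^sup>2 / \<epsilon>)" by (simp add: exp_def divide_inverse mult.commute)
      then have "t ^ (2 * n) \<le> (\<epsilon> ^ n * fact n) * exp (t\<^sup>2 / \<epsilon>)"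
        using assms by (simp add: power_divide power_mult[symmetric] field_simps)
      then have "Phi t * t ^ (2 * n) \<le> Phi t * ((\<epsilon> ^ n * fact n) * exp (t\<^sup>2 / \<epsilon>))"
        using Phi_pos[of t] by (intro mult_left_mono) auto
      then show "Phi t * t ^ (2 * n) \<le> (\<epsilon> ^ n * fact n) * (Phi t * exp (t\<^sup>2 / \<epsilon>))" by (simp add: mult_ac)
    qed
    also have "\<dots> = (\<epsilon> ^ n * fact n) * C" unfolding C_def by simp
    finally have "xi_coeff n \<le> (\<epsilon> ^ n * fact n) * C / fact (2 * n)"
      unfolding xi_coeff_def by (simp add: divide_right_mono)
    also have "\<dots> \<le> (\<epsilon> ^ n * fact n) * C / (fact n * fact n)"
    proof (intro divide_left_mono)
      have "(fact n * fact n :: nat) * (2 * n choose n) = fact (2 * n)"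
        using binomial_fact_lemma[of n "2 * n"] by simp
      then have "(fact n * fact n :: nat) * 1 \<le> fact (2 * n)"
        by (metis mult_le_mono2 zero_less_binomial le_add1 mult_2 Suc_leI One_nat_def)
      then have "real (fact n * fact n) \<le> real (fact (2 * n))" by (simp only: of_nat_le_iff mult_1_right)
      then show "(fact n * fact n :: real) \<le> fact (2 * n)" by simp
      have "0 \<le> C" unfolding C_def by (intro integral_nonneg_AE AE_I2) (simp add: Phi_pos less_imp_le)
      then show "0 \<le> \<epsilon> ^ n * fact n * C" using assms by simp
    qed simp
    also have "\<dots> = C * \<epsilon> ^ n / fact n" by simp
    finally show ?thesis .
  qed
  then show ?thesis by blast
qed

section \<open>Logarithmic concavity of the coefficients\<close>

text \<open>Divided by (2n)!, these moments form the geometric sequence 2/\<kappa>^(2n+1), the case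
  of equality in log-concavity. This makes the two-sided exponential the right comparison
  density.\<close>

lemma exp_abs_moment:
  assumes "\<kappa> > 0"
  shows "has_bochner_integral lborel (\<lambda>t::real. exp (- \<kappa> * \<bar>t\<bar>) * t ^ (2 * n)) (2 * fact (2 * n) / \<kappa> ^ (2 * n + 1))"
proof -
  have h1: "has_bochner_integral lborel (\<lambda>x::real. x ^ (2 * n) * exp (- x) * indicator {0..} x) (fact (2 * n))"
  proof (rule has_bochner_integral_nn_integral)
    have "(\<integral>\<^sup>+x. ennreal (x ^ (2 * n) * exp (- x) * indicator {0..} x) \<partial>lborel) =
      (\<integral>\<^sup>+x. ennreal (x ^ (2 * n) * exp (- x)) * indicator {0..} x \<partial>lborel)"
      by (intro nn_integral_cong) (auto simp: indicator_def)
    then show "(\<integral>\<^sup>+x. ennreal (x ^ (2 * n) * exp (- x) * indicator {0..} x) \<partial>lborel) = ennreal (fact (2 * n))"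
      by (simp add: nn_intergal_power_times_exp_Ici)
  qed (auto simp: indicator_def)
  have h2: "has_bochner_integral lborel (\<lambda>x::real. (0 + (-1) * x) ^ (2 * n) * exp (- (0 + (-1) * x)) * indicator {0..} (0 + (-1) * x)) (fact (2 * n) /\<^sub>R \<bar>-1\<bar>)"
    by (rule lborel_has_bochner_integral_real_affine_iff[THEN iffD1, OF _ h1]) simp
  have "has_bochner_integral lborel (\<lambda>t::real. exp (- \<bar>t\<bar>) * t ^ (2 * n)) (fact (2 * n) + fact (2 * n) /\<^sub>R \<bar>-1\<bar>)"
  proof -
    define F where "F = (\<lambda>x::real. x ^ (2 * n) * exp (- x) * indicator {0..} x +
       (0 + (-1) * x) ^ (2 * n) * exp (- (0 + (-1) * x)) * indicator {0..} (0 + (-1) * x))"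
    have hF: "has_bochner_integral lborel F (fact (2 * n) + fact (2 * n) /\<^sub>R \<bar>-1\<bar>)"
      unfolding F_def by (rule has_bochner_integral_add[OF h1 h2])
    have AE: "AE x in lborel. F x = exp (- \<bar>x\<bar>) * x ^ (2 * n)"
    proof -
      have "AE x in lborel. x \<noteq> (0::real)" by (rule AE_lborel_singleton)
      then show ?thesis by eventually_elim (auto simp: F_def indicator_def)
    qed
    have "F \<in> borel_measurable lborel" unfolding F_def by measurable
    moreover have "(\<lambda>t::real. exp (- \<bar>t\<bar>) * t ^ (2 * n)) \<in> borel_measurable lborel" by measurable
    ultimately show ?thesis using has_bochner_integral_cong_AE[OF _ _ AE] hF by blast
  qed
  then have h3: "has_bochner_integral lborel (\<lambda>t::real. exp (- \<bar>t\<bar>) * t ^ (2 * n)) (2 * fact (2 * n))" by simp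
  have "has_bochner_integral lborel (\<lambda>t::real. exp (- \<bar>0 + \<kappa> * t\<bar>) * (0 + \<kappa> * t) ^ (2 * n)) ((2 * fact (2 * n)) /\<^sub>R \<bar>\<kappa>\<bar>)"
    by (rule lborel_has_bochner_integral_real_affine_iff[THEN iffD1, OF _ h3]) (use assms in simp)
  then have "has_bochner_integral lborel (\<lambda>t::real. inverse (\<kappa> ^ (2 * n)) * (exp (- \<bar>0 + \<kappa> * t\<bar>) * (0 + \<kappa> * t) ^ (2 * n))) (inverse (\<kappa> ^ (2 * n)) * ((2 * fact (2 * n)) /\<^sub>R \<bar>\<kappa>\<bar>))"
    by (rule has_bochner_integral_mult_right)
  moreover have "(\<lambda>t::real. inverse (\<kappa> ^ (2 * n)) * (exp (- \<bar>0 + \<kappa> * t\<bar>) * (0 + \<kappa> * t) ^ (2 * n))) = (\<lambda>t. exp (- \<kappa> * \<bar>t\<bar>) * t ^ (2 * n))"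
    using assms by (auto simp: abs_mult power_mult_distrib fun_eq_iff)
  moreover have "inverse (\<kappa> ^ (2 * n)) * ((2 * fact (2 * n)) /\<^sub>R \<bar>\<kappa>\<bar>) = 2 * fact (2 * n) / \<kappa> ^ (2 * n + 1)"
    using assms by (simp add: field_simps)
  ultimately show ?thesis by simp
qed

text \<open>
  A log-concave density exceeds an exponential exactly on an interval. Hence, if the moments of
  order \<open>2 n\<close> and \<open>2 n + 4\<close> of the difference vanish, integrating it against a polynomial with the
  same sign changes shows that the moment of order \<open>2 n + 2\<close> is nonnegative.
\<close>
lemma crossing_moment:
  fixes D :: "real \<Rightarrow> real"
  assumes even: "\<And>t. D t = D \<bar>t\<bar>"
    and conv: "\<And>a b s. \<lbrakk>0 \<le> a; a < s; s < b; D a \<ge> 0; D b \<ge> 0\<rbrakk> \<Longrightarrow> D s \<ge> 0"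
    and int: "\<And>k. integrable lborel (\<lambda>t. D t * t ^ (2 * k))"
    and z0: "(LINT t|lborel. D t * t ^ (2 * n)) = 0"
    and z2: "(LINT t|lborel. D t * t ^ (2 * (n + 2))) = 0"
  shows "(LINT t|lborel. D t * t ^ (2 * (n + 1))) \<ge> 0"
proof -
  define d where "d = (\<lambda>k. LINT t|lborel. D t * t ^ (2 * k))"
  define I where "I = {t. t \<ge> 0 \<and> D t \<ge> 0}"
  have evpos: "(t::real) ^ (2 * k) \<ge> 0" for t k by (simp add: zero_le_even_power)
  show ?thesis
  proof (cases "\<exists>t0>0. t0 \<in> I")
    case False
    \<comment> \<open>If \<open>D\<close> is nonpositive off the origin, its vanishing moment forces
      it to vanish almost everywhere.\<close>
    then have neg: "D t \<le> 0" if "t \<noteq> 0" for t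
      using that even[of t] by (auto simp: I_def not_le intro: less_imp_le)
    have AE0: "AE t in lborel. t \<noteq> (0::real)" by (rule AE_lborel_singleton)
    have "AE t in lborel. 0 \<le> - (D t * t ^ (2 * n))"
      using AE0 by eventually_elim (use neg evpos in \<open>auto simp: mult_le_0_iff\<close>)
    moreover have "(LINT t|lborel. - (D t * t ^ (2 * n))) = 0" using z0 by simp
    ultimately have "AE t in lborel. - (D t * t ^ (2 * n)) = 0"
      using integral_nonneg_eq_0_iff_AE[of lborel "\<lambda>t. - (D t * t ^ (2 * n))"] int[of n] by simp
    then have "AE t in lborel. D t * t ^ (2 * (n + 1)) = 0"
      by eventually_elim auto
    then have "(LINT t|lborel. D t * t ^ (2 * (n + 1))) = 0" by (rule integral_eq_zero_AE)
    then show ?thesis by simp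
  next
    case True
    then obtain t0 where t0: "t0 > 0" "t0 \<in> I" by blast
    have bb: "bdd_below I" by (auto simp: I_def bdd_below_def intro!: exI[of _ 0])
    define \<alpha> where "\<alpha> = Inf I"
    have Ine: "I \<noteq> {}" using t0 by blast
    have \<alpha>0: "\<alpha> \<ge> 0" unfolding \<alpha>_def by (rule cInf_greatest[OF Ine]) (simp add: I_def)
    have below: "D s < 0" if "0 \<le> s" "s < \<alpha>" for s
    proof (rule ccontr)
      assume "\<not> D s < 0"
      then have "s \<in> I" using that by (auto simp: I_def)
      then have "\<alpha> \<le> s" unfolding \<alpha>_def by (intro cInf_lower bb)
      then show False using that by simp
    qed
    show ?thesis
    proof (cases "bdd_above I")
      case True
      define \<beta> where "\<beta> = Sup I"
      have \<beta>: "\<beta> \<ge> t0" unfolding \<beta>_def by (intro cSup_upper t0 True)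
      have \<alpha>\<beta>: "\<alpha> \<le> \<beta>" using cInf_lower[OF t0(2) bb] \<beta> by (simp add: \<alpha>_def)
      have above: "D s < 0" if "s > \<beta>" for s
      proof (rule ccontr)
        assume "\<not> D s < 0"
        then have "s \<in> I" using that \<beta> t0 by (auto simp: I_def)
        then have "s \<le> \<beta>" unfolding \<beta>_def by (intro cSup_upper True)
        then show False using that by simp
      qed
      have mid: "D s \<ge> 0" if as: "\<alpha> < s" "s < \<beta>" for s
      proof -
        obtain a where "a \<in> I" "a < s" using cInf_lessD[OF Ine as(1)[unfolded \<alpha>_def]] by blast
        moreover obtain b where "b \<in> I" "s < b" using less_cSupD[OF Ine as(2)[unfolded \<beta>_def]] by blast
        ultimately show ?thesis using conv[of a s b] by (auto simp: I_def)
      qed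
      \<comment> \<open>\<open>\<alpha>\<close> and \<open>\<beta>\<close> are the ends of the
        interval where \<open>D\<close> is nonnegative on the half-line. The quartic changes sign at
        the same places, so the product keeps one sign; on integration its outer moments drop
        out.\<close>
      have sign: "(t\<^sup>2 - \<alpha>\<^sup>2) * (t\<^sup>2 - \<beta>\<^sup>2) * D t \<le> 0" for t
      proof -
        define s where "s = \<bar>t\<bar>"
        have s: "s \<ge> 0" "t\<^sup>2 = s\<^sup>2" "D t = D s" using even[of t] by (auto simp: s_def)
        have fac: "s\<^sup>2 - c\<^sup>2 = (s - c) * (s + c)" for c by (simp add: power2_eq_square algebra_simps)
        consider "s < \<alpha>" | "s = \<alpha>" | "\<alpha> < s" "s < \<beta>" | "s = \<beta>" | "s > \<beta>" by linarith
        then show ?thesis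
        proof cases
          case 1
          have "(s\<^sup>2 - \<alpha>\<^sup>2) * (s\<^sup>2 - \<beta>\<^sup>2) \<ge> 0"
            using 1 s \<alpha>\<beta> by (intro mult_nonpos_nonpos) (auto intro!: power_mono)
          then show ?thesis unfolding s using below[OF s(1) 1] by (simp add: mult_le_0_iff)
        next
          case 3
          have "(s\<^sup>2 - \<alpha>\<^sup>2) * (s\<^sup>2 - \<beta>\<^sup>2) \<le> 0"
            using 3 s \<alpha>0 by (intro mult_nonneg_nonpos) (auto intro!: power_mono)
          then show ?thesis unfolding s using mid[OF 3] by (simp add: mult_le_0_iff)
        next
          case 5
          have "(s\<^sup>2 - \<alpha>\<^sup>2) * (s\<^sup>2 - \<beta>\<^sup>2) \<ge> 0"
            using 5 s \<alpha>0 \<alpha>\<beta> by (intro mult_nonneg_nonneg) (auto intro!: power_mono)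
          then show ?thesis unfolding s using above[OF 5] by (simp add: mult_le_0_iff)
        qed (auto simp: s)
      qed
      have "0 \<le> (LINT t|lborel. (\<alpha>\<^sup>2 + \<beta>\<^sup>2) * (D t * t ^ (2 * (n + 1))) - D t * t ^ (2 * (n + 2)) - \<alpha>\<^sup>2 * \<beta>\<^sup>2 * (D t * t ^ (2 * n)))"
      proof (rule integral_nonneg_AE[OF AE_I2])
        fix t
        have "(\<alpha>\<^sup>2 + \<beta>\<^sup>2) * (D t * t ^ (2 * (n + 1))) - D t * t ^ (2 * (n + 2)) - \<alpha>\<^sup>2 * \<beta>\<^sup>2 * (D t * t ^ (2 * n))
           = - (((t\<^sup>2 - \<alpha>\<^sup>2) * (t\<^sup>2 - \<beta>\<^sup>2) * D t) * t ^ (2 * n))"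
          by (simp add: power2_eq_square algebra_simps)
        moreover have "((t\<^sup>2 - \<alpha>\<^sup>2) * (t\<^sup>2 - \<beta>\<^sup>2) * D t) * t ^ (2 * n) \<le> 0"
          using sign[of t] evpos[of t n] by (rule mult_nonpos_nonneg)
        ultimately show "0 \<le> (\<alpha>\<^sup>2 + \<beta>\<^sup>2) * (D t * t ^ (2 * (n + 1))) - D t * t ^ (2 * (n + 2)) - \<alpha>\<^sup>2 * \<beta>\<^sup>2 * (D t * t ^ (2 * n))"
          by linarith
      qed
      also have "\<dots> = (\<alpha>\<^sup>2 + \<beta>\<^sup>2) * d (n + 1) - d (n + 2) - \<alpha>\<^sup>2 * \<beta>\<^sup>2 * d n"
        unfolding d_def using int[of n] int[of "n + 1"] int[of "n + 2"]
        by (simp only: Bochner_Integration.integral_diff integral_mult_right_zero integrable_mult_right Bochner_Integration.integrable_diff)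
      finally have "0 \<le> (\<alpha>\<^sup>2 + \<beta>\<^sup>2) * d (n + 1)" using z0 z2 by (simp add: d_def)
      moreover have "\<alpha>\<^sup>2 + \<beta>\<^sup>2 > 0" using \<beta> t0 by (intro add_nonneg_pos) auto
      ultimately show ?thesis by (simp add: d_def zero_le_mult_iff)
    next
      \<comment> \<open>With no upper end there is a single sign change, so the weight is t^2 -
        \<alpha>^2.\<close>
      case False
      have mid: "D s \<ge> 0" if as: "\<alpha> < s" for s
      proof -
        obtain a where "a \<in> I" "a < s" using cInf_lessD[OF Ine as[unfolded \<alpha>_def]] by blast
        moreover obtain b where "b \<in> I" "s < b" using False by (auto simp: bdd_above_def not_le)
        ultimately show ?thesis using conv[of a s b] by (auto simp: I_def)
      qed
      have sign: "(t\<^sup>2 - \<alpha>\<^sup>2) * D t \<ge> 0" for t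
      proof -
        define s where "s = \<bar>t\<bar>"
        have s: "s \<ge> 0" "t\<^sup>2 = s\<^sup>2" "D t = D s" using even[of t] by (auto simp: s_def)
        consider "s < \<alpha>" | "s = \<alpha>" | "\<alpha> < s" by linarith
        then show ?thesis
        proof cases
          case 1
          then show ?thesis unfolding s using below[OF s(1) 1] s(1) by (intro mult_nonpos_nonpos) (auto intro!: power_mono)
        next
          case 3
          then show ?thesis unfolding s using mid[OF 3] \<alpha>0 by (intro mult_nonneg_nonneg) (auto intro!: power_mono)
        qed (simp add: s)
      qed
      have "0 \<le> (LINT t|lborel. D t * t ^ (2 * (n + 1)) - \<alpha>\<^sup>2 * (D t * t ^ (2 * n)))"
      proof (rule integral_nonneg_AE[OF AE_I2])
        fix t
        have "0 \<le> ((t\<^sup>2 - \<alpha>\<^sup>2) * D t) * t ^ (2 * n)" using sign[of t] evpos[of t n] by (rule mult_nonneg_nonneg)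
        also have "\<dots> = D t * t ^ (2 * (n + 1)) - \<alpha>\<^sup>2 * (D t * t ^ (2 * n))"
          by (simp add: power2_eq_square algebra_simps)
        finally show "0 \<le> D t * t ^ (2 * (n + 1)) - \<alpha>\<^sup>2 * (D t * t ^ (2 * n))" .
      qed
      also have "\<dots> = d (n + 1) - \<alpha>\<^sup>2 * d n"
        unfolding d_def using int[of n] int[of "n + 1"]
        by (simp only: Bochner_Integration.integral_diff integral_mult_right_zero integrable_mult_right)
      finally show ?thesis using z0 by (simp add: d_def)
    qed
  qed
qed

lemma nonneg_of_pos_mult: "(c::real) > 0 \<Longrightarrow> 0 \<le> c * x \<Longrightarrow> 0 \<le> x"
  by (simp add: zero_le_mult_iff)

text \<open>The density C exp (-\<kappa> |t|) is fitted to the coefficients of index n and n+2,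
  which forces \<kappa>^4 = A_n/A_{n+2}. The crossing argument then gives A_{n+1} >= A_n/\<kappa>^2,
  and this lower bound is the geometric mean of A_n and A_{n+2}.\<close>

theorem xi_coeff_log_concave: "xi_coeff n * xi_coeff (n + 2) \<le> (xi_coeff (n + 1))\<^sup>2"
proof -
  define q where "q = xi_coeff n / xi_coeff (n + 2)"
  define \<kappa> where "\<kappa> = sqrt (sqrt q)"
  have q: "q > 0" using xi_coeff_pos by (simp add: q_def)
  have \<kappa>: "\<kappa> > 0" using q by (simp add: \<kappa>_def)
  have l4: "\<kappa> ^ 4 = q"
  proof -
    have "\<kappa>\<^sup>2 = sqrt q" using q by (simp add: \<kappa>_def)
    then have "(\<kappa>\<^sup>2)\<^sup>2 = q" using q by simp
    then show ?thesis by (simp add: power_mult[symmetric])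
  qed
  define C where "C = xi_coeff n * \<kappa> ^ (2 * n + 1) / 2"
  have C: "C > 0" using xi_coeff_pos \<kappa> by (simp add: C_def)
  define D where "D = (\<lambda>t. Phi t - C * exp (- \<kappa> * \<bar>t\<bar>))"
  have E: "has_bochner_integral lborel (\<lambda>t. C * (exp (- \<kappa> * \<bar>t\<bar>) * t ^ (2 * k))) (C * (2 * fact (2 * k) / \<kappa> ^ (2 * k + 1)))" for k
    by (intro has_bochner_integral_mult_right exp_abs_moment \<kappa>)
  have Deq: "(\<lambda>t. D t * t ^ (2 * k)) = (\<lambda>t. Phi t * t ^ (2 * k) - C * (exp (- \<kappa> * \<bar>t\<bar>) * t ^ (2 * k)))" for k
    by (auto simp: D_def algebra_simps)
  have Dint: "integrable lborel (\<lambda>t. D t * t ^ (2 * k))" for k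
    unfolding Deq by (intro Bochner_Integration.integrable_diff integrable_Phi_power integrable.intros[OF E])
  have Dval: "(LINT t|lborel. D t * t ^ (2 * k)) = fact (2 * k) * (xi_coeff k - 2 * C / \<kappa> ^ (2 * k + 1))" for k
  proof -
    have "(LINT t|lborel. D t * t ^ (2 * k)) = Phi_moment (2 * k) - C * (2 * fact (2 * k) / \<kappa> ^ (2 * k + 1))"
      unfolding Deq Phi_moment_def
      by (subst Bochner_Integration.integral_diff[OF integrable_Phi_power integrable.intros[OF E]]) (simp only: has_bochner_integral_integral_eq[OF E])
    moreover have "Phi_moment (2 * k) = fact (2 * k) * xi_coeff k" by (simp add: xi_coeff_def)
    ultimately show ?thesis by (simp add: right_diff_distrib)
  qed
  have "0 \<le> (LINT t|lborel. D t * t ^ (2 * (n + 1)))"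
  proof (rule crossing_moment[OF _ _ Dint])
    show "D t = D \<bar>t\<bar>" for t using Phi_even[of t] by (auto simp: D_def abs_if)
    show "(LINT t|lborel. D t * t ^ (2 * n)) = 0"
      unfolding Dval using \<kappa> by (simp add: C_def)
    show "(LINT t|lborel. D t * t ^ (2 * (n + 2))) = 0"
    proof -
      have "2 * (n + 2) + 1 = (2 * n + 1) + 4" by simp
      then have "\<kappa> ^ (2 * (n + 2) + 1) = \<kappa> ^ (2 * n + 1) * \<kappa> ^ 4" by (simp only: power_add)
      also have "\<dots> = \<kappa> ^ (2 * n + 1) * q" by (simp only: l4)
      finally have "2 * C / \<kappa> ^ (2 * (n + 2) + 1) = xi_coeff n / q" using \<kappa> by (simp only: C_def) simp
      also have "\<dots> = xi_coeff (n + 2)" using xi_coeff_pos[of n] by (simp add: q_def)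
      finally show ?thesis unfolding Dval by simp
    qed
    fix a b s :: real assume a: "0 \<le> a" "a < s" "s < b" "D a \<ge> 0" "D b \<ge> 0"
    \<comment> \<open>The logarithm of the quotient of exponential and kernel. It is convex for t >=
      0, so the set where it is <= 0, that is where \<open>D\<close> is nonnegative, is an
      interval.\<close>
    define g where "g = (\<lambda>t. - ln (Phi t) + (ln C - \<kappa> * t))"
    have D_iff: "D t \<ge> 0 \<longleftrightarrow> g t \<le> 0" if "t \<ge> 0" for t
    proof -
      have "D t \<ge> 0 \<longleftrightarrow> exp (ln C - \<kappa> * t) \<le> exp (ln (Phi t))"
        using that C Phi_pos[of t] by (simp add: D_def exp_diff exp_minus divide_inverse)
      then show ?thesis by (simp add: g_def)
    qed
    have "convex_on {0..} g"
      unfolding g_def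
    proof (rule convex_on_add[OF Phi_log_concave])
      show "convex_on {0..} (\<lambda>t. ln C - \<kappa> * t)"
        by (rule convex_onI) (auto simp: algebra_simps)
    qed
    define u where "u = (s - a) / (b - a)"
    have "u * (b - a) = s - a" using a by (simp add: u_def)
    then have "s = (1 - u) * a + u * b" by (simp add: algebra_simps)
    moreover have "0 \<le> u" "u \<le> 1" using a by (simp_all add: u_def)
    ultimately have u: "0 \<le> u" "u \<le> 1" "s = (1 - u) * a + u * b" by blast+
    have "g s \<le> (1 - u) * g a + u * g b"
      using convex_onD[OF \<open>convex_on {0..} g\<close> u(1,2), of a b] a u(3) by simp
    also have "\<dots> \<le> 0" using a D_iff[of a] D_iff[of b] u by (intro add_nonpos_nonpos mult_nonneg_nonpos) auto
    finally show "D s \<ge> 0" using D_iff[of s] a by simp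
  qed
  then have "0 \<le> xi_coeff (n + 1) - 2 * C / \<kappa> ^ (2 * (n + 1) + 1)"
    unfolding Dval by (rule nonneg_of_pos_mult[rotated]) simp
  moreover have "2 * C / \<kappa> ^ (2 * (n + 1) + 1) = xi_coeff n / \<kappa>\<^sup>2"
  proof -
    have "\<kappa> ^ (2 * (n + 1) + 1) = \<kappa> ^ (2 * n + 1) * \<kappa>\<^sup>2" by (simp add: power2_eq_square)
    then show ?thesis using \<kappa> by (simp only: C_def) simp
  qed
  ultimately have "xi_coeff n / \<kappa>\<^sup>2 \<le> xi_coeff (n + 1)" by simp
  then have "(xi_coeff n / \<kappa>\<^sup>2)\<^sup>2 \<le> (xi_coeff (n + 1))\<^sup>2"
    using xi_coeff_pos[of n] by (intro power_mono) auto
  moreover have "(xi_coeff n / \<kappa>\<^sup>2)\<^sup>2 = xi_coeff n * xi_coeff (n + 2)"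
  proof -
    have "(\<kappa>\<^sup>2)\<^sup>2 = q" using l4 by (simp add: power2_eq_square power4_eq_xxxx)
    then show ?thesis using xi_coeff_pos[of n] by (simp add: power_divide q_def power2_eq_square)
  qed
  ultimately show ?thesis by simp
qed

section \<open>The zeta function and the Xi function\<close>

text \<open>The substitution x = exp t turns Euler's integral into one over the whole line, where
  the affine change t -> b + 2t produces \<open>vfun\<close>.\<close>

lemma Gamma_integral_exp:
  assumes s: "Re s > 0"
  shows "has_bochner_integral lborel (\<lambda>t. exp (s * of_real t - of_real (exp t))) (Gamma s)"
proof -
  define f where "f = (\<lambda>t. complex_of_real t powr (s - 1) / of_real (exp t))"
  define g where "g = (\<lambda>t::real. exp (s * of_real t - of_real (exp t)))"
  have img: "exp ` (UNIV::real set) = {0<..}"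
    by (auto simp: image_iff) (metis exp_ln)
  have "f absolutely_integrable_on {0<..}" "integral {0<..} f = Gamma s"
    using absolutely_integrable_Gamma_integral'[OF s] integral_unique[OF Gamma_integral_complex'[OF s]]
    by (auto simp: f_def)
  then have "(\<lambda>t. \<bar>exp t\<bar> *\<^sub>R f (exp t)) absolutely_integrable_on UNIV \<and> integral UNIV (\<lambda>t. \<bar>exp t\<bar> *\<^sub>R f (exp t)) = Gamma s"
    using has_absolute_integral_change_of_variables_real[of UNIV exp exp f "Gamma s"]
    by (auto simp: img inj_on_def intro!: derivative_eq_intros)
  moreover have "(\<lambda>t. \<bar>exp t\<bar> *\<^sub>R f (exp t)) = g"
  proof
    fix t :: real
    have "complex_of_real (exp t) powr (s - 1) = exp ((s - 1) * of_real t)"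
      by (simp add: powr_def Ln_of_real mult.commute)
    then have "\<bar>exp t\<bar> *\<^sub>R f (exp t) = exp (of_real t) * (exp ((s - 1) * of_real t) / exp (of_real (exp t)))"
      by (simp add: f_def scaleR_conv_of_real exp_of_real)
    also have "\<dots> = exp (of_real t + (s - 1) * of_real t - of_real (exp t))"
      by (simp only: exp_add exp_diff times_divide_eq_right)
    also have "of_real t + (s - 1) * of_real t - of_real (exp t) = s * of_real t - complex_of_real (exp t)"
      by (simp add: algebra_simps)
    finally show "\<bar>exp t\<bar> *\<^sub>R f (exp t) = g t" by (simp add: g_def)
  qed
  ultimately have g: "g absolutely_integrable_on UNIV" "integral UNIV g = Gamma s" by auto
  have "g \<in> borel_measurable borel"
    unfolding g_def by (intro borel_measurable_continuous_onI continuous_intros)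
  then have gm: "g \<in> lborel \<rightarrow>\<^sub>M borel" by simp
  have "integrable lebesgue g" using g(1) by (simp add: set_integrable_def)
  then have int: "integrable lborel g" using integrable_completion[OF gm] by simp
  have "integral\<^sup>L lborel g = integral\<^sup>L lebesgue g" by (rule integral_completion[OF gm, symmetric])
  also have "\<dots> = integral UNIV g"
    using set_lebesgue_integral_eq_integral(2)[OF g(1)] by (simp add: set_lebesgue_integral_def)
  finally show ?thesis using int g(2) unfolding g_def by (simp add: has_bochner_integral_iff)
qed

lemma vfun_integral:
  assumes s: "Re s > 0"
  shows "has_bochner_integral lborel (\<lambda>t. exp (s * of_real t) * of_real (vfun n t ^ k * exp (- vfun n t)))
    (exp (- s / 2 * of_real (ln (pi * (real (Suc n))\<^sup>2))) * Gamma (s / 2 + of_nat k) / 2)"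
proof -
  define b where "b = ln (pi * (real (Suc n))\<^sup>2)"
  have eb: "exp b = pi * (real (Suc n))\<^sup>2" unfolding b_def by (rule exp_ln) simp
  have v: "exp (b + 2 * t) = vfun n t" for t by (simp add: exp_add eb vfun_def)
  define z where "z = s / 2 + of_nat k"
  have z: "Re z > 0" using s by (simp add: z_def add_pos_nonneg)
  have "has_bochner_integral lborel (\<lambda>t. exp (z * of_real (b + 2 * t) - of_real (exp (b + 2 * t)))) (Gamma z /\<^sub>R \<bar>2\<bar>)"
    by (rule lborel_has_bochner_integral_real_affine_iff[THEN iffD1, OF _ Gamma_integral_exp[OF z]]) simp
  then have "has_bochner_integral lborel (\<lambda>t. exp (- s / 2 * of_real b) * exp (z * of_real (b + 2 * t) - of_real (exp (b + 2 * t))))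
      (exp (- s / 2 * of_real b) * (Gamma z /\<^sub>R \<bar>2\<bar>))"
    by (rule has_bochner_integral_mult_right)
  moreover have "exp (- s / 2 * of_real b) * exp (z * of_real (b + 2 * t) - of_real (exp (b + 2 * t)))
     = exp (s * of_real t) * of_real (vfun n t ^ k * exp (- vfun n t))" for t
  proof -
    have "- s / 2 * of_real b + (z * of_real (b + 2 * t) - of_real (exp (b + 2 * t))) =
        s * of_real t + (of_nat k * of_real (b + 2 * t) - of_real (exp (b + 2 * t)))"
      by (simp add: z_def algebra_simps)
    then have "exp (- s / 2 * of_real b) * exp (z * of_real (b + 2 * t) - of_real (exp (b + 2 * t))) =
      exp (s * of_real t) * exp (of_nat k * of_real (b + 2 * t) - of_real (exp (b + 2 * t)))"
      by (simp only: exp_add[symmetric])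
    also have "exp (of_nat k * of_real (b + 2 * t) - of_real (exp (b + 2 * t))) = complex_of_real (exp (b + 2 * t) ^ k * exp (- exp (b + 2 * t)))"
      by (simp only: exp_diff exp_of_nat_mult exp_minus of_real_mult of_real_power exp_of_real of_real_inverse divide_inverse)
    finally show ?thesis by (simp only: v)
  qed
  ultimately show ?thesis by (simp add: z_def b_def scaleR_conv_of_real)
qed

definition Phi_transform :: "complex \<Rightarrow> complex" where
  "Phi_transform w = (LINT t|lborel. of_real (Phi t) * exp (w * of_real t))"

lemma Phi_transform_power_series: "(\<lambda>n. of_real (xi_coeff n) * w ^ (2 * n)) sums Phi_transform w"
  unfolding Phi_transform_def by (rule Phi_transform_sums)

text \<open>The series of the kernel is integrated term by term. Absolute convergence for Re s > 1
  comes from the same integrals at the real point Re s, which are constant multiples of (n+1)^(-Re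
  s).\<close>

lemma Phi_transform_Dirichlet:
  assumes s: "Re s > 1"
  shows "(\<lambda>n. 1 / 2 * s * (s - 1) * of_real pi powr (- s / 2) * Gamma (s / 2) * (1 / of_nat (Suc n) powr s)) sums Phi_transform (s - 1 / 2)"
proof -
  define f where "f = (\<lambda>n t. exp (s * of_real t) * of_real ((4 * vfun n t ^ 2 - 6 * vfun n t ^ 1) * exp (- vfun n t)))"
  define e where "e = (\<lambda>s n. exp (- s / 2 * of_real (ln (pi * (real (Suc n))\<^sup>2))) :: complex)"
  have s0: "Re s > 0" using s by simp
  have f_int: "has_bochner_integral lborel (f n) (4 * (e s n * Gamma (s / 2 + of_nat 2) / 2) - 6 * (e s n * Gamma (s / 2 + of_nat 1) / 2))" for n
  proof -
    have "f n = (\<lambda>t. 4 * (exp (s * of_real t) * of_real (vfun n t ^ 2 * exp (- vfun n t))) - 6 * (exp (s * of_real t) * of_real (vfun n t ^ 1 * exp (- vfun n t))))"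
      by (auto simp: f_def algebra_simps)
    then show ?thesis unfolding e_def
      by (simp only:) (intro has_bochner_integral_diff has_bochner_integral_mult_right vfun_integral s0)
  qed
  have e_eq: "e z n = of_real pi powr (- z / 2) * (1 / of_nat (Suc n) powr z)" for z n
  proof -
    have "ln (pi * (real (Suc n))\<^sup>2) = ln pi + 2 * ln (real (Suc n))" by (simp add: ln_mult ln_realpow)
    then have "- z / 2 * of_real (ln (pi * (real (Suc n))\<^sup>2)) = - z / 2 * of_real (ln pi) + (- z * of_real (ln (real (Suc n))))"
      by (simp add: field_simps del: of_nat_Suc)
    then have "e z n = exp (- z / 2 * of_real (ln pi) + (- z * of_real (ln (real (Suc n)))))"
      by (simp only: e_def)
    also have "\<dots> = exp (- z / 2 * of_real (ln pi)) * exp (- z * of_real (ln (real (Suc n))))" by (rule exp_add)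
    also have "exp (- z / 2 * of_real (ln pi)) = of_real pi powr (- z / 2)"
      by (simp add: powr_def Ln_of_real)
    also have "exp (- z * of_real (ln (real (Suc n)))) = 1 / of_nat (Suc n) powr z"
    proof -
      have "Ln (of_nat (Suc n)) = of_real (ln (real (Suc n)))"
        using Ln_of_real[of "real (Suc n)"] by simp
      then show ?thesis by (simp add: powr_def exp_minus divide_inverse del: of_nat_Suc)
    qed
    finally show ?thesis .
  qed
  \<comment> \<open>By the recurrence of Gamma the weights 4 and -6 of the kernel give 2 (s/2 + 1)
    (s/2) - 3 (s/2) = s (s - 1)/2, the polynomial factor in the definition of Xi.\<close>
  have val: "4 * (e s n * Gamma (s / 2 + of_nat 2) / 2) - 6 * (e s n * Gamma (s / 2 + of_nat 1) / 2) =
     1 / 2 * s * (s - 1) * of_real pi powr (- s / 2) * Gamma (s / 2) * (1 / of_nat (Suc n) powr s)" for n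
  proof -
    have nz: "s / 2 \<notin> \<int>\<^sub>\<le>\<^sub>0" "s / 2 + 1 \<notin> \<int>\<^sub>\<le>\<^sub>0" using s0 by (auto elim!: nonpos_Ints_cases simp: complex_eq_iff)
    have g1: "Gamma (s / 2 + of_nat 1) = s / 2 * Gamma (s / 2)" using Gamma_plus1[OF nz(1)] by simp
    have g2: "Gamma (s / 2 + of_nat 2) = (s / 2 + 1) * (s / 2 * Gamma (s / 2))"
      using Gamma_plus1[OF nz(2)] Gamma_plus1[OF nz(1)] by (simp add: add.assoc)
    have "4 * (p * i * ((s / 2 + 1) * (s / 2 * g)) / 2) - 6 * (p * i * (s / 2 * g) / 2) = 1 / 2 * s * (s - 1) * p * g * i" for p i g :: complex
      by (simp add: field_simps)
    then show ?thesis unfolding g1 g2 e_eq .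
  qed
  have "(\<lambda>n. integral\<^sup>L lborel (f n)) sums (\<integral>t. (\<Sum>n. f n t) \<partial>lborel)"
  proof (rule sums_integral)
    show "integrable lborel (f n)" for n using integrable.intros[OF f_int] .
    have nf: "norm (f n t) \<le> exp (Re s * t) * (4 * (vfun n t ^ 2 * exp (- vfun n t)) + 6 * (vfun n t ^ 1 * exp (- vfun n t)))" for n t
    proof -
      have "norm (f n t) = exp (Re s * t) * \<bar>(4 * vfun n t ^ 2 - 6 * vfun n t ^ 1) * exp (- vfun n t)\<bar>"
        by (simp only: f_def norm_mult norm_of_real norm_exp_eq_Re Re_complex_of_real times_complex.sel Im_complex_of_real mult_zero_right diff_0_right)
      also have "\<bar>(4 * vfun n t ^ 2 - 6 * vfun n t ^ 1) * exp (- vfun n t)\<bar> \<le> 4 * (vfun n t ^ 2 * exp (- vfun n t)) + 6 * (vfun n t ^ 1 * exp (- vfun n t))"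
        using vfun_pos[of n t] by (simp add: abs_mult abs_le_iff algebra_simps)
      finally show ?thesis by simp
    qed
    show "AE t in lborel. summable (\<lambda>n. norm (f n t))"
    proof (rule AE_I2)
      fix t
      have "summable (\<lambda>n. exp (Re s * t) * (4 * (vfun n t ^ 2 * exp (- vfun n t)) + 6 * (vfun n t ^ 1 * exp (- vfun n t))))"
        by (intro summable_mult summable_add summable_vfun)
      then show "summable (\<lambda>n. norm (f n t))"
        by (rule summable_comparison_test') (use nf in auto)
    qed
    define r where "r = (\<lambda>k n. Re (e (of_real (Re s)) n * Gamma (of_real (Re s) / 2 + of_nat k) / 2))"
    have rint: "has_bochner_integral lborel (\<lambda>t. exp (Re s * t) * (vfun n t ^ k * exp (- vfun n t))) (r k n)" for k n
    proof -
      have "has_bochner_integral lborel (\<lambda>t. Re (exp (of_real (Re s) * of_real t) * of_real (vfun n t ^ k * exp (- vfun n t)))) (r k n)"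
        unfolding r_def e_def by (intro has_bochner_integral_Re vfun_integral) (use s0 in simp)
      moreover have "Re (exp (of_real (Re s) * of_real t) * of_real (vfun n t ^ k * exp (- vfun n t))) = exp (Re s * t) * (vfun n t ^ k * exp (- vfun n t))" for t
        by (simp only: of_real_mult[symmetric] exp_of_real Re_complex_of_real)
      ultimately show ?thesis by (simp only:)
    qed
    have rsum: "summable (\<lambda>n. norm (r k n))" for k
    proof (rule summable_comparison_test')
      show "summable (\<lambda>n. norm (of_real pi powr (- of_real (Re s) / 2) * Gamma (of_real (Re s) / 2 + of_nat k) / 2 :: complex) * (1 / real (Suc n) powr Re s))"
      proof (intro summable_mult)
        have "summable (\<lambda>n. real n powr (- Re s))" using s by (subst summable_real_powr_iff) simp
        then have "summable (\<lambda>n. real (Suc n) powr (- Re s))" by (subst summable_Suc_iff)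
        then show "summable (\<lambda>n. 1 / real (Suc n) powr Re s)" by (simp add: powr_minus divide_inverse del: of_nat_Suc)
      qed
      fix n
      have "norm (r k n) \<le> norm (e (of_real (Re s)) n * Gamma (of_real (Re s) / 2 + of_nat k) / 2)"
        unfolding r_def real_norm_def by (rule abs_Re_le_cmod)
      also have "\<dots> = norm (of_real pi powr (- of_real (Re s) / 2) * Gamma (of_real (Re s) / 2 + of_nat k) / 2 :: complex) * (1 / norm (of_nat (Suc n) powr complex_of_real (Re s)))"
        unfolding e_eq by (simp add: norm_mult norm_divide del: of_nat_Suc)
      also have "norm (of_nat (Suc n) powr complex_of_real (Re s)) = real (Suc n) powr Re s"
        using norm_powr_real_powr[of "of_nat (Suc n)" "complex_of_real (Re s)"] by simp
      finally show "norm (norm (r k n)) \<le> norm (of_real pi powr (- of_real (Re s) / 2) * Gamma (of_real (Re s) / 2 + of_nat k) / 2 :: complex) * (1 / real (Suc n) powr Re s)" by simp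
    qed
    show "summable (\<lambda>n. LINT t|lborel. norm (f n t))"
    proof (rule summable_comparison_test')
      show "summable (\<lambda>n. 4 * norm (r 2 n) + 6 * norm (r 1 n))" by (intro summable_add summable_mult rsum)
      fix n
      have h: "has_bochner_integral lborel (\<lambda>t. 4 * (exp (Re s * t) * (vfun n t ^ 2 * exp (- vfun n t))) + 6 * (exp (Re s * t) * (vfun n t ^ 1 * exp (- vfun n t)))) (4 * r 2 n + 6 * r 1 n)"
        by (intro has_bochner_integral_add has_bochner_integral_mult_right rint)
      have "(LINT t|lborel. norm (f n t)) \<le> (LINT t|lborel. 4 * (exp (Re s * t) * (vfun n t ^ 2 * exp (- vfun n t))) + 6 * (exp (Re s * t) * (vfun n t ^ 1 * exp (- vfun n t))))"
      proof (rule integral_mono)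
        show "integrable lborel (\<lambda>t. norm (f n t))" using integrable.intros[OF f_int] by (rule integrable_norm)
        show "integrable lborel (\<lambda>t. 4 * (exp (Re s * t) * (vfun n t ^ 2 * exp (- vfun n t))) + 6 * (exp (Re s * t) * (vfun n t ^ 1 * exp (- vfun n t))))"
          using integrable.intros[OF h] .
        show "norm (f n t) \<le> 4 * (exp (Re s * t) * (vfun n t ^ 2 * exp (- vfun n t))) + 6 * (exp (Re s * t) * (vfun n t ^ 1 * exp (- vfun n t)))" for t
          using nf[of n t] by (simp add: algebra_simps)
      qed
      also have "\<dots> = 4 * r 2 n + 6 * r 1 n" using has_bochner_integral_integral_eq[OF h] .
      also have "\<dots> \<le> 4 * norm (r 2 n) + 6 * norm (r 1 n)" by simp
      finally have "(LINT t|lborel. norm (f n t)) \<le> 4 * norm (r 2 n) + 6 * norm (r 1 n)" .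
      moreover have "0 \<le> (LINT t|lborel. norm (f n t))" by simp
      ultimately show "norm (LINT t|lborel. norm (f n t)) \<le> 4 * norm (r 2 n) + 6 * norm (r 1 n)" by simp
    qed
  qed
  moreover have "integral\<^sup>L lborel (f n) = 1 / 2 * s * (s - 1) * of_real pi powr (- s / 2) * Gamma (s / 2) * (1 / of_nat (Suc n) powr s)" for n
    using has_bochner_integral_integral_eq[OF f_int[of n]] val[of n] by simp
  moreover have "(\<Sum>n. f n t) = of_real (Phi t) * exp ((s - 1 / 2) * of_real t)" for t
  proof -
    have "(\<lambda>n. complex_of_real (exp (t / 2) * ((4 * vfun n t ^ 2 - 6 * vfun n t) * exp (- vfun n t)))) sums of_real (Phi t)"
      by (intro sums_of_real Phi_sums)
    then have "(\<lambda>n. exp ((s - 1 / 2) * of_real t) * complex_of_real (exp (t / 2) * ((4 * vfun n t ^ 2 - 6 * vfun n t) * exp (- vfun n t)))) sums (exp ((s - 1 / 2) * of_real t) * of_real (Phi t))"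
      by (rule sums_mult)
    moreover have "exp ((s - 1 / 2) * of_real t) * complex_of_real (exp (t / 2) * ((4 * vfun n t ^ 2 - 6 * vfun n t) * exp (- vfun n t))) = f n t" for n
    proof -
      have "exp ((s - 1 / 2) * of_real t) * complex_of_real (exp (t / 2)) = exp ((s - 1 / 2) * of_real t + of_real (t / 2))"
        by (simp only: exp_add exp_of_real)
      also have "(s - 1 / 2) * of_real t + of_real (t / 2) = s * of_real t" by (simp add: algebra_simps)
      finally show ?thesis by (simp only: f_def of_real_mult power_one_right mult.assoc[symmetric])
    qed
    ultimately show ?thesis by (simp add: sums_iff mult.commute)
  qed
  ultimately show ?thesis unfolding Phi_transform_def by simp
qed

section \<open>The power series of Xi and the continuation of zeta\<close>

definition xi_series :: "complex \<Rightarrow> complex" where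
  "xi_series x = (\<Sum>n. of_real (xi_coeff n) * x ^ n)"

lemma xi_series_sums: "(\<lambda>n. of_real (xi_coeff n) * x ^ n) sums xi_series x"
proof -
  have "(\<lambda>n. of_real (xi_coeff n) * csqrt x ^ (2 * n)) sums Phi_transform (csqrt x)"
    by (rule Phi_transform_power_series)
  then have "summable (\<lambda>n. of_real (xi_coeff n) * x ^ n)"
    by (simp add: power_mult sums_iff)
  then show ?thesis unfolding xi_series_def by (rule summable_sums)
qed

lemma Phi_transform_eq: "Phi_transform w = xi_series (w\<^sup>2)"
  using sums_unique2[OF Phi_transform_power_series[of w]] xi_series_sums[of "w\<^sup>2"] by (simp add: power_mult)

lemma holomorphic_xi_series: "xi_series holomorphic_on UNIV"
  by (rule power_series_holomorphic(1)[OF xi_series_sums])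

text \<open>
  The equation \<open>1/2 s (s - 1) \<pi>\<^bsup>-s/2\<^esup> \<Gamma>(s/2) \<zeta>(s) = \<integral> \<Phi>(t) e\<^bsup>(s - 1/2) t\<^esup> dt\<close>, solved for the zeta function
  with \<open>s/2 \<Gamma>(s/2) = \<Gamma>(s/2 + 1)\<close>.
\<close>
definition zeta_cont :: "complex \<Rightarrow> complex" where
  "zeta_cont s = (if s = 1 then 0 else
     xi_series ((s - 1 / 2)\<^sup>2) * of_real pi powr (s / 2) * rGamma (s / 2 + 1) / (s - 1))"

text \<open>\<open>zeta_cont\<close> meets the description because \<open>rGamma\<close> is entire
  and the division is singular only at s = 1. Uniqueness is the identity theorem on the connected
  punctured plane.\<close>

lemma riemann_zeta_eq: "riemann_zeta = zeta_cont"
  unfolding riemann_zeta_def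
proof (rule the_equality)
  have "(\<lambda>s. xi_series ((s - 1 / 2)\<^sup>2)) holomorphic_on - {1}"
    by (rule holomorphic_on_compose_gen[unfolded o_def, OF _ holomorphic_xi_series]) (auto intro!: holomorphic_intros)
  then have "(\<lambda>s. xi_series ((s - 1 / 2)\<^sup>2) * of_real pi powr (s / 2) * rGamma (s / 2 + 1) / (s - 1)) holomorphic_on - {1}"
    by (intro holomorphic_intros) auto
  then have hol: "zeta_cont holomorphic_on - {1}"
    by (rule holomorphic_transform) (auto simp: zeta_cont_def)
  have ser: "(\<lambda>n. 1 / of_nat (Suc n) powr s) sums zeta_cont s" if s: "Re s > 1" for s
  proof -
    define c where "c = 1 / 2 * s * (s - 1) * of_real pi powr (- s / 2) * Gamma (s / 2)"
    have s1: "s \<noteq> 1" "s \<noteq> 0" using s by auto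
    have nz: "s / 2 \<notin> \<int>\<^sub>\<le>\<^sub>0" using s by (auto elim!: nonpos_Ints_cases simp: complex_eq_iff)
    have "Gamma (s / 2) \<noteq> 0" using nz by (simp add: Gamma_eq_zero_iff)
    then have c: "c \<noteq> 0" using s1 by (simp add: c_def)
    have "(\<lambda>n. c * (1 / of_nat (Suc n) powr s)) sums xi_series ((s - 1 / 2)\<^sup>2)"
      using Phi_transform_Dirichlet[OF s] by (simp only: c_def Phi_transform_eq)
    then have "(\<lambda>n. c * (1 / of_nat (Suc n) powr s) / c) sums (xi_series ((s - 1 / 2)\<^sup>2) / c)"
      by (rule sums_divide)
    moreover have "xi_series ((s - 1 / 2)\<^sup>2) / c = zeta_cont s"
    proof -
      have "Gamma (s / 2 + 1) = s / 2 * Gamma (s / 2)" by (rule Gamma_plus1[OF nz])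
      then have r: "rGamma (s / 2 + 1) = 1 / (s / 2 * Gamma (s / 2))" by (simp only: rGamma_inverse_Gamma inverse_eq_divide)
      have p: "of_real pi powr (- s / 2) = inverse (complex_of_real pi powr (s / 2))" by (simp add: powr_minus)
      have "1 / c = of_real pi powr (s / 2) * rGamma (s / 2 + 1) / (s - 1)"
      proof -
        have "1 / (1 / 2 * s * a * inverse q * g) = q * (1 / (s / 2 * g)) / a" for q g a :: complex
          by (cases "s = 0 \<or> a = 0 \<or> q = 0 \<or> g = 0") (auto simp: field_simps)
        then show ?thesis unfolding c_def r p .
      qed
      then have "xi_series ((s - 1 / 2)\<^sup>2) * (1 / c) = xi_series ((s - 1 / 2)\<^sup>2) * (of_real pi powr (s / 2) * rGamma (s / 2 + 1) / (s - 1))"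
        by (simp only:)
      then show ?thesis using s1 by (simp add: zeta_cont_def mult.assoc)
    qed
    ultimately show ?thesis using c by simp
  qed
  then show "zeta_cont holomorphic_on - {1} \<and> (\<forall>s. 1 < Re s \<longrightarrow> (\<lambda>n. 1 / of_nat (Suc n) powr s) sums zeta_cont s) \<and> zeta_cont 1 = 0"
    using hol by (auto simp: zeta_cont_def)
  fix f assume f: "f holomorphic_on - {1} \<and> (\<forall>s. 1 < Re s \<longrightarrow> (\<lambda>n. 1 / of_nat (Suc n) powr s) sums f s) \<and> f 1 = (0::complex)"
  have "f s = zeta_cont s" if s: "s \<noteq> 1" for s
  proof (rule analytic_continuation_open[of "{s. Re s > 1}" "- {1}" f zeta_cont])
    show "open {s. 1 < Re s}" by (rule open_halfspace_Re_gt)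
    have "(2::complex) \<in> {s. 1 < Re s}" by simp
    then show "{s. 1 < Re s} \<noteq> {}" by blast
    show "connected (- {1::complex})" by (intro connected_punctured_universe) simp
    show "f z = zeta_cont z" if "z \<in> {s. 1 < Re s}" for z
      using that f ser[of z] sums_unique2 by blast
  qed (use f hol s in auto)
  then show "f = zeta_cont" using f by (auto simp: zeta_cont_def fun_eq_iff)
qed

text \<open>Exceptional values of the defining product can occur only at integers s. Elsewhere the
  factors cancel, and as the integers are isolated, the limit taken by \<open>remove_sings\<close>
  is the value of the entire series.\<close>

lemma riemann_Xi_eq: "riemann_Xi z = xi_series (- z\<^sup>2)"
proof -
  define G where "G = (\<lambda>z. let s = 1 / 2 + \<i> * z in
     1 / 2 * s * (s - 1) * of_real pi powr (- s / 2) * Gamma (s / 2) * riemann_zeta s)"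
  have G: "G w = xi_series (- w\<^sup>2)" if w: "1 / 2 + \<i> * w \<notin> \<int>" for w
  proof -
    define s where "s = 1 / 2 + \<i> * w"
    have sq: "(s - 1 / 2)\<^sup>2 = - w\<^sup>2" by (simp add: s_def power_mult_distrib)
    have sZ: "s \<notin> \<int>" using w by (simp add: s_def)
    have s1: "s \<noteq> 1" using sZ by auto
    have nz: "s / 2 \<notin> \<int>\<^sub>\<le>\<^sub>0"
    proof
      assume "s / 2 \<in> \<int>\<^sub>\<le>\<^sub>0"
      then have "2 * (s / 2) \<in> \<int>" by (intro Ints_mult) (auto dest: nonpos_Ints_Int)
      then show False using sZ by simp
    qed
    have s0: "s \<noteq> 0" using sZ by auto
    have "Gamma (s / 2 + 1) = s / 2 * Gamma (s / 2)" by (rule Gamma_plus1[OF nz])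
    then have r: "rGamma (s / 2 + 1) = 1 / (s / 2 * Gamma (s / 2))" by (simp only: rGamma_inverse_Gamma inverse_eq_divide)
    have p: "of_real pi powr (- s / 2) = inverse (complex_of_real pi powr (s / 2))" by (simp add: powr_minus)
    have gnz: "Gamma (s / 2) \<noteq> 0" using nz by (simp add: Gamma_eq_zero_iff)
    have "G w = 1 / 2 * s * (s - 1) * of_real pi powr (- s / 2) * Gamma (s / 2) * zeta_cont s"
      by (simp only: G_def s_def Let_def riemann_zeta_eq)
    also have "\<dots> = xi_series ((s - 1 / 2)\<^sup>2)"
      using s1 s0 gnz unfolding zeta_cont_def r p by (simp add: field_simps)
    finally show ?thesis by (simp only: sq)
  qed
  have "open (- (\<int> - {1 / 2 + \<i> * z}))" by (rule open_Compl[OF closed_subset_Ints]) auto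
  then have "open ((\<lambda>w. 1 / 2 + \<i> * w) -` (- (\<int> - {1 / 2 + \<i> * z})))"
    by (rule open_vimage) (intro continuous_intros)
  then have "\<forall>\<^sub>F w in nhds z. w \<in> (\<lambda>w. 1 / 2 + \<i> * w) -` (- (\<int> - {1 / 2 + \<i> * z}))"
    by (rule eventually_nhds_in_open) auto
  then have ev: "\<forall>\<^sub>F w in at z. G w = xi_series (- w\<^sup>2)"
    unfolding eventually_at_filter by eventually_elim (auto intro: G)
  have "(\<lambda>w. xi_series (- w\<^sup>2)) holomorphic_on UNIV"
    by (rule holomorphic_on_compose_gen[unfolded o_def, OF _ holomorphic_xi_series]) (auto intro!: holomorphic_intros)
  then have "isCont (\<lambda>w. xi_series (- w\<^sup>2)) z"
    by (meson continuous_on_eq_continuous_at holomorphic_on_imp_continuous_on open_UNIV UNIV_I)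
  then have "(\<lambda>w. xi_series (- w\<^sup>2)) \<midarrow>z\<rightarrow> xi_series (- z\<^sup>2)" by (simp add: isCont_def)
  then have "G \<midarrow>z\<rightarrow> xi_series (- z\<^sup>2)"
    using tendsto_cong[OF ev] by simp
  then have "remove_sings G z = xi_series (- z\<^sup>2)" by (rule remove_sings_eqI)
  then show ?thesis by (simp only: riemann_Xi_def G_def)
qed

lemma f_flat_eq: "f_flat = xi_series"
  by (rule ext) (simp add: f_flat_def riemann_Xi_eq power_mult_distrib)

lemma fps_expansion_f_flat: "fps_expansion f_flat 0 = Abs_fps (\<lambda>n. of_real (xi_coeff n))"
  unfolding f_flat_eq by (rule fps_expansion_eqI, rule power_series_holomorphic(2)[OF xi_series_sums])

section \<open>The functions B(y)\<close>

definition B_coeff :: "real \<Rightarrow> nat \<Rightarrow> real" where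
  "B_coeff y n = xi_coeff n * y ^ (n * (n + 1) div 2)"

lemma B_series_f_flat: "B_series y f_flat = Abs_fps (\<lambda>n. of_real (B_coeff y n))"
  by (simp add: B_series_def fps_expansion_f_flat B_coeff_def fps_eq_iff)

lemma B_coeff_0 [simp]: "B_coeff y 0 = xi_coeff 0"
  by (simp add: B_coeff_def)

lemma B_coeff_nonneg: "y \<ge> 0 \<Longrightarrow> B_coeff y n \<ge> 0"
  using xi_coeff_pos[of n] by (simp add: B_coeff_def)

lemma B_coeff_le:
  assumes "0 \<le> y" "y \<le> 1"
  shows "B_coeff y n \<le> xi_coeff n"
proof -
  have "y ^ (n * (n + 1) div 2) \<le> 1" by (rule power_le_one[OF assms])
  then have "xi_coeff n * y ^ (n * (n + 1) div 2) \<le> xi_coeff n * 1"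
    using xi_coeff_pos[of n] by (intro mult_left_mono) auto
  then show ?thesis by (simp add: B_coeff_def)
qed

lemma B_summable:
  assumes "0 \<le> y" "y \<le> 1"
  shows "summable (\<lambda>n. of_real (B_coeff y n) * (x::complex) ^ n)"
proof (rule summable_comparison_test')
  have "summable (\<lambda>n. norm (complex_of_real (xi_coeff n) * of_real (norm x) ^ n))"
  proof -
    have "summable (\<lambda>n. complex_of_real (xi_coeff n) * of_real (norm x + 1) ^ n)"
      using xi_series_sums by (rule sums_summable)
    then show ?thesis by (rule powser_insidea) simp
  qed
  then show "summable (\<lambda>n. xi_coeff n * norm x ^ n)"
    using xi_coeff_pos by (simp add: norm_mult norm_power less_imp_le)
  show "norm (of_real (B_coeff y n) * x ^ n) \<le> xi_coeff n * norm x ^ n" for n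
    using B_coeff_nonneg[OF assms(1), of n] B_coeff_le[OF assms, of n]
    by (simp add: norm_mult norm_power mult_right_mono)
qed

lemma B_entire: "0 \<le> y \<Longrightarrow> y \<le> 1 \<Longrightarrow> entire_fps (B_series y f_flat)"
  unfolding entire_fps_def B_series_f_flat fps_conv_radius_def
  by (intro conv_radius_inftyI'') (simp add: B_summable)

lemma B_sums:
  assumes "0 \<le> y" "y \<le> 1"
  shows "(\<lambda>n. of_real (B_coeff y n) * x ^ n) sums eval_fps (B_series y f_flat) x"
  using summable_sums[OF B_summable[OF assms]] by (simp add: eval_fps_def B_series_f_flat)

text \<open>For the lower bound of the coefficients the quotients of consecutive terms are
  (2n+1)(2n+2) / y^(n+1), which tend to 0, so the ratio test gives radius 0.\<close>

lemma B_radius_zero: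
  assumes y: "y > 1"
  shows "fps_conv_radius (B_series y f_flat) = 0"
proof -
  obtain c where c: "c > 0" "\<And>n. c / fact (2 * n) \<le> xi_coeff n" using xi_coeff_lower by blast
  define g where "g = (\<lambda>n. complex_of_real (c / fact (2 * n) * y ^ (n * (n + 1) div 2)))"
  have ratio: "norm (g n) / norm (g (Suc n)) = (2 * real n + 1) * (2 * real n + 2) / y ^ Suc n" for n
  proof -
    have T: "Suc n * (Suc n + 1) div 2 = n * (n + 1) div 2 + Suc n" by (simp add: algebra_simps) 
    have f: "fact (2 * Suc n) = (2 * real n + 2) * ((2 * real n + 1) * fact (2 * n))" by (simp add: algebra_simps)
    show ?thesis unfolding g_def norm_of_real T power_add f using c y
      by (simp add: abs_mult)
  qed
  have lim: "(\<lambda>n. norm (g n) / norm (g (Suc n))) \<longlonglongrightarrow> 0"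
  proof -
    define a where "a = ln y"
    have a: "a > 0" "y = exp a" using y by (auto simp: a_def)
    show ?thesis unfolding ratio a(2) using a(1) by real_asymp
  qed
  have rg: "conv_radius g = 0"
  proof (rule conv_radius_ratio_limit[OF _ _ lim])
    show "(0::ereal) = ereal 0" by simp
    show "\<forall>\<^sub>F n in sequentially. g n \<noteq> 0" using c y by (simp add: g_def)
  qed
  show ?thesis
    unfolding B_series_f_flat fps_conv_radius_def
  proof (rule conv_radius_zeroI)
    fix z :: complex assume z: "z \<noteq> 0"
    show "\<not> summable (\<lambda>n. fps_nth (Abs_fps (\<lambda>n. complex_of_real (B_coeff y n))) n * z ^ n)"
    proof
      assume "summable (\<lambda>n. fps_nth (Abs_fps (\<lambda>n. complex_of_real (B_coeff y n))) n * z ^ n)"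
      then have "summable (\<lambda>n. complex_of_real (B_coeff y n) * z ^ n)" by simp
      \<comment> \<open>Moving to z/2 makes the convergence absolute, as the comparison with the
        lower bound requires.\<close>
      then have "summable (\<lambda>n. norm (complex_of_real (B_coeff y n) * (z / 2) ^ n))"
        by (rule powser_insidea) (use z in \<open>simp add: norm_divide\<close>)
      then have "summable (\<lambda>n. g n * (z / 2) ^ n)"
      proof (rule summable_comparison_test')
        fix n
        have "c / fact (2 * n) * y ^ (n * (n + 1) div 2) \<le> B_coeff y n"
          unfolding B_coeff_def using c(2) y by (intro mult_right_mono) auto
        moreover have "0 \<le> c / fact (2 * n) * y ^ (n * (n + 1) div 2)" using c(1) y by simp
        ultimately have "norm (g n) \<le> norm (complex_of_real (B_coeff y n))"
          unfolding g_def norm_of_real by linarith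
        then show "norm (g n * (z / 2) ^ n) \<le> norm (complex_of_real (B_coeff y n) * (z / 2) ^ n)"
          unfolding norm_mult by (rule mult_right_mono) simp
      qed
      then have "conv_radius g \<ge> ereal (norm (z / 2))" by (rule conv_radius_geI)
      then show False using rg z by (simp add: norm_divide)
    qed
  qed
qed

text \<open>For 0 <= y <= 1 this is equivalent to having only real zeros, and in this form the
  property visibly passes to limits in \<open>y\<close> and to smaller \<open>y\<close>.\<close>

definition B_limit :: "real \<Rightarrow> bool" where
  "B_limit y \<longleftrightarrow> neg_rooted_limit (\<lambda>n. of_real (B_coeff y n))"

lemma B_limit_product:
  assumes "B_limit y" "0 \<le> y" "y \<le> 1"
  shows "laguerre_L1 (eval_fps (B_series y f_flat))"
    "eval_fps (B_series y f_flat) x = 0 \<Longrightarrow> x \<in> \<real> \<and> Re x < 0"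
proof -
  obtain \<sigma> \<alpha> where \<sigma>: "(\<sigma>::real) \<ge> 0" and \<alpha>: "\<And>j::nat. (\<alpha> j :: real) \<ge> 0" "summable \<alpha>" and
    sums: "\<And>x. (\<lambda>n. complex_of_real (B_coeff y n) * x ^ n) sums (of_real (xi_coeff 0) * exp (of_real \<sigma> * x) * (\<Prod>j. 1 + of_real (\<alpha> j) * x))"
    by (rule neg_rooted_limit_product[of "\<lambda>n. of_real (B_coeff y n)" "xi_coeff 0"])
       (use assms(1) xi_coeff_pos in \<open>auto simp: B_limit_def\<close>)
  have eq: "eval_fps (B_series y f_flat) x = of_real (xi_coeff 0) * exp (of_real \<sigma> * x) * (\<Prod>j. 1 + of_real (\<alpha> j) * x)" for x
    by (rule sums_unique2[OF B_sums[OF assms(2,3)] sums])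
  show "laguerre_L1 (eval_fps (B_series y f_flat))"
    unfolding laguerre_L1_def
  proof (intro conjI exI allI)
    show "eval_fps (B_series y f_flat) holomorphic_on UNIV"
      by (rule power_series_holomorphic(1)[OF B_sums[OF assms(2,3)]])
    show "eval_fps (B_series y f_flat) x = of_real (xi_coeff 0) * x ^ 0 * exp (of_real \<sigma> * x) * (\<Prod>j. 1 + of_real (\<alpha> j) * x)" for x
      by (simp add: eq)
  qed (use \<sigma> \<alpha> xi_coeff_pos[of 0] in auto)
  show "eval_fps (B_series y f_flat) x = 0 \<Longrightarrow> x \<in> \<real> \<and> Re x < 0"
    unfolding eq by (rule product_zeros[OF xi_coeff_pos \<alpha>])
qed

text \<open>Nonnegative coefficients and a positive constant term exclude zeros >= 0, so real zeros
  are negative. The growth condition is inherited from A_n because y^(n(n+1)/2) <= 1.\<close>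

lemma B_limit_of_real_zeros:
  assumes y: "0 \<le> y" "y \<le> 1" and real: "only_real_zeros (eval_fps (B_series y f_flat))"
  shows "B_limit y"
  unfolding B_limit_def
proof (rule neg_rooted_limit_of_entire[OF B_sums[OF y]])
  show "complex_of_real (B_coeff y 0) = of_real (xi_coeff 0)" by simp
  show "xi_coeff 0 > 0" by (rule xi_coeff_pos)
  fix x assume x: "eval_fps (B_series y f_flat) x = 0"
  then have xr: "x \<in> \<real>" using real by (auto simp: only_real_zeros_def)
  then obtain r where r: "x = of_real r" by (auto elim: Reals_cases)
  have "r < 0"
  proof (rule ccontr)
    assume "\<not> r < 0"
    have "(\<lambda>n. Re (of_real (B_coeff y n) * x ^ n)) sums Re (eval_fps (B_series y f_flat) x)"
      by (rule sums_Re[OF B_sums[OF y]])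
    moreover have "Re (of_real (B_coeff y n) * x ^ n) = B_coeff y n * r ^ n" for n
      by (simp add: r flip: of_real_power)
    ultimately have s: "(\<lambda>n. B_coeff y n * r ^ n) sums 0"
      using x by (simp only: zero_complex.sel)
    have "0 < (\<Sum>n. B_coeff y n * r ^ n)"
    proof (rule suminf_pos2[OF sums_summable[OF s]])
      show "0 \<le> B_coeff y n * r ^ n" for n using B_coeff_nonneg[OF y(1), of n] \<open>\<not> r < 0\<close> by simp
      show "0 < B_coeff y 0 * r ^ 0" using xi_coeff_pos[of 0] by simp
    qed
    then show False using s by (simp add: sums_iff)
  qed
  then show "x \<in> \<real> \<and> Re x < 0" using xr r by simp
next
  fix \<epsilon> :: real assume \<epsilon>: "\<epsilon> > 0"
  obtain C where C: "\<And>n. xi_coeff n \<le> C * \<epsilon> ^ n / fact n" using xi_coeff_upper[OF \<epsilon>] by blast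
  have "norm (eval_fps (B_series y f_flat) x) \<le> C * exp (\<epsilon> * norm x)" for x
  proof -
    have e: "(\<lambda>n. C * ((\<epsilon> * norm x) ^ n / fact n)) sums (C * exp (\<epsilon> * norm x))"
      using sums_mult[OF exp_converges[of "\<epsilon> * norm x"], of C] by (simp add: divide_inverse mult.commute)
    have le: "norm (of_real (B_coeff y n) * x ^ n) \<le> C * ((\<epsilon> * norm x) ^ n / fact n)" for n
    proof -
      have "norm (of_real (B_coeff y n) * x ^ n) = B_coeff y n * norm x ^ n"
        using B_coeff_nonneg[OF y(1), of n] by (simp add: norm_mult norm_power)
      also have "\<dots> \<le> (C * \<epsilon> ^ n / fact n) * norm x ^ n"
        using order_trans[OF B_coeff_le[OF y] C] by (intro mult_right_mono) auto
      finally show ?thesis by (simp add: power_mult_distrib)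
    qed
    have "norm (eval_fps (B_series y f_flat) x) = norm (\<Sum>n. of_real (B_coeff y n) * x ^ n)"
      using B_sums[OF y, of x] by (simp add: sums_iff)
    also have "\<dots> \<le> (\<Sum>n. C * ((\<epsilon> * norm x) ^ n / fact n))"
      by (rule norm_suminf_le[OF le sums_summable[OF e]])
    also have "\<dots> = C * exp (\<epsilon> * norm x)" using e by (simp add: sums_iff)
    finally show ?thesis .
  qed
  then show "\<exists>B. \<forall>x. norm (eval_fps (B_series y f_flat) x) \<le> B * exp (\<epsilon> * norm x)" by blast
qed

text \<open>\<open>B_coeff y'\<close> arises from \<open>B_coeff y\<close> by the triangular
  multiplier with base \<open>y' / y\<close>, which is at most 1.\<close>

lemma B_limit_mono:
  assumes "B_limit y" "0 \<le> y'" "y' \<le> y"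
  shows "B_limit y'"
proof (cases "y = 0")
  case False
  then have y: "y > 0" using assms by simp
  have "neg_rooted_limit (\<lambda>n. complex_of_real (B_coeff y n) * of_real ((y' / y) ^ (n * (n + 1) div 2)))"
    using assms y unfolding B_limit_def by (intro neg_rooted_limit_triangular) auto
  moreover have "complex_of_real (B_coeff y n) * of_real ((y' / y) ^ (n * (n + 1) div 2)) = of_real (B_coeff y' n)" for n
    unfolding of_real_mult[symmetric] B_coeff_def power_divide using y by simp
  ultimately show ?thesis by (simp add: B_limit_def)
qed (use assms in auto)

text \<open>Hutchinson's quotient is that of A_n divided by y; log-concavity makes it at least 1/y,
  which exceeds 4.\<close>

lemma B_limit_quarter:
  assumes "0 < y" "y < 1 / 4"
  shows "B_limit y"
  unfolding B_limit_def
proof (rule neg_rooted_limit_Hutchinson)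
  show "B_coeff y n > 0" for n using xi_coeff_pos[of n] assms by (simp add: B_coeff_def)
  fix n
  define T where "T = (\<lambda>n::nat. n * (n + 1) div 2)"
  have T: "T (Suc n) = T n + Suc n" "T (n + 2) = T n + Suc n + Suc (Suc n)"
    by (simp_all add: T_def algebra_simps)
  have Bc: "B_coeff y m = xi_coeff m * y ^ T m" for m by (simp only: B_coeff_def T_def)
  have "4 * y * (xi_coeff n * xi_coeff (n + 2)) < 1 * (xi_coeff (n + 1))\<^sup>2"
    using assms xi_coeff_log_concave[of n] xi_coeff_pos by (intro mult_less_le_imp_less) auto
  then have "4 * y * (xi_coeff n * xi_coeff (n + 2)) * y ^ (2 * T n + 2 * Suc n) < (xi_coeff (n + 1))\<^sup>2 * y ^ (2 * T n + 2 * Suc n)"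
    using assms by (intro mult_strict_right_mono) auto
  moreover have "(B_coeff y (Suc n))\<^sup>2 = (xi_coeff (n + 1))\<^sup>2 * y ^ (2 * T n + 2 * Suc n)"
  proof -
    have "2 * T n + 2 * Suc n = 2 * (T n + Suc n)" by simp
    then show ?thesis unfolding Bc T by (simp only: power_mult_distrib power_even_eq Suc_eq_plus1)
  qed
  moreover have "4 * B_coeff y n * B_coeff y (n + 2) = 4 * y * (xi_coeff n * xi_coeff (n + 2)) * y ^ (2 * T n + 2 * Suc n)"
  proof -
    have "y ^ T n * y ^ (T n + Suc n + Suc (Suc n)) = y * y ^ (2 * T n + 2 * Suc n)"
    proof -
      have "T n + (T n + Suc n + Suc (Suc n)) = Suc (2 * T n + 2 * Suc n)" by simp
      then show ?thesis by (simp only: power_add[symmetric] power_Suc)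
    qed
    then have "4 * xi_coeff n * xi_coeff (n + 2) * (y ^ T n * y ^ (T n + Suc n + Suc (Suc n))) =
        4 * xi_coeff n * xi_coeff (n + 2) * (y * y ^ (2 * T n + 2 * Suc n))"
      by (simp only:)
    then show ?thesis unfolding Bc T by (simp only: mult_ac)
  qed
  ultimately show "(B_coeff y (Suc n))\<^sup>2 > 4 * B_coeff y n * B_coeff y (n + 2)" by simp
qed

section \<open>The supremum Theta\<close>

lemma Theta_eq: "Theta = Sup {y. 0 \<le> y \<and> y \<le> 1 \<and> B_limit y}"
proof -
  have "0 \<le> y \<and> entire_fps (B_series y f_flat) \<and> only_real_zeros (eval_fps (B_series y f_flat)) \<longleftrightarrow>
    0 \<le> y \<and> y \<le> 1 \<and> B_limit y" for y
  proof
    assume l: "0 \<le> y \<and> entire_fps (B_series y f_flat) \<and> only_real_zeros (eval_fps (B_series y f_flat))"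
    then have "y \<le> 1" using B_radius_zero[of y] by (cases "y > 1") (auto simp: entire_fps_def)
    then show "0 \<le> y \<and> y \<le> 1 \<and> B_limit y" using l B_limit_of_real_zeros by blast
  next
    assume "0 \<le> y \<and> y \<le> 1 \<and> B_limit y"
    then show "0 \<le> y \<and> entire_fps (B_series y f_flat) \<and> only_real_zeros (eval_fps (B_series y f_flat))"
      using B_limit_product(2) B_entire by (auto simp: only_real_zeros_def)
  qed
  then show ?thesis unfolding Theta_def by simp
qed

lemma le_Theta: "0 \<le> y \<Longrightarrow> y \<le> 1 \<Longrightarrow> B_limit y \<Longrightarrow> y \<le> Theta"
  unfolding Theta_eq by (rule cSup_upper) (auto intro!: bdd_aboveI[of _ 1])

lemma quarter_le_Theta: "1 / 4 \<le> Theta"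
proof (rule ccontr)
  assume "\<not> 1 / 4 \<le> Theta"
  define y where "y = (max 0 Theta + 1 / 4) / 2"
  have "0 < y" "y < 1 / 4" "Theta < y" using \<open>\<not> 1 / 4 \<le> Theta\<close> by (auto simp: y_def max_def)
  then show False using le_Theta[of y] B_limit_quarter[of y] by simp
qed

lemma Theta_le_1: "Theta \<le> 1"
  unfolding Theta_eq using B_limit_quarter[of "1 / 8"] by (intro cSup_least) (auto intro!: exI[of _ "1 / 8"])

text \<open>The supremum is attained: \<open>B_limit\<close> holds below it, each coefficient is
  continuous in \<open>y\<close>, and the property passes to coefficientwise limits.\<close>

lemma B_limit_Theta: "B_limit Theta"
proof -
  have less: "B_limit y" if y: "0 \<le> y" "y < Theta" for y
  proof -
    have ne: "{y. 0 \<le> y \<and> y \<le> 1 \<and> B_limit y} \<noteq> {}" using B_limit_quarter[of "1 / 8"] by (auto intro!: exI[of _ "1 / 8"])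
    obtain y1 where "0 \<le> y1" "B_limit y1" "y < y1"
      using less_cSupD[OF ne y(2)[unfolded Theta_eq]] by blast
    then show ?thesis using B_limit_mono[of y1 y] y by simp
  qed
  have T: "Theta > 0" using quarter_le_Theta by simp
  define y where "y = (\<lambda>k::nat. Theta * (1 - 1 / real (Suc k)))"
  have lim: "y \<longlonglongrightarrow> Theta * (1 - 0)"
    unfolding y_def by (intro tendsto_intros LIMSEQ_Suc[OF lim_1_over_n])
  show ?thesis
    unfolding B_limit_def
  proof (rule neg_rooted_limit_tendstoI[where F = sequentially])
    have "0 \<le> y k" "y k < Theta" for k using T by (auto simp: y_def field_simps)
    then show "\<forall>\<^sub>F k in sequentially. neg_rooted_limit (\<lambda>n. complex_of_real (B_coeff (y k) n))"
      using less unfolding B_limit_def by (intro always_eventually) blast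
    fix n
    have "(\<lambda>k. B_coeff (y k) n) \<longlonglongrightarrow> B_coeff (Theta * (1 - 0)) n"
      unfolding B_coeff_def by (intro tendsto_intros lim)
    then show "(\<lambda>k. complex_of_real (B_coeff (y k) n)) \<longlonglongrightarrow> of_real (B_coeff Theta n)"
      by (intro tendsto_of_real) simp
  qed simp
qed

lemma eval_B_cnj:
  assumes "0 \<le> y" "y \<le> 1"
  shows "eval_fps (B_series y f_flat) (cnj x) = cnj (eval_fps (B_series y f_flat) x)"
proof -
  have "(\<lambda>n. cnj (of_real (B_coeff y n) * x ^ n)) sums cnj (eval_fps (B_series y f_flat) x)"
    using B_sums[OF assms] by (simp only: sums_cnj)
  then have "(\<lambda>n. of_real (B_coeff y n) * cnj x ^ n) sums cnj (eval_fps (B_series y f_flat) x)" by simp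
  then show ?thesis using B_sums[OF assms] sums_unique2 by blast
qed

text \<open>For y = 1 the multiplier is trivial, and the zeros of f and of Xi correspond through x =
  -z^2.\<close>

lemma B_limit_1_iff: "B_limit 1 \<longleftrightarrow> riemann_hypothesis"
proof -
  have e1: "eval_fps (B_series 1 f_flat) x = xi_series x" for x
    using sums_unique2[OF B_sums[of 1 x] ] xi_series_sums[of x] by (simp add: B_coeff_def)
  show ?thesis
  proof
    assume lim: "B_limit 1"
    show riemann_hypothesis
      unfolding riemann_hypothesis_def
    proof (intro allI impI)
      fix z assume "riemann_Xi z = 0"
      then have "- z\<^sup>2 \<in> \<real> \<and> Re (- z\<^sup>2) < 0"
        using B_limit_product(2)[OF lim, of "- z\<^sup>2"] by (simp only: e1 riemann_Xi_eq)
      \<comment> \<open>A negative real -z^2 means that Re z Im z = 0 while |Re z| > |Im z|, which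
        leaves only Im z = 0.\<close>
      then have "Im z * Re z = 0" "(Re z)\<^sup>2 - (Im z)\<^sup>2 > 0" 
        by (auto simp: complex_is_Real_iff power2_eq_square)
      then have "Im z = 0" by (auto simp: power2_eq_square)
      then show "z \<in> \<real>" by (simp add: complex_is_Real_iff)
    qed
  next
    assume rh: riemann_hypothesis
    show "B_limit 1"
    proof (rule B_limit_of_real_zeros)
      show "only_real_zeros (eval_fps (B_series 1 f_flat))"
        unfolding only_real_zeros_def e1
      proof (intro allI impI)
        fix x assume "xi_series x = 0"
        then have "riemann_Xi (\<i> * csqrt x) = 0" by (simp add: riemann_Xi_eq power_mult_distrib)
        then have "\<i> * csqrt x \<in> \<real>" using rh by (auto simp: riemann_hypothesis_def)
        then have "- (\<i> * csqrt x)\<^sup>2 \<in> \<real>" by (intro Reals_minus Reals_power)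
        then show "x \<in> \<real>" by (simp add: power_mult_distrib)
      qed
    qed auto
  qed
qed

text \<open>Written as a power series with coefficients 0 and 1, the lacunary series is continuous.
  At 1/2 the exponents 1 and 4 alone already contribute 1/2 + 1/16, so the root lies below 1/2;
  termwise monotonicity makes it unique.\<close>

lemma rho_o_bounds: "0 < rho_o \<and> rho_o < 1 / 2"
proof -
  define c :: "nat \<Rightarrow> real" where "c = (\<lambda>m. if m \<in> range (\<lambda>k. (Suc k)\<^sup>2) then 1 else 0)"
  \<comment> \<open>The radius 3/4 lies between 1/2, the right end of the interval searched, and 1,
    the radius of convergence.\<close>
  have sm: "summable (\<lambda>m. c m * (3 / 4) ^ m)"
    by (rule summable_comparison_test'[of "\<lambda>m. (3 / 4) ^ m" 0]) (auto simp: c_def intro: summable_geometric)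
  have iff: "(\<lambda>k. \<rho> ^ ((Suc k)\<^sup>2)) sums s \<longleftrightarrow> (\<lambda>m. c m * \<rho> ^ m) sums s" for \<rho> s :: real
  proof -
    have "strict_mono (\<lambda>k::nat. (Suc k)\<^sup>2)" by (rule strict_monoI) (simp add: power_strict_mono)
    then have "(\<lambda>k. c ((Suc k)\<^sup>2) * \<rho> ^ ((Suc k)\<^sup>2)) sums s \<longleftrightarrow> (\<lambda>m. c m * \<rho> ^ m) sums s"
      by (rule sums_mono_reindex) (auto simp: c_def)
    then show ?thesis by (simp add: c_def)
  qed
  define h where "h = (\<lambda>\<rho>. \<Sum>m. c m * \<rho> ^ m)"
  have hs: "(\<lambda>m. c m * \<rho> ^ m) sums h \<rho>" if "\<bar>\<rho>\<bar> < 3 / 4" for \<rho>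
    unfolding h_def by (intro summable_sums powser_inside[OF sm]) (use that in simp)
  have cont: "isCont h \<rho>" if "\<bar>\<rho>\<bar> < 3 / 4" for \<rho>
    unfolding h_def by (rule isCont_powser[OF sm]) (use that in simp)
  have h0: "h 0 = 0" unfolding h_def by (auto simp: powser_zero c_def power2_eq_square)
  have h1: "1 / 2 < h (1 / 2)"
  proof -
    have "(\<Sum>m\<in>{1, 4}. c m * (1 / 2) ^ m) \<le> h (1 / 2)"
      unfolding h_def using hs[of "1 / 2"] by (intro sum_le_suminf) (auto simp: sums_iff c_def)
    moreover have "c 1 = 1" "c 4 = 1"
    proof -
      have "(1::nat) = (Suc 0)\<^sup>2" "(4::nat) = (Suc 1)\<^sup>2" by (simp_all add: power2_eq_square)
      then show "c 1 = 1" "c 4 = 1" unfolding c_def by (metis rangeI)+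
    qed
    ultimately show ?thesis by (simp add: eval_nat_numeral)
  qed
  have "\<exists>\<rho>\<ge>0. \<rho> \<le> 1 / 2 \<and> h \<rho> = 1 / 2"
    using h0 h1 cont by (intro IVT) auto
  then obtain \<rho> where \<rho>: "0 \<le> \<rho>" "\<rho> \<le> 1 / 2" "h \<rho> = 1 / 2" by blast
  have "\<rho> \<noteq> 0" using \<rho>(3) h0 by auto
  moreover have "\<rho> \<noteq> 1 / 2"
  proof
    assume e: "\<rho> = 1 / 2"
    show False using \<rho>(3) h1 unfolding e by linarith
  qed
  ultimately have \<rho>': "0 < \<rho>" "\<rho> < 1 / 2" using \<rho> by auto
  have sol: "\<rho> > 0 \<and> (\<lambda>k. \<rho> ^ ((Suc k)\<^sup>2)) sums (1 / 2)"
    using \<rho>' hs[of \<rho>] \<rho>(3) iff by simp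
  have uniq: "False" if "0 < a" "a < b" "(\<lambda>k. a ^ ((Suc k)\<^sup>2)) sums (1 / 2)" "(\<lambda>k. b ^ ((Suc k)\<^sup>2)) sums (1 / 2)" for a b :: real
  proof -
    have s: "(\<lambda>k. b ^ ((Suc k)\<^sup>2) - a ^ ((Suc k)\<^sup>2)) sums (1 / 2 - 1 / 2)" by (rule sums_diff[OF that(4,3)])
    have "0 < (\<Sum>k. b ^ ((Suc k)\<^sup>2) - a ^ ((Suc k)\<^sup>2))"
      by (rule suminf_pos2[OF sums_summable[OF s], of 0]) (use that in \<open>auto intro: power_mono\<close>)
    then show False using s by (simp add: sums_iff)
  qed
  have "rho_o = \<rho>"
    unfolding rho_o_def
  proof (rule the_equality)
    show "\<rho> > 0 \<and> (\<lambda>k. \<rho> ^ ((Suc k)\<^sup>2)) sums (1 / 2)" by (rule sol)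
    fix r :: real assume r: "r > 0 \<and> (\<lambda>k. r ^ ((Suc k)\<^sup>2)) sums (1 / 2)"
    show "r = \<rho>" using uniq[of r \<rho>] uniq[of \<rho> r] r sol by (cases r \<rho> rule: linorder_cases) auto
  qed
  then show ?thesis using \<rho>' by simp
qed

theorem theorem4p3:
  shows
    "(\<forall>y::real. 0 \<le> y \<and> y \<le> Theta \<longrightarrow>
        entire_fps (B_series y f_flat) \<and>
        laguerre_L1 (eval_fps (B_series y f_flat)) \<and>
        (\<forall>x. eval_fps (B_series y f_flat) x = 0 \<longrightarrow> x \<in> \<real> \<and> Re x < 0)) \<and>
     (\<forall>y::real. Theta < 1 \<and> Theta < y \<and> y \<le> 1 \<longrightarrow>
        entire_fps (B_series y f_flat) \<and>
        (\<exists>z w. z \<noteq> w \<and> z \<notin> \<real> \<and> w \<notin> \<real> \<and>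
           eval_fps (B_series y f_flat) z = 0 \<and> eval_fps (B_series y f_flat) w = 0)) \<and>
     (\<forall>y::real. y > 1 \<longrightarrow> fps_conv_radius (B_series y f_flat) = 0) \<and>
     (Theta = 1 \<longleftrightarrow> riemann_hypothesis) \<and>
     (0 < rho_o\<^sup>2 \<and> rho_o\<^sup>2 < 1 / 4 \<and> 1 / 4 \<le> Theta \<and> Theta \<le> 1)"
proof (intro conjI allI impI)
  fix y assume y: "0 \<le> y \<and> y \<le> Theta"
  then have y1: "0 \<le> y" "y \<le> 1" using Theta_le_1 by auto
  have lim: "B_limit y" using B_limit_mono[OF B_limit_Theta] y by blast
  show "entire_fps (B_series y f_flat)" by (rule B_entire[OF y1])
  show "laguerre_L1 (eval_fps (B_series y f_flat))" by (rule B_limit_product(1)[OF lim y1])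
  fix x assume "eval_fps (B_series y f_flat) x = 0"
  then show "x \<in> \<real>" "Re x < 0" using B_limit_product(2)[OF lim y1] by auto
next
  fix y assume y: "Theta < 1 \<and> Theta < y \<and> y \<le> 1"
  then have y1: "0 \<le> y" "y \<le> 1" using quarter_le_Theta by auto
  show "entire_fps (B_series y f_flat)" by (rule B_entire[OF y1])
  have "\<not> B_limit y" using le_Theta[OF y1] y by auto
  then obtain z where z: "eval_fps (B_series y f_flat) z = 0" "z \<notin> \<real>"
    using B_limit_of_real_zeros[OF y1] by (auto simp: only_real_zeros_def)
  \<comment> \<open>The coefficients are real, so the conjugate of a nonreal zero is a second
    one.\<close>
  show "\<exists>z w. z \<noteq> w \<and> z \<notin> \<real> \<and> w \<notin> \<real> \<and> eval_fps (B_series y f_flat) z = 0 \<and> eval_fps (B_series y f_flat) w = 0"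
  proof (intro exI conjI)
    show "z \<noteq> cnj z" "cnj z \<notin> \<real>" using z(2) by (auto simp: Reals_cnj_iff complex_is_Real_iff)
    show "eval_fps (B_series y f_flat) (cnj z) = 0" using z(1) by (simp add: eval_B_cnj[OF y1])
  qed (use z in auto)
next
  show "fps_conv_radius (B_series y f_flat) = 0" if "y > 1" for y by (rule B_radius_zero[OF that])
next
  show "Theta = 1 \<longleftrightarrow> riemann_hypothesis"
    unfolding B_limit_1_iff[symmetric] using B_limit_Theta le_Theta[of 1] Theta_le_1 by force
next
  show "0 < rho_o\<^sup>2" using rho_o_bounds by simp
  have "rho_o\<^sup>2 < (1 / 2)\<^sup>2" using rho_o_bounds by (intro power_strict_mono) auto
  then show "rho_o\<^sup>2 < 1 / 4" by (simp add: power2_eq_square)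
qed (rule quarter_le_Theta Theta_le_1)+

end
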